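(* For all sufficiently large $d$, the antisymmetric state $\alpha_d=\frac{\mathbb 1-F}{d(d-1)}$ on $\mathbb C^d\otimes\mathbb C^d$ satisfies $$E_{d,\mathrm{DNE}}(\alpha_d)<E_{d,\mathrm{NE}}(\alpha_d).$$
   Context: $F$ is the swap operator, $F|\psi\rangle|\phi\rangle=|\phi\rangle|\psi\rangle$. All Hilbert spaces are finite-dimensional. $\mathcal S=\mathcal S(A\!:\!B)$ is the set of separable states on $AB$ (finite convex combinations of product states); $\mathrm{cone}(\mathcal S)=\{\lambda\sigma:\lambda\ge0,\sigma\in\mathcal S\}$. The adjoint $\Xi^\dagger$ is defined by $\mathrm{Tr}[X\,\Xi(Y)]=\mathrm{Tr}[\Xi^\dagger(X)Y]$. $\mathrm{NE}(AB\to A'B')$ (non-entangling operations) is the set of completely positive trace-preserving maps $\Xi$ with $\Xi(\mathcal S(A\!:\!B))\subseteq\mathcal S(A'\!:\!B')$; $\mathrm{DNE}(AB\to A'B')$ (dually non-entangling operations) is the subset of those that additionally satisfy $\Xi^\dagger(\mathcal S(A'\!:\!B'))\subseteq\mathrm{cone}(\mathcal S(A\!:\!B))$. Let $\Phi_2=|\Phi_2\rangle\langle\Phi_2|$, $|\Phi_2\rangle=\frac1{\sqrt2}(|00\rangle+|11\rangle)$ on a two-qubit system $A_0B_0$; $\Phi_2^{\otimes m}$ is bipartite across $A_0^m:B_0^m$. For $\mathcal F\in\{\mathrm{NE},\mathrm{DNE}\}$ and $\varepsilon\in[0,1)$, $$E^{(1),\varepsilon}_{d,\mathcal F}(\rho)=\max\Big\{m\in\mathbb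 N:\inf_{\Theta\in\mathcal F(AB\to A_0^mB_0^m)}\tfrac12\|\Theta(\rho)-\Phi_2^{\otimes m}\|_1\le\varepsilon\Big\},$$ and the distillable entanglement is $E_{d,\mathcal F}(\rho)=\lim_{\varepsilon\to0^+}\liminf_{n\to\infty}\frac1nE^{(1),\varepsilon}_{d,\mathcal F}(\rho^{\otimes n})$, where $\rho^{\otimes n}$ is regarded as a bipartite state across $A^n:B^n$. *)

theory Defs
  imports
    "Jordan_Normal_Form.Schur_Decomposition"
    "HOL-Library.Extended_Real"
    "HOL-Library.Liminf_Limsup"
begin

text \<open>
  Operators on an n-dimensional Hilbert space are the elements of \<^term>\<open>carrier_mat n n\<close> over
  the complex numbers. A bipartite system with local dimensions a and b has dimension a * b; the
  basis vector |i>|j> carries the index i * b + j.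
\<close>

type_synonym op = "complex mat"

definition mtrace :: "op \<Rightarrow> complex" where
  "mtrace M = (\<Sum>i<dim_row M. M $$ (i, i))"

text \<open>
  Below, 0 \<le> z for a complex z is the order of \<^theory>\<open>HOL-Library.Complex_Order\<close>: z is real and
  nonnegative. Positive semidefinite matrices are therefore Hermitian.
\<close>

definition psd :: "nat \<Rightarrow> op \<Rightarrow> bool" where
  "psd n M \<longleftrightarrow> M \<in> carrier_mat n n \<and> (\<forall>v\<in>carrier_vec n. 0 \<le> (M *\<^sub>v v) \<bullet>c v)"

definition psd_sqrt :: "op \<Rightarrow> op" where
  "psd_sqrt M = (THE P. psd (dim_row M) P \<and> P * P = M)"

definition trace_norm :: "op \<Rightarrow> real" where
  "trace_norm M = Re (mtrace (psd_sqrt (mat_adjoint M * M)))"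

definition density :: "nat \<Rightarrow> op set" where
  "density n = {\<rho>. psd n \<rho> \<and> mtrace \<rho> = 1}"

definition tensor_vec :: "complex vec \<Rightarrow> complex vec \<Rightarrow> complex vec" where
  "tensor_vec v w = vec (dim_vec v * dim_vec w) (\<lambda>i. v $ (i div dim_vec w) * w $ (i mod dim_vec w))"

definition kron :: "op \<Rightarrow> op \<Rightarrow> op" where
  "kron M N = mat (dim_row M * dim_row N) (dim_col M * dim_col N)
     (\<lambda>(i, j). M $$ (i div dim_row N, j div dim_col N) * N $$ (i mod dim_row N, j mod dim_col N))"

definition ket_bra :: "complex vec \<Rightarrow> op" where
  "ket_bra v = mat (dim_vec v) (dim_vec v) (\<lambda>(i, j). v $ i * cnj (v $ j))"

text \<open>
  Tensor product of an operator M on A:B with an operator N on A':B', regarded as an operator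
  on AA':BB' (see \<open>bip_tensor_kron\<close>). For an index r of AA':BB', \<^term>\<open>r div (b * b')\<close> is
  the index of AA' and \<^term>\<open>r mod (b * b')\<close> that of BB'.
\<close>

definition idx_fst :: "nat \<Rightarrow> nat \<Rightarrow> nat \<Rightarrow> nat \<Rightarrow> nat" where
  "idx_fst b a' b' r = r div (b * b') div a' * b + r mod (b * b') div b'"

definition idx_snd :: "nat \<Rightarrow> nat \<Rightarrow> nat \<Rightarrow> nat \<Rightarrow> nat" where
  "idx_snd b a' b' r = r div (b * b') mod a' * b' + r mod (b * b') mod b'"

definition bip_tensor :: "nat \<Rightarrow> nat \<Rightarrow> nat \<Rightarrow> nat \<Rightarrow> op \<Rightarrow> op \<Rightarrow> op" where
  "bip_tensor a b a' b' M N = mat (a * a' * (b * b')) (a * a' * (b * b'))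
     (\<lambda>(r, c). M $$ (idx_fst b a' b' r, idx_fst b a' b' c) * N $$ (idx_snd b a' b' r, idx_snd b a' b' c))"

text \<open>The n-th tensor power of an operator on A:B, as an operator on A^n:B^n.\<close>

fun bip_power :: "nat \<Rightarrow> nat \<Rightarrow> op \<Rightarrow> nat \<Rightarrow> op" where
  "bip_power a b M 0 = 1\<^sub>m 1"
| "bip_power a b M (Suc n) = bip_tensor a b (a ^ n) (b ^ n) M (bip_power a b M n)"

definition separable :: "nat \<Rightarrow> nat \<Rightarrow> op set" where
  "separable a b =
     {mat (a * b) (a * b) (\<lambda>ij. \<Sum>k<K. complex_of_real (p k) * kron (\<rho> k) (\<tau> k) $$ ij) | (K :: nat) p \<rho> \<tau>.
        (\<forall>k<K. 0 \<le> p k \<and> \<rho> k \<in> density a \<and> \<tau> k \<in> density b) \<and> (\<Sum>k<K. p k) = 1}"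

definition state_cone :: "op set \<Rightarrow> op set" where
  "state_cone S = {complex_of_real l \<cdot>\<^sub>m \<sigma> | l \<sigma>. 0 \<le> l \<and> \<sigma> \<in> S}"

definition linear_op_map :: "nat \<Rightarrow> nat \<Rightarrow> (op \<Rightarrow> op) \<Rightarrow> bool" where
  "linear_op_map n m \<Xi> \<longleftrightarrow>
     (\<forall>X\<in>carrier_mat n n. \<Xi> X \<in> carrier_mat m m) \<and>
     (\<forall>X\<in>carrier_mat n n. \<forall>Y\<in>carrier_mat n n. \<Xi> (X + Y) = \<Xi> X + \<Xi> Y) \<and>
     (\<forall>c. \<forall>X\<in>carrier_mat n n. \<Xi> (c \<cdot>\<^sub>m X) = c \<cdot>\<^sub>m \<Xi> X)"

text \<open>
  \<open>ampliation k n m \<Xi>\<close> is the tensor product of the identity map on k \<times> k matrices with a map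
  \<open>\<Xi>\<close> from n \<times> n to m \<times> m matrices: it applies \<open>\<Xi>\<close> to each n \<times> n block (see \<open>ampliation_kron\<close>).
\<close>

definition ampliation :: "nat \<Rightarrow> nat \<Rightarrow> nat \<Rightarrow> (op \<Rightarrow> op) \<Rightarrow> op \<Rightarrow> op" where
  "ampliation k n m \<Xi> X = mat (k * m) (k * m) (\<lambda>(r, c).
     \<Xi> (mat n n (\<lambda>(i, j). X $$ (r div m * n + i, c div m * n + j))) $$ (r mod m, c mod m))"

definition completely_positive :: "nat \<Rightarrow> nat \<Rightarrow> (op \<Rightarrow> op) \<Rightarrow> bool" where
  "completely_positive n m \<Xi> \<longleftrightarrow> linear_op_map n m \<Xi> \<and>
     (\<forall>k X. psd (k * n) X \<longrightarrow> psd (k * m) (ampliation k n m \<Xi> X))"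

definition trace_preserving :: "nat \<Rightarrow> (op \<Rightarrow> op) \<Rightarrow> bool" where
  "trace_preserving n \<Xi> \<longleftrightarrow> (\<forall>X\<in>carrier_mat n n. mtrace (\<Xi> X) = mtrace X)"

definition CPTP :: "nat \<Rightarrow> nat \<Rightarrow> (op \<Rightarrow> op) set" where
  "CPTP n m = {\<Xi>. completely_positive n m \<Xi> \<and> trace_preserving n \<Xi>}"

definition adjoint_map :: "nat \<Rightarrow> (op \<Rightarrow> op) \<Rightarrow> op \<Rightarrow> op" where
  "adjoint_map n \<Xi> X =
     (THE Z. Z \<in> carrier_mat n n \<and> (\<forall>Y\<in>carrier_mat n n. mtrace (X * \<Xi> Y) = mtrace (Z * Y)))"

text \<open>
  Arguments of NE and DNE: the local dimensions of A, B, A', B'. The maps are total functions on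
  matrices of all sizes; their values outside \<^term>\<open>carrier_mat (a * b) (a * b)\<close> play no role.
\<close>

definition NE :: "nat \<Rightarrow> nat \<Rightarrow> nat \<Rightarrow> nat \<Rightarrow> (op \<Rightarrow> op) set" where
  "NE a b a' b' = {\<Xi> \<in> CPTP (a * b) (a' * b'). \<Xi> ` separable a b \<subseteq> separable a' b'}"

definition DNE :: "nat \<Rightarrow> nat \<Rightarrow> nat \<Rightarrow> nat \<Rightarrow> (op \<Rightarrow> op) set" where
  "DNE a b a' b' =
     {\<Xi> \<in> NE a b a' b'. adjoint_map (a * b) \<Xi> ` separable a' b' \<subseteq> state_cone (separable a b)}"

definition phi2_vec :: "complex vec" where
  "phi2_vec = complex_of_real (1 / sqrt 2) \<cdot>\<^sub>v
     (tensor_vec (unit_vec 2 0) (unit_vec 2 0) + tensor_vec (unit_vec 2 1) (unit_vec 2 1))"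

definition Phi2 :: op where
  "Phi2 = ket_bra phi2_vec"

text \<open>
  \<open>\<F>\<close> is one of NE, DNE. For \<open>0 \<le> \<epsilon> < 1\<close> and a state \<open>\<rho>\<close> the set below is finite and contains 0.
  Indeed \<open>\<rho> \<le> a b \<pi>\<close> for the maximally mixed, hence separable, state \<open>\<pi>\<close>, so for
  every \<open>\<Theta>\<close> in NE the overlap of \<open>\<Theta> \<rho>\<close> with the target is at most \<open>a b / 2^m\<close>, while a
  trace distance at most \<open>\<epsilon>'\<close> forces it to be at least \<open>1 - \<epsilon>'\<close>. For m = 0 the trace is a feasible map.
\<close>

definition one_shot_distillable ::
  "(nat \<Rightarrow> nat \<Rightarrow> nat \<Rightarrow> nat \<Rightarrow> (op \<Rightarrow> op) set) \<Rightarrow> nat \<Rightarrow> nat \<Rightarrow> real \<Rightarrow> op \<Rightarrow> nat" where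
  "one_shot_distillable \<F> a b \<epsilon> \<rho> =
     Max {m. (INF \<Theta>\<in>\<F> a b (2 ^ m) (2 ^ m). 1 / 2 * trace_norm (\<Theta> \<rho> - bip_power 2 2 Phi2 m)) \<le> \<epsilon>}"

text \<open>
  The lower limit is taken in the extended reals, and it is monotone in \<open>\<epsilon>\<close>, so the limit exists.
\<close>

definition distillable_entanglement ::
  "(nat \<Rightarrow> nat \<Rightarrow> nat \<Rightarrow> nat \<Rightarrow> (op \<Rightarrow> op) set) \<Rightarrow> nat \<Rightarrow> nat \<Rightarrow> op \<Rightarrow> ereal" where
  "distillable_entanglement \<F> a b \<rho> =
     Lim (at_right 0) (\<lambda>\<epsilon>. liminf (\<lambda>n.
       ereal (1 / real n * real (one_shot_distillable \<F> (a ^ n) (b ^ n) \<epsilon> (bip_power a b \<rho> n)))))"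

text \<open>The swap operator on the tensor square of a d-dimensional space; see \<open>swap_op_tensor\<close>.\<close>

definition swap_op :: "nat \<Rightarrow> op" where
  "swap_op d = mat (d * d) (d * d) (\<lambda>(r, c). if r div d = c mod d \<and> r mod d = c div d then 1 else 0)"

definition antisym_state :: "nat \<Rightarrow> op" where
  "antisym_state d = 1 / (of_nat d * (of_nat d - 1)) \<cdot>\<^sub>m (1\<^sub>m (d * d) - swap_op d)"


lemma swap_op_tensor:
  assumes v: "v \<in> carrier_vec d" and w: "w \<in> carrier_vec d"
  shows "swap_op d *\<^sub>v tensor_vec v w = tensor_vec w v"
proof (rule eq_vecI)
  have dv: "dim_vec v = d" "dim_vec w = d" using v w by auto
  show "dim_vec (swap_op d *\<^sub>v tensor_vec v w) = dim_vec (tensor_vec w v)"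
    by (simp add: swap_op_def tensor_vec_def dv)
  fix i assume "i < dim_vec (tensor_vec w v)"
  then have i: "i < d * d" by (simp add: tensor_vec_def dv)
  then have d: "d > 0" by (cases d) auto
  let ?k = "(i mod d) * d + i div d"
  have id: "i div d < d" using i by (simp add: less_mult_imp_div_less)
  have im: "i mod d < d" using d by simp
  have k: "?k < d * d"
  proof -
    have "?k < (i mod d + 1) * d" using id by simp
    also have "\<dots> \<le> d * d" using im by (intro mult_right_mono) auto
    finally show ?thesis .
  qed
  have eq: "(i div d = c mod d \<and> i mod d = c div d) \<longleftrightarrow> c = ?k" if "c < d * d" for c
  proof
    assume "i div d = c mod d \<and> i mod d = c div d"
    then show "c = ?k" by (simp only: div_mult_mod_eq)
  next
    assume "c = ?k"
    then show "i div d = c mod d \<and> i mod d = c div d" using id d by simp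
  qed
  have "(swap_op d *\<^sub>v tensor_vec v w) $ i =
      (\<Sum>c = 0..<d * d. (if i div d = c mod d \<and> i mod d = c div d then 1 else 0) * (v $ (c div d) * w $ (c mod d)))"
    using i by (simp add: swap_op_def tensor_vec_def dv scalar_prod_def)
  also have "\<dots> = (\<Sum>c = 0..<d * d. if c = ?k then v $ (c div d) * w $ (c mod d) else 0)"
    by (intro sum.cong refl) (auto simp: eq)
  also have "\<dots> = v $ (?k div d) * w $ (?k mod d)"
    using k by simp
  also have "\<dots> = tensor_vec w v $ i"
    using i id im d by (simp add: tensor_vec_def dv)
  finally show "(swap_op d *\<^sub>v tensor_vec v w) $ i = tensor_vec w v $ i" .
qed

lemma bip_tensor_kron:
  assumes "M \<in> carrier_mat a a" "N \<in> carrier_mat b b" "M' \<in> carrier_mat a' a'" "N' \<in> carrier_mat b' b'"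
  shows "bip_tensor a b a' b' (kron M N) (kron M' N') = kron (kron M M') (kron N N')"
proof (rule eq_matI)
  have dims [simp]: "dim_row M = a" "dim_col M = a" "dim_row N = b" "dim_col N = b"
    "dim_row M' = a'" "dim_col M' = a'" "dim_row N' = b'" "dim_col N' = b'"
    using assms by auto
  show "dim_row (bip_tensor a b a' b' (kron M N) (kron M' N')) = dim_row (kron (kron M M') (kron N N'))"
    "dim_col (bip_tensor a b a' b' (kron M N) (kron M' N')) = dim_col (kron (kron M M') (kron N N'))"
    by (simp_all add: bip_tensor_def kron_def)
  fix i j
  assume "i < dim_row (kron (kron M M') (kron N N'))" "j < dim_col (kron (kron M M') (kron N N'))"
  then have ij: "i < a * a' * (b * b')" "j < a * a' * (b * b')" by (simp_all add: kron_def)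
  then have pos: "a > 0" "b > 0" "a' > 0" "b' > 0"
    by (cases a; cases b; cases a'; cases b'; simp)+
  have bnd: "p * n + q < m * n" if "p < m" "q < n" for p q m n :: nat
  proof -
    have "p * n + q < (p + 1) * n" using that by simp
    also have "\<dots> \<le> m * n" using that by (intro mult_right_mono) auto
    finally show ?thesis .
  qed
  have parts: "r div (b * b') < a * a'" "r div (b * b') div a' < a" "r div (b * b') mod a' < a'"
    "r mod (b * b') < b * b'" "r mod (b * b') div b' < b" "r mod (b * b') mod b' < b'"
    if "r < a * a' * (b * b')" for r
  proof -
    show 1: "r div (b * b') < a * a'" using that by (simp add: less_mult_imp_div_less)
    then show "r div (b * b') div a' < a" by (simp add: less_mult_imp_div_less)
    show 2: "r mod (b * b') < b * b'" using pos by simp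
    then show "r mod (b * b') div b' < b" by (simp add: less_mult_imp_div_less)
  qed (use pos in simp_all)
  note pi = parts[OF ij(1)] and pj = parts[OF ij(2)]
  have "bip_tensor a b a' b' (kron M N) (kron M' N') $$ (i, j) =
      kron M N $$ (idx_fst b a' b' i, idx_fst b a' b' j) * kron M' N' $$ (idx_snd b a' b' i, idx_snd b a' b' j)"
    using ij by (simp add: bip_tensor_def)
  also have "\<dots> = M $$ (i div (b * b') div a', j div (b * b') div a') * N $$ (i mod (b * b') div b', j mod (b * b') div b')
      * (M' $$ (i div (b * b') mod a', j div (b * b') mod a') * N' $$ (i mod (b * b') mod b', j mod (b * b') mod b'))"
    using bnd[OF pi(2) pi(5)] bnd[OF pj(2) pj(5)] bnd[OF pi(3) pi(6)] bnd[OF pj(3) pj(6)] pi pj pos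
    by (simp add: kron_def idx_fst_def idx_snd_def)
  also have "\<dots> = kron (kron M M') (kron N N') $$ (i, j)"
    using ij pi pj by (simp add: kron_def)
  finally show "bip_tensor a b a' b' (kron M N) (kron M' N') $$ (i, j) = kron (kron M M') (kron N N') $$ (i, j)" .
qed

lemma ampliation_kron:
  assumes Y: "Y \<in> carrier_mat k k" and X: "X \<in> carrier_mat n n" and lin: "linear_op_map n m \<Xi>"
  shows "ampliation k n m \<Xi> (kron Y X) = kron Y (\<Xi> X)"
proof (rule eq_matI)
  have \<Xi>X: "\<Xi> X \<in> carrier_mat m m" using lin X by (auto simp: linear_op_map_def)
  show "dim_row (ampliation k n m \<Xi> (kron Y X)) = dim_row (kron Y (\<Xi> X))"
    "dim_col (ampliation k n m \<Xi> (kron Y X)) = dim_col (kron Y (\<Xi> X))"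
    using Y \<Xi>X by (auto simp: ampliation_def kron_def)
  fix i j assume "i < dim_row (kron Y (\<Xi> X))" "j < dim_col (kron Y (\<Xi> X))"
  then have ij: "i < k * m" "j < k * m" using Y \<Xi>X by (auto simp: kron_def)
  then have m: "m > 0" by (cases m) auto
  have id: "i div m < k" "j div m < k" using ij by (simp_all add: less_mult_imp_div_less)
  have bnd: "p * n + q < k * n" if "p < k" "q < n" for p q :: nat
  proof -
    have "p * n + q < (p + 1) * n" using that by simp
    also have "\<dots> \<le> k * n" using that by (intro mult_right_mono) auto
    finally show ?thesis .
  qed
  have "mat n n (\<lambda>(r, c). kron Y X $$ (i div m * n + r, j div m * n + c)) = Y $$ (i div m, j div m) \<cdot>\<^sub>m X"
    using Y X id bnd by (intro eq_matI) (auto simp: kron_def)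
  then show "ampliation k n m \<Xi> (kron Y X) $$ (i, j) = kron Y (\<Xi> X) $$ (i, j)"
    using ij Y X \<Xi>X lin m by (auto simp: ampliation_def kron_def linear_op_map_def)
qed

end

theory Submission
  imports Defs "HOL-Analysis.Convex" "HOL-Analysis.Elementary_Topology"
begin

text \<open>
  Both rates are governed by the overlap of \<open>P^(\<otimes>n)\<close>, P the antisymmetric projector, with separable
  operators.

  NE: measuring \<open>P^(\<otimes>n)\<close> never fails on the n copies of the state; prepare the maximally entangled
  state of Schmidt rank K on success and a separable state orthogonal to it on failure. This is
  non-entangling as soon as all separable states pass the test with probability at most 1/K. The
  passing probability is at most \<open>((d-1)/(d+2))^n\<close>: on the range of P, the swap F of A with a copy A'
  has expectations between -1 and 1/2, while the partial transpose of F on A' has expectations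
  between 0 and d/2, so that a suitable \<open>W = \<alpha> - \<beta> F\<close> satisfies \<open>F^(\<otimes>n) \<le> W^(\<otimes>n)\<close> and its partial
  transpose is bounded by \<open>\<alpha>\<close> in absolute value.

  DNE: pull the separable state of overlap 1/K with the target back through the adjoint. The result
  E is separable, so partial transposition shows that its expectation in n copies of the
  antisymmetric state is at most \<open>((d+1)/(d-1))^n\<close> times that in n copies of the normalized symmetric
  projector, which is separable. The former is at least of order 1/K and the latter at most 2/K^2.

  Hence the rates are separated by \<open>log ((d+1)/(d-1)) < log ((d+2)/(d-1))\<close>.
\<close>



section \<open>Positive kernels and the spectral theorem\<close>

text \<open>The obstacle is that a product vector of A^n:B^n may be entangled between the n copies
  on each side, so a bound on the passing probability for one copy does not simply multiply. Nor
  does C \<le> A pass to tensor powers when C is indefinite. What does pass to powers is two-sided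
  domination, -A \<le> C \<le> A. Both halves of the proof therefore look for a single-copy
  inequality of this kind, and obtain it by partial transposition, which product vectors see only as
  complex conjugation of one factor. The copy A' is there because p itself is not accessible in this
  way: Cauchy-Schwarz bounds p^2 by an expectation of the swap, and swaps have partial transposes
  that are easy to bound.

  A second point is the form of the yield: it is a \<open>Max\<close> over natural numbers of a
  condition on an infimum over maps. Finiteness and nonemptiness of the set, and nonemptiness of NE
  and DNE, have to be established before any rate can be compared.\<close>

definition ip :: "nat \<Rightarrow> (nat \<Rightarrow> complex) \<Rightarrow> (nat \<Rightarrow> complex) \<Rightarrow> complex" where
  "ip n f g = (\<Sum>i<n. cnj (f i) * g i)"

text \<open>Operators are handled as kernels over an arbitrary index set. Tensor products then live
  on Cartesian products, and flattened indices are reached through bijections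
  (\<open>psdk_reindex\<close>).\<close>

definition hform :: "'a set \<Rightarrow> ('a \<Rightarrow> 'a \<Rightarrow> complex) \<Rightarrow> ('a \<Rightarrow> complex) \<Rightarrow> complex" where
  "hform I K f = (\<Sum>s\<in>I. \<Sum>t\<in>I. cnj (f s) * K s t * f t)"

definition psdk :: "'a set \<Rightarrow> ('a \<Rightarrow> 'a \<Rightarrow> complex) \<Rightarrow> bool" where
  "psdk I K \<longleftrightarrow> (\<forall>f. 0 \<le> hform I K f)"

definition onf :: "nat \<Rightarrow> nat \<Rightarrow> (nat \<Rightarrow> nat \<Rightarrow> complex) \<Rightarrow> bool" where
  "onf n m v \<longleftrightarrow> (\<forall>r<m. \<forall>s<m. ip n (v r) (v s) = (if r = s then 1 else 0))"

lemma cnj_mult_self_nonneg: "0 \<le> cnj z * (z::complex)" "0 \<le> z * cnj z"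
  by (auto simp: less_eq_complex_def)

lemma ip_self: "ip n f f = complex_of_real (\<Sum>i<n. (cmod (f i))\<^sup>2)"
  by (simp only: ip_def of_real_sum complex_norm_square mult.commute)

lemma ip_cnj: "cnj (ip n f g) = ip n g f"
  by (simp add: ip_def mult.commute)

lemma ip_diff_right: "ip n f (\<lambda>i. g i - h i) = ip n f g - ip n f h"
  by (simp add: ip_def sum_subtractf algebra_simps)

lemma ip_diff_left: "ip n (\<lambda>i. g i - h i) f = ip n g f - ip n h f"
  by (simp add: ip_def sum_subtractf algebra_simps)

lemma ip_scale_right: "ip n f (\<lambda>i. c * g i) = c * ip n f g"
  by (simp add: ip_def sum_distrib_left algebra_simps)

lemma ip_sum_right: "ip n f (\<lambda>i. \<Sum>r\<in>J. g r i) = (\<Sum>r\<in>J. ip n f (g r))"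
  unfolding ip_def by (simp add: sum_distrib_left) (rule sum.swap)

lemma ip_sum_left: "ip n (\<lambda>i. \<Sum>r\<in>J. g r i) f = (\<Sum>r\<in>J. ip n (g r) f)"
  unfolding ip_def by (simp add: sum_distrib_right) (rule sum.swap)

lemma ip_scale_left: "ip n (\<lambda>i. c * g i) f = cnj c * ip n g f"
  by (simp add: ip_def sum_distrib_left algebra_simps)

lemma ip_cong: "(\<And>i. i < n \<Longrightarrow> f i = f' i) \<Longrightarrow> (\<And>i. i < n \<Longrightarrow> g i = g' i) \<Longrightarrow> ip n f g = ip n f' g'"
  by (simp add: ip_def)

text \<open>\<open>g\<close> is the orthogonal projection of \<open>f\<close> onto the span of the
  frame; the squared norm of f - g is the difference of the two sides.\<close>

lemma bessel:
  assumes "onf n m v"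
  shows "(\<Sum>r<m. (cmod (ip n (v r) f))\<^sup>2) \<le> (\<Sum>i<n. (cmod (f i))\<^sup>2)"
proof -
  define g where "g i = (\<Sum>r<m. ip n (v r) f * v r i)" for i
  have vg: "ip n (v s) g = ip n (v s) f" if "s < m" for s
  proof -
    have "ip n (v s) g = (\<Sum>r<m. ip n (v r) f * ip n (v s) (v r))"
      unfolding g_def by (simp add: ip_sum_right ip_scale_right)
    also have "\<dots> = (\<Sum>r<m. if r = s then ip n (v r) f else 0)"
      using assms that by (intro sum.cong) (auto simp: onf_def)
    finally show ?thesis using that by simp
  qed
  have gx: "ip n g h = (\<Sum>r<m. cnj (ip n (v r) f) * ip n (v r) h)" for h
    unfolding g_def by (simp add: ip_sum_left ip_scale_left)
  have gg: "ip n g g = ip n g f" unfolding gx by (intro sum.cong) (auto simp: vg)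
  have gf: "ip n g f = complex_of_real (\<Sum>r<m. (cmod (ip n (v r) f))\<^sup>2)"
    unfolding gx by (simp only: of_real_sum complex_norm_square mult.commute)
  then have fg: "ip n f g = ip n g f" using ip_cnj[of n g f] by simp
  have "ip n (\<lambda>i. f i - g i) (\<lambda>i. f i - g i) = ip n f f - ip n g f"
    by (simp add: ip_diff_left ip_diff_right gg fg)
  then have "complex_of_real (\<Sum>i<n. (cmod (f i - g i))\<^sup>2) =
      complex_of_real ((\<Sum>i<n. (cmod (f i))\<^sup>2) - (\<Sum>r<m. (cmod (ip n (v r) f))\<^sup>2))"
    by (simp add: ip_self gf)
  then have "(\<Sum>i<n. (cmod (f i - g i))\<^sup>2) =
      ((\<Sum>i<n. (cmod (f i))\<^sup>2) - (\<Sum>r<m. (cmod (ip n (v r) f))\<^sup>2))"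
    using of_real_eq_iff by blast
  moreover have "(\<Sum>i<n. (cmod (f i - g i))\<^sup>2) \<ge> 0" by (intro sum_nonneg) auto
  ultimately show ?thesis by linarith
qed

text \<open>Double counting of squared entries: each vector contributes 1, and by Bessel for the
  i-th basis vector each coordinate receives at most 1. This is what stops the deflation in the
  spectral theorem.\<close>

lemma onf_card_le:
  assumes "onf n m v"
  shows "m \<le> n"
proof -
  have one: "(\<Sum>r<m. (cmod (v r i))\<^sup>2) \<le> 1" if "i < n" for i
  proof -
    have d: "ip n (v r) (\<lambda>j. if j = i then 1 else 0) = cnj (v r i)" for r
      using that by (simp add: ip_def if_distrib cong: if_cong)
    have "(\<Sum>j<n. (cmod (if j = i then 1 else 0 :: complex))\<^sup>2) = (\<Sum>j<n. if j = i then 1 else 0 :: real)"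
      by (intro sum.cong) auto
    then show ?thesis using bessel[OF assms, of "\<lambda>j. if j = i then 1 else 0"] that
      by (simp add: d)
  qed
  have "complex_of_real (\<Sum>i<n. (cmod (v r i))\<^sup>2) = 1" if "r < m" for r
    using assms that ip_self[of n "v r"] by (simp add: onf_def)
  then have nrm: "(\<Sum>i<n. (cmod (v r i))\<^sup>2) = 1" if "r < m" for r
    using that of_real_eq_1_iff by blast
  have "real m = (\<Sum>r<m. \<Sum>i<n. (cmod (v r i))\<^sup>2)" by (simp add: nrm)
  also have "\<dots> = (\<Sum>i<n. \<Sum>r<m. (cmod (v r i))\<^sup>2)" by (rule sum.swap)
  also have "\<dots> \<le> (\<Sum>i<n. 1)" by (intro sum_mono) (use one in auto)
  finally show ?thesis by simp
qed

lemma mtrace_comm: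
  assumes "A \<in> carrier_mat n m" "B \<in> carrier_mat m n"
  shows "mtrace (A * B) = mtrace (B * A)"
proof -
  have "mtrace (A * B) = (\<Sum>i<n. \<Sum>j<m. A $$ (i, j) * B $$ (j, i))"
    using assms by (simp add: mtrace_def scalar_prod_def atLeast0LessThan)
  also have "\<dots> = (\<Sum>j<m. \<Sum>i<n. A $$ (i, j) * B $$ (j, i))" by (rule sum.swap)
  also have "\<dots> = mtrace (B * A)"
    using assms by (simp add: mtrace_def scalar_prod_def atLeast0LessThan mult.commute)
  finally show ?thesis .
qed

text \<open>
  If all eigenvalues vanish, a triangularization is strictly triangular, so the trace of the
  square, which is the sum of all squared moduli of the entries, vanishes.
\<close>

lemma hermitian_nonzero_eigenvalue:
  assumes M: "M \<in> carrier_mat n n"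
    and herm: "\<And>i j. i < n \<Longrightarrow> j < n \<Longrightarrow> M $$ (j, i) = cnj (M $$ (i, j))"
    and nz: "i0 < n" "j0 < n" "M $$ (i0, j0) \<noteq> 0"
  shows "\<exists>v e. eigenvector M v e \<and> e \<noteq> 0"
proof (rule ccontr)
  assume neg: "\<not> ?thesis"
  obtain es where cp: "char_poly M = (\<Prod>a\<leftarrow>es. [:- a, 1:])"
    using char_poly_factorized[OF M] by blast
  obtain B P Q where schur: "schur_decomposition M es = (B, P, Q)"
    by (cases "schur_decomposition M es") auto
  from schur_decomposition[OF M cp schur] have sim: "similar_mat_wit M B P Q"
    and ut: "upper_triangular B" and dg: "diag_mat B = es" by auto
  from similar_mat_witD2[OF M sim] have MPBQ: "M = P * B * Q" and QP: "Q * P = 1\<^sub>m n"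
    and B: "B \<in> carrier_mat n n" and P: "P \<in> carrier_mat n n" and Q: "Q \<in> carrier_mat n n" by auto
  have es0: "e = 0" if "e \<in> set es" for e
  proof -
    have "poly (char_poly M) e = 0" unfolding cp using that by (induction es) auto
    then have "eigenvalue M e" using eigenvalue_root_char_poly[OF M] by simp
    then show ?thesis using neg unfolding eigenvalue_def by blast
  qed
  have Bd: "B $$ (i, i) = 0" if "i < n" for i
  proof -
    have "B $$ (i, i) \<in> set es" using that B unfolding dg[symmetric] diag_mat_def by auto
    then show ?thesis by (rule es0)
  qed
  have B0: "B $$ (i, j) = 0" if "i < n" "j \<le> i" for i j
    using ut Bd that B by (cases "i = j") (auto simp: upper_triangular_def)
  have "mtrace (B * B) = (\<Sum>i<n. \<Sum>j<n. B $$ (i, j) * B $$ (j, i))"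
    using B by (simp add: mtrace_def scalar_prod_def atLeast0LessThan)
  also have "\<dots> = 0" proof (intro sum.neutral ballI)
    fix i j assume ij: "i \<in> {..<n}" "j \<in> {..<n}"
    show "B $$ (i, j) * B $$ (j, i) = 0"
    proof (cases "j \<le> i")
      case True
      then show ?thesis using B0[of i j] ij by simp
    next
      case False
      then show ?thesis using B0[of j i] ij by simp
    qed
  qed
  finally have trB: "mtrace (B * B) = 0" .
  have "M * M = P * (B * (Q * P) * B * Q)"
    unfolding MPBQ using P B Q by (simp add: assoc_mult_mat[of _ n n _ n _ n])
  also have "\<dots> = P * (B * B * Q)" unfolding QP using B P Q by simp
  finally have "mtrace (M * M) = mtrace (B * B * Q * P)"
    using mtrace_comm[of P n n "B * B * Q"] P B Q by simp
  also have "B * B * Q * P = B * B * (Q * P)"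
    using P B Q by (simp add: assoc_mult_mat[of _ n n _ n _ n])
  also have "\<dots> = B * B" unfolding QP using B by simp
  finally have "mtrace (M * M) = 0" using trB by simp
  moreover have "mtrace (M * M) = (\<Sum>i<n. \<Sum>j<n. complex_of_real ((cmod (M $$ (i, j)))\<^sup>2))"
  proof -
    have "mtrace (M * M) = (\<Sum>i<n. \<Sum>j<n. M $$ (i, j) * M $$ (j, i))"
      using M by (simp add: mtrace_def scalar_prod_def atLeast0LessThan)
    also have "\<dots> = (\<Sum>i<n. \<Sum>j<n. complex_of_real ((cmod (M $$ (i, j)))\<^sup>2))"
    proof (intro sum.cong refl)
      fix i j assume "i \<in> {..<n}" "j \<in> {..<n}"
      then show "M $$ (i, j) * M $$ (j, i) = complex_of_real ((cmod (M $$ (i, j)))\<^sup>2)"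
        using herm[of i j] by (simp only: complex_norm_square lessThan_iff)
    qed
    finally show ?thesis .
  qed
  ultimately have "complex_of_real (\<Sum>i<n. \<Sum>j<n. (cmod (M $$ (i, j)))\<^sup>2) = 0" by simp
  then have z: "(\<Sum>i<n. \<Sum>j<n. (cmod (M $$ (i, j)))\<^sup>2) = 0" using of_real_eq_0_iff by blast
  have "(\<Sum>j<n. (cmod (M $$ (i0, j)))\<^sup>2) = 0"
    using z nz(1) by (subst (asm) sum_nonneg_eq_0_iff) (auto intro: sum_nonneg)
  then have "(cmod (M $$ (i0, j0)))\<^sup>2 = 0"
    using nz(2) by (subst (asm) sum_nonneg_eq_0_iff) auto
  then show False using nz(3) by simp
qed

text \<open>Deflation: either some orthonormal eigenfamily already reproduces H, or it can be
  prolonged, and a family of length n + 1 cannot exist. Only nonzero eigenvalues are collected, so k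
  may be smaller than n.\<close>

lemma spectral_decomposition:
  fixes H :: "nat \<Rightarrow> nat \<Rightarrow> complex"
  assumes herm: "\<And>i j. i < n \<Longrightarrow> j < n \<Longrightarrow> H j i = cnj (H i j)"
  shows "\<exists>k v l. onf n k v \<and> (\<forall>i<n. \<forall>j<n. H i j = (\<Sum>r<k. complex_of_real (l r) * v r i * cnj (v r j)))"
proof -
  let ?A = "\<exists>k v l. onf n k v \<and> (\<forall>i<n. \<forall>j<n. H i j = (\<Sum>r<k. complex_of_real (l r) * v r i * cnj (v r j)))"
  let ?E = "\<lambda>m. \<exists>v l. onf n m v \<and> (\<forall>r<m. \<forall>i<n. (\<Sum>j<n. H i j * v r j) = complex_of_real (l r) * v r i)"
  have "?A \<or> ?E m" for m
  proof (induction m)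
    case 0
    then show ?case by (auto simp: onf_def)
  next
    case (Suc m)
    show ?case
    proof (cases ?A)
      case nA: False
      with Suc obtain v l where v: "onf n m v"
        and l: "\<And>r i. r < m \<Longrightarrow> i < n \<Longrightarrow> (\<Sum>j<n. H i j * v r j) = complex_of_real (l r) * v r i" by blast
      \<comment> \<open>\<open>D\<close> is the part of H not yet accounted for. It is Hermitian,
        kills every earlier \<open>v r\<close>, and is nonzero because the decomposition is not
        complete.\<close>
      define D where "D i j = H i j - (\<Sum>r<m. complex_of_real (l r) * v r i * cnj (v r j))" for i j
      have Dherm: "D j i = cnj (D i j)" if "i < n" "j < n" for i j
        using herm[OF that] by (simp add: D_def mult_ac)
      have "\<exists>i<n. \<exists>j<n. D i j \<noteq> 0"
      proof (rule ccontr)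
        assume "\<not> ?thesis"
        then have "\<forall>i<n. \<forall>j<n. H i j = (\<Sum>r<m. complex_of_real (l r) * v r i * cnj (v r j))"
          by (auto simp: D_def)
        then show False using v nA by blast
      qed
      then obtain i0 j0 where ij: "i0 < n" "j0 < n" "D i0 j0 \<noteq> 0" by blast
      define M where "M = mat n n (\<lambda>(i, j). D i j)"
      have M: "M \<in> carrier_mat n n" by (simp add: M_def)
      have Mherm: "M $$ (j, i) = cnj (M $$ (i, j))" if "i < n" "j < n" for i j
        using Dherm[OF that] that by (simp only: M_def index_mat split)
      obtain x e where x: "eigenvector M x e" and e: "e \<noteq> 0"
        using hermitian_nonzero_eigenvalue[OF M Mherm, of i0 j0] ij by (auto simp: M_def)
      define w0 where "w0 i = x $ i" for i
      have xc: "x \<in> carrier_vec n" "x \<noteq> 0\<^sub>v n" "M *\<^sub>v x = e \<cdot>\<^sub>v x"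
        using x M by (auto simp: eigenvector_def)
      have Dw0: "(\<Sum>j<n. D i j * w0 j) = e * w0 i" if "i < n" for i
        using arg_cong[OF xc(3), of "\<lambda>y. y $ i"] that xc(1) M
        by (simp add: M_def scalar_prod_def w0_def atLeast0LessThan)
      define s where "s = sqrt (\<Sum>i<n. (cmod (w0 i))\<^sup>2)"
      have "\<exists>i<n. w0 i \<noteq> 0"
      proof (rule ccontr)
        assume "\<not> ?thesis"
        then have "x = 0\<^sub>v n" using xc(1) by (intro eq_vecI) (auto simp: w0_def)
        then show False using xc(2) by simp
      qed
      then have "(\<Sum>i<n. (cmod (w0 i))\<^sup>2) > 0" by (auto intro!: sum_pos2)
      then have s: "s > 0" "s\<^sup>2 = (\<Sum>i<n. (cmod (w0 i))\<^sup>2)" by (simp_all add: s_def)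
      define w where "w i = complex_of_real (1 / s) * w0 i" for i
      have ww: "ip n w w = 1"
      proof -
        have weq: "w = (\<lambda>i. complex_of_real (1 / s) * w0 i)" by (simp add: w_def fun_eq_iff)
        have "ip n w w = cnj (complex_of_real (1 / s)) * (complex_of_real (1 / s) * ip n w0 w0)"
          unfolding weq by (simp only: ip_scale_left ip_scale_right)
        also have "ip n w0 w0 = complex_of_real (s\<^sup>2)" by (simp only: ip_self s(2))
        also have "cnj (complex_of_real (1 / s)) * (complex_of_real (1 / s) * complex_of_real (s\<^sup>2)) =
            complex_of_real ((1 / s)\<^sup>2 * s\<^sup>2)" by (simp add: power2_eq_square)
        finally have "ip n w w = complex_of_real ((1 / s)\<^sup>2 * s\<^sup>2)" .
        then show ?thesis using s(1) by (simp add: power_divide)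
      qed
      have Dw: "(\<Sum>j<n. D i j * w j) = e * w i" if "i < n" for i
      proof -
        have "(\<Sum>j<n. D i j * w j) = complex_of_real (1 / s) * (\<Sum>j<n. D i j * w0 j)"
          by (simp add: w_def sum_distrib_left mult_ac)
        then show ?thesis using Dw0[OF that] by (simp add: w_def)
      qed
      have Dsym: "ip n f (\<lambda>i. \<Sum>j<n. D i j * g j) = ip n (\<lambda>i. \<Sum>j<n. D i j * f j) g" for f g
      proof -
        have "ip n f (\<lambda>i. \<Sum>j<n. D i j * g j) = (\<Sum>i<n. \<Sum>j<n. cnj (f i) * (D i j * g j))"
          by (simp add: ip_def sum_distrib_left)
        also have "\<dots> = (\<Sum>j<n. \<Sum>i<n. cnj (f i) * (D i j * g j))" by (rule sum.swap)
        also have "\<dots> = (\<Sum>j<n. \<Sum>i<n. cnj (D j i * f i) * g j)"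
        proof (intro sum.cong refl)
          fix j i assume "j \<in> {..<n}" "i \<in> {..<n}"
          then show "cnj (f i) * (D i j * g j) = cnj (D j i * f i) * g j"
            using Dherm[of j i] by (simp add: mult_ac)
        qed
        also have "\<dots> = ip n (\<lambda>i. \<Sum>j<n. D i j * f j) g" by (simp add: ip_def sum_distrib_right)
        finally show ?thesis .
      qed
      have Dv: "(\<Sum>j<n. D i j * v r j) = 0" if "r < m" "i < n" for r i
      proof -
        have "(\<Sum>j<n. (\<Sum>q<m. complex_of_real (l q) * v q i * cnj (v q j)) * v r j) =
            (\<Sum>j<n. \<Sum>q<m. complex_of_real (l q) * v q i * (cnj (v q j) * v r j))"
          by (simp only: sum_distrib_right mult.assoc)
        also have "\<dots> = (\<Sum>q<m. complex_of_real (l q) * v q i * ip n (v q) (v r))"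
          by (subst sum.swap) (simp add: ip_def sum_distrib_left)
        also have "\<dots> = (\<Sum>q<m. if q = r then complex_of_real (l q) * v q i else 0)"
          using v that by (intro sum.cong) (auto simp: onf_def)
        finally show ?thesis
          using l[OF that] that by (simp add: D_def left_diff_distrib sum_subtractf)
      qed
      \<comment> \<open>An eigenvector of the Hermitian D for e \<noteq> 0 is orthogonal to the
        kernel of D, which contains the earlier vectors.\<close>
      have vw: "ip n (v r) w = 0" if "r < m" for r
      proof -
        have "e * ip n (v r) w = ip n (v r) (\<lambda>i. \<Sum>j<n. D i j * w j)"
          by (subst ip_scale_right[symmetric]) (rule ip_cong, auto simp: Dw)
        also have "\<dots> = ip n (\<lambda>i. 0) w" unfolding Dsym by (rule ip_cong) (auto simp: Dv that)
        finally show ?thesis using e by (simp add: ip_def)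
      qed
      have "e = ip n w (\<lambda>i. \<Sum>j<n. D i j * w j)"
        using ww ip_scale_right[of n w e w] by (simp add: Dw cong: ip_cong)
      moreover have "\<dots> = cnj e"
        unfolding Dsym using ww ip_scale_left[of n e w w] by (simp add: Dw cong: ip_cong)
      ultimately have ereal: "e = complex_of_real (Re e)"
        by (simp add: complex_eq_iff)
      define v' where "v' = v(m := w)"
      define l' where "l' = l(m := Re e)"
      have wv: "ip n w (v r) = 0" if "r < m" for r
        using vw[OF that] ip_cnj[of n "v r" w] by simp
      have on: "onf n (Suc m) v'"
        using v ww vw wv unfolding onf_def v'_def by (auto simp: less_Suc_eq)
      have "(\<Sum>j<n. H i j * w j) = e * w i" if "i < n" for i
      proof -
        have "(\<Sum>j<n. (\<Sum>q<m. complex_of_real (l q) * v q i * cnj (v q j)) * w j) =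
            (\<Sum>j<n. \<Sum>q<m. complex_of_real (l q) * v q i * (cnj (v q j) * w j))"
          by (simp only: sum_distrib_right mult.assoc)
        also have "\<dots> = (\<Sum>q<m. complex_of_real (l q) * v q i * ip n (v q) w)"
          by (subst sum.swap) (simp add: ip_def sum_distrib_left)
        also have "\<dots> = 0" by (simp add: vw)
        finally show ?thesis using Dw[OF that] by (simp add: D_def left_diff_distrib sum_subtractf)
      qed
      then have "(\<Sum>j<n. H i j * v' r j) = complex_of_real (l' r) * v' r i" if "r < Suc m" "i < n" for r i
        using that l ereal unfolding v'_def l'_def by (cases "r = m") auto
      then show ?thesis using on by blast
    qed auto
  qed
  from this[of "Suc n"] show ?thesis using onf_card_le[of n "Suc n"] by auto
qed

lemma psd_iff_psdk: "psd n M \<longleftrightarrow> M \<in> carrier_mat n n \<and> psdk {..<n} (\<lambda>i j. M $$ (i, j))"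
proof -
  have eq: "(M *\<^sub>v v) \<bullet>c v = hform {..<n} (\<lambda>i j. M $$ (i, j)) (\<lambda>i. v $ i)"
    if "M \<in> carrier_mat n n" "v \<in> carrier_vec n" for v
    using that by (simp add: hform_def scalar_prod_def atLeast0LessThan sum_distrib_right sum_distrib_left mult_ac)
  have eq': "hform {..<n} (\<lambda>i j. M $$ (i, j)) f = hform {..<n} (\<lambda>i j. M $$ (i, j)) (\<lambda>i. vec n f $ i)" for f
    unfolding hform_def by (intro sum.cong) auto
  show ?thesis
  proof (intro iffI conjI)
    assume p: "psd n M"
    then show M: "M \<in> carrier_mat n n" by (simp add: psd_def)
    show "psdk {..<n} (\<lambda>i j. M $$ (i, j))" unfolding psdk_def
    proof
      fix f
      have "0 \<le> (M *\<^sub>v vec n f) \<bullet>c vec n f" using p by (simp add: psd_def)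
      then show "0 \<le> hform {..<n} (\<lambda>i j. M $$ (i, j)) f" by (subst eq') (simp only: eq[OF M vec_carrier])
    qed
  next
    assume "M \<in> carrier_mat n n \<and> psdk {..<n} (\<lambda>i j. M $$ (i, j))"
    then show "psd n M" unfolding psd_def psdk_def by (simp add: eq)
  qed
qed

section \<open>Calculus of positive semidefinite kernels and their Gram decompositions\<close>

lemma hform_cong:
  "(\<And>s t. s \<in> I \<Longrightarrow> t \<in> I \<Longrightarrow> K s t = L s t) \<Longrightarrow> (\<And>s. s \<in> I \<Longrightarrow> f s = g s) \<Longrightarrow> hform I K f = hform I L g"
  unfolding hform_def by (intro sum.cong refl) auto

lemma psdk_cong: "(\<And>s t. s \<in> I \<Longrightarrow> t \<in> I \<Longrightarrow> K s t = L s t) \<Longrightarrow> psdk I K \<longleftrightarrow> psdk I L"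
  unfolding psdk_def using hform_cong[of I K L] by auto

lemma hform_add: "hform I (\<lambda>s t. K s t + L s t) f = hform I K f + hform I L f"
  by (simp add: hform_def sum.distrib algebra_simps)

lemma hform_diff: "hform I (\<lambda>s t. K s t - L s t) f = hform I K f - hform I L f"
  by (simp add: hform_def sum_subtractf algebra_simps)

lemma hform_scale: "hform I (\<lambda>s t. c * K s t) f = c * hform I K f"
  by (simp add: hform_def sum_distrib_left algebra_simps)

lemma hform_sum: "hform I (\<lambda>s t. \<Sum>r\<in>J. K r s t) f = (\<Sum>r\<in>J. hform I (K r) f)"
proof -
  have "hform I (\<lambda>s t. \<Sum>r\<in>J. K r s t) f = (\<Sum>s\<in>I. \<Sum>t\<in>I. \<Sum>r\<in>J. cnj (f s) * K r s t * f t)"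
    by (simp add: hform_def sum_distrib_left sum_distrib_right)
  also have "\<dots> = (\<Sum>s\<in>I. \<Sum>r\<in>J. \<Sum>t\<in>I. cnj (f s) * K r s t * f t)"
    by (intro sum.cong refl sum.swap)
  also have "\<dots> = (\<Sum>r\<in>J. \<Sum>s\<in>I. \<Sum>t\<in>I. cnj (f s) * K r s t * f t)" by (rule sum.swap)
  finally show ?thesis by (simp add: hform_def)
qed

lemma hform_rank_one: "hform I (\<lambda>s t. g s * cnj (g t)) f = complex_of_real ((cmod (\<Sum>s\<in>I. cnj (g s) * f s))\<^sup>2)"
proof -
  have "hform I (\<lambda>s t. g s * cnj (g t)) f = (\<Sum>s\<in>I. cnj (f s) * g s) * (\<Sum>t\<in>I. cnj (g t) * f t)"
    unfolding hform_def sum_product by (intro sum.cong refl) (simp add: mult_ac)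
  also have "(\<Sum>s\<in>I. cnj (f s) * g s) = cnj (\<Sum>t\<in>I. cnj (g t) * f t)" by (simp add: mult.commute)
  finally show ?thesis by (simp only: complex_norm_square mult.commute)
qed

lemma psdk_add: "psdk I K \<Longrightarrow> psdk I L \<Longrightarrow> psdk I (\<lambda>s t. K s t + L s t)"
  by (simp add: psdk_def hform_add)

lemma psdk_scale: "0 \<le> c \<Longrightarrow> psdk I K \<Longrightarrow> psdk I (\<lambda>s t. complex_of_real c * K s t)"
  by (simp add: psdk_def hform_scale mult_nonneg_nonneg less_eq_complex_def)

lemma psdk_rank_one: "psdk I (\<lambda>s t. g s * cnj (g t))"
  unfolding psdk_def hform_rank_one by (simp add: less_eq_complex_def)

lemma psdk_sum: "(\<And>r. r \<in> J \<Longrightarrow> psdk I (K r)) \<Longrightarrow> psdk I (\<lambda>s t. \<Sum>r\<in>J. K r s t)"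
  unfolding psdk_def hform_sum by (auto intro: sum_nonneg)

lemma hform_reindex:
  assumes "bij_betw h I J"
  shows "hform I (\<lambda>s t. K (h s) (h t)) (\<lambda>s. f (h s)) = hform J K f"
  unfolding hform_def
  by (simp add: sum.reindex_bij_betw[OF assms, of "\<lambda>s. \<Sum>t\<in>J. cnj (f s) * K s t * f t", symmetric]
      sum.reindex_bij_betw[OF assms, of "\<lambda>t. cnj (f (h s)) * K (h s) t * f t" for s, symmetric])

lemma psdk_reindex:
  assumes h: "bij_betw h I J"
  shows "psdk I (\<lambda>s t. K (h s) (h t)) \<longleftrightarrow> psdk J K"
proof
  assume "psdk I (\<lambda>s t. K (h s) (h t))"
  then show "psdk J K" unfolding psdk_def hform_reindex[OF h, symmetric] by blast
next
  assume J: "psdk J K"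
  have "hform I (\<lambda>s t. K (h s) (h t)) f = hform J K (\<lambda>t. f (the_inv_into I h t))" for f
    unfolding hform_reindex[OF h, symmetric] using h
    by (intro hform_cong) (auto simp: bij_betw_def the_inv_into_f_f)
  then show "psdk I (\<lambda>s t. K (h s) (h t))" using J by (simp add: psdk_def)
qed

text \<open>Polarization: since the form is real at e s + e t and at e s + \<i> e t, the imaginary
  parts of the two entries cancel and their real parts agree.\<close>

lemma psdk_hermitian:
  assumes K: "psdk I K" and I: "finite I" and s: "s \<in> I" and t: "t \<in> I"
  shows "K t s = cnj (K s t)"
proof -
  define e where "e u = (\<lambda>x. if x = u then 1 else 0 :: complex)" for u :: 'a
  have B: "(\<Sum>a\<in>I. \<Sum>b\<in>I. e u a * K a b * e w b) = K u w" if "u \<in> I" "w \<in> I" for u w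
  proof -
    have "(\<Sum>a\<in>I. \<Sum>b\<in>I. e u a * K a b * e w b) = (\<Sum>a\<in>I. \<Sum>b\<in>I. if b = w then e u a * K a b else 0)"
      by (intro sum.cong refl) (simp add: e_def)
    also have "\<dots> = (\<Sum>a\<in>I. e u a * K a w)" using that I by simp
    also have "\<dots> = (\<Sum>a\<in>I. if a = u then K a w else 0)"
      by (intro sum.cong refl) (simp add: e_def)
    finally show ?thesis using that I by simp
  qed
  have form: "hform I K (\<lambda>x. e s x + c * e t x) = K s s + c * K s t + cnj c * K t s + cnj c * c * K t t" for c
  proof -
    have "hform I K (\<lambda>x. e s x + c * e t x) = (\<Sum>a\<in>I. \<Sum>b\<in>I. e s a * K a b * e s b + c * (e s a * K a b * e t b)
        + cnj c * (e t a * K a b * e s b) + cnj c * c * (e t a * K a b * e t b))"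
      unfolding hform_def by (intro sum.cong refl) (simp add: e_def algebra_simps)
    then show ?thesis by (simp add: sum.distrib sum_distrib_left[symmetric] B s t)
  qed
  have pos: "Im (K s s + c * K s t + cnj c * K t s + cnj c * c * K t t) = 0" for c
    using K form[of c] unfolding psdk_def less_eq_complex_def by (metis zero_complex.simps(2))
  have diag: "Im (K u u) = 0" if "u \<in> I" for u
  proof -
    have "hform I K (e u) = K u u"
      unfolding hform_def using B[OF that that] by (simp add: e_def if_distrib cong: if_cong)
    then show ?thesis using K unfolding psdk_def less_eq_complex_def by (metis zero_complex.simps(2))
  qed
  have "Im (K s t) + Im (K t s) = 0" using pos[of 1] diag s t by simp
  moreover have "Re (K s t) = Re (K t s)" using pos[of \<i>] diag s t by simp
  ultimately show ?thesis by (simp add: complex_eq_iff)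
qed

text \<open>In the spectral decomposition the eigenvalue \<open>l s\<close> is the value of the form
  at \<open>v s\<close>, hence nonnegative, and its square root is absorbed in the vector.\<close>

lemma psdk_gram_nat:
  fixes H :: "nat \<Rightarrow> nat \<Rightarrow> complex"
  assumes "psdk {..<n} H"
  shows "\<exists>(k::nat) g. \<forall>i<n. \<forall>j<n. H i j = (\<Sum>r<k. g r i * cnj (g r j))"
proof -
  obtain k v l where v: "onf n k v"
    and H: "\<And>i j. i < n \<Longrightarrow> j < n \<Longrightarrow> H i j = (\<Sum>r<k. complex_of_real (l r) * v r i * cnj (v r j))"
    using spectral_decomposition[of n H, OF psdk_hermitian[OF assms]] by auto
  have form: "hform {..<n} H f = (\<Sum>r<k. complex_of_real (l r) * complex_of_real ((cmod (ip n (v r) f))\<^sup>2))" for f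
  proof -
    have "hform {..<n} H f = hform {..<n} (\<lambda>i j. \<Sum>r<k. complex_of_real (l r) * (v r i * cnj (v r j))) f"
      by (intro hform_cong) (auto simp: H mult.assoc)
    then show ?thesis by (simp only: hform_sum hform_scale hform_rank_one ip_def)
  qed
  have l: "l s \<ge> 0" if "s < k" for s
  proof -
    have "hform {..<n} H (v s) = (\<Sum>r<k. if r = s then complex_of_real (l r) else 0)"
      unfolding form using v that by (intro sum.cong refl) (auto simp: onf_def)
    then have "hform {..<n} H (v s) = complex_of_real (l s)" using that by simp
    moreover have "0 \<le> hform {..<n} H (v s)" using assms by (simp add: psdk_def)
    ultimately show ?thesis by (simp add: less_eq_complex_def)
  qed
  have "H i j = (\<Sum>r<k. (complex_of_real (sqrt (l r)) * v r i) * cnj (complex_of_real (sqrt (l r)) * v r j))"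
    if "i < n" "j < n" for i j
  proof -
    have sq: "complex_of_real (l r) = complex_of_real (sqrt (l r)) * complex_of_real (sqrt (l r))" if "r < k" for r
      using l[OF that] by (simp flip: of_real_mult)
    show ?thesis unfolding H[OF that]
      by (intro sum.cong refl) (simp add: sq mult_ac)
  qed
  then show ?thesis by (intro exI[of _ k] exI[of _ "\<lambda>r i. complex_of_real (sqrt (l r)) * v r i"]) auto
qed

lemma psdk_gram:
  assumes "psdk I K" "finite I"
  shows "\<exists>(k::nat) g. \<forall>s\<in>I. \<forall>t\<in>I. K s t = (\<Sum>r<k. g r s * cnj (g r t))"
proof -
  obtain h where h: "bij_betw h {..<card I} I"
    using ex_bij_betw_nat_finite[OF assms(2)] by (auto simp: atLeast0LessThan)
  obtain k :: nat and g where g: "\<And>i j. i < card I \<Longrightarrow> j < card I \<Longrightarrow> K (h i) (h j) = (\<Sum>r<k. g r i * cnj (g r j))"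
    using psdk_gram_nat[of "card I" "\<lambda>i j. K (h i) (h j)"] psdk_reindex[OF h] assms(1) by blast
  let ?i = "the_inv_into {..<card I} h"
  have "inj_on h {..<card I}" "h ` {..<card I} = I" using h by (simp_all add: bij_betw_def)
  then have i: "?i s < card I" "h (?i s) = s" if "s \<in> I" for s
    using that the_inv_into_into[of h "{..<card I}" s "{..<card I}"] f_the_inv_into_f[of h "{..<card I}" s]
    by auto
  have "K s t = (\<Sum>r<k. g r (?i s) * cnj (g r (?i t)))" if "s \<in> I" "t \<in> I" for s t
    using g[of "?i s" "?i t"] i that by simp
  then show ?thesis by (intro exI[of _ k] exI[of _ "\<lambda>r s. g r (?i s)"]) auto
qed

text \<open>Only K is expanded into Gram vectors. Each rank-one term turns the form into that of L
  at the vector contracted with \<open>g r\<close>, so L enters through its positivity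
  alone.\<close>

lemma psdk_tensor:
  assumes K: "psdk I K" and L: "psdk J L" and I: "finite I"
  shows "psdk (I \<times> J) (\<lambda>s t. K (fst s) (fst t) * L (snd s) (snd t))"
proof -
  obtain k :: nat and g where g: "\<And>s t. s \<in> I \<Longrightarrow> t \<in> I \<Longrightarrow> K s t = (\<Sum>r<k. g r s * cnj (g r t))"
    using psdk_gram[OF K I] by blast
  have one: "hform (I \<times> J) (\<lambda>s t. (g r (fst s) * cnj (g r (fst t))) * L (snd s) (snd t)) f =
      hform J L (\<lambda>y. \<Sum>x\<in>I. cnj (g r x) * f (x, y))" for f r
  proof -
    have "hform J L (\<lambda>y. \<Sum>x\<in>I. cnj (g r x) * f (x, y)) =
        (\<Sum>y\<in>J. \<Sum>y'\<in>J. \<Sum>x\<in>I. \<Sum>x'\<in>I. cnj (f (x, y)) * (g r x * cnj (g r x') * L y y') * f (x', y'))"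
      unfolding hform_def by (simp add: sum_distrib_left sum_distrib_right mult_ac)
    also have "\<dots> = (\<Sum>y\<in>J. \<Sum>x\<in>I. \<Sum>y'\<in>J. \<Sum>x'\<in>I. cnj (f (x, y)) * (g r x * cnj (g r x') * L y y') * f (x', y'))"
      by (intro sum.cong refl sum.swap)
    also have "\<dots> = (\<Sum>x\<in>I. \<Sum>y\<in>J. \<Sum>y'\<in>J. \<Sum>x'\<in>I. cnj (f (x, y)) * (g r x * cnj (g r x') * L y y') * f (x', y'))"
      by (rule sum.swap)
    also have "\<dots> = (\<Sum>x\<in>I. \<Sum>y\<in>J. \<Sum>x'\<in>I. \<Sum>y'\<in>J. cnj (f (x, y)) * (g r x * cnj (g r x') * L y y') * f (x', y'))"
      by (intro sum.cong refl sum.swap)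
    also have "\<dots> = hform (I \<times> J) (\<lambda>s t. (g r (fst s) * cnj (g r (fst t))) * L (snd s) (snd t)) f"
      by (simp add: hform_def sum.cartesian_product' )
    finally show ?thesis by simp
  qed
  have "hform (I \<times> J) (\<lambda>s t. K (fst s) (fst t) * L (snd s) (snd t)) f =
      hform (I \<times> J) (\<lambda>s t. \<Sum>r<k. (g r (fst s) * cnj (g r (fst t))) * L (snd s) (snd t)) f" for f
    by (intro hform_cong) (auto simp: g sum_distrib_right)
  then show ?thesis using L unfolding psdk_def hform_sum one by (auto intro: sum_nonneg)
qed

text \<open>
  Twice the claimed kernel is the sum of (A + C)(B + D) and (A - C)(B - D), respectively of
  (A + C)(B - D) and (A - C)(B + D).
\<close>

lemma psdk_tensor_dominated:
  assumes "psdk I (\<lambda>s t. A s t + C s t)" "psdk I (\<lambda>s t. A s t - C s t)"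
    and "psdk J (\<lambda>s t. B s t + D s t)" "psdk J (\<lambda>s t. B s t - D s t)" and "finite I"
  shows "psdk (I \<times> J) (\<lambda>s t. A (fst s) (fst t) * B (snd s) (snd t) + C (fst s) (fst t) * D (snd s) (snd t))" (is ?p)
    and "psdk (I \<times> J) (\<lambda>s t. A (fst s) (fst t) * B (snd s) (snd t) - C (fst s) (fst t) * D (snd s) (snd t))" (is ?m)
proof -
  note T = psdk_scale[of "1/2", OF _ psdk_add]
  have "psdk (I \<times> J) (\<lambda>s t. complex_of_real (1/2) *
      ((A (fst s) (fst t) + C (fst s) (fst t)) * (B (snd s) (snd t) + D (snd s) (snd t)) +
       (A (fst s) (fst t) - C (fst s) (fst t)) * (B (snd s) (snd t) - D (snd s) (snd t))))"
    by (intro T psdk_tensor[of I "\<lambda>s t. A s t + C s t" J "\<lambda>s t. B s t + D s t"]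
        psdk_tensor[of I "\<lambda>s t. A s t - C s t" J "\<lambda>s t. B s t - D s t"]) (use assms in auto)
  then show ?p by (rule psdk_cong[THEN iffD1, rotated]) (simp add: field_simps)
  have "psdk (I \<times> J) (\<lambda>s t. complex_of_real (1/2) *
      ((A (fst s) (fst t) + C (fst s) (fst t)) * (B (snd s) (snd t) - D (snd s) (snd t)) +
       (A (fst s) (fst t) - C (fst s) (fst t)) * (B (snd s) (snd t) + D (snd s) (snd t))))"
    by (intro T psdk_tensor[of I "\<lambda>s t. A s t + C s t" J "\<lambda>s t. B s t - D s t"]
        psdk_tensor[of I "\<lambda>s t. A s t - C s t" J "\<lambda>s t. B s t + D s t"]) (use assms in auto)
  then show ?m by (rule psdk_cong[THEN iffD1, rotated]) (simp add: field_simps)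
qed

section \<open>Tensor powers of kernels\<close>

text \<open>
  An index of the (n+1)-st power is split into its first component and an index of the n-th
  power by a pair of projections, which depend on n as indices are numbers in base a.
\<close>

definition splitting :: "(nat \<Rightarrow> 's \<Rightarrow> 'h) \<Rightarrow> (nat \<Rightarrow> 's \<Rightarrow> 's) \<Rightarrow> (nat \<Rightarrow> 's set) \<Rightarrow> 'h set \<Rightarrow> bool" where
  "splitting hp tp I H \<longleftrightarrow> finite H \<and> (\<exists>s0. I 0 = {s0}) \<and>
     (\<forall>n. bij_betw (\<lambda>s. (hp n s, tp n s)) (I (Suc n)) (H \<times> I n))"

fun kpw :: "(nat \<Rightarrow> 's \<Rightarrow> 'h) \<Rightarrow> (nat \<Rightarrow> 's \<Rightarrow> 's) \<Rightarrow> ('h \<Rightarrow> 'h \<Rightarrow> complex) \<Rightarrow> nat \<Rightarrow> 's \<Rightarrow> 's \<Rightarrow> complex" where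
  "kpw hp tp K 0 s t = 1"
| "kpw hp tp K (Suc n) s t = K (hp n s) (hp n t) * kpw hp tp K n (tp n s) (tp n t)"

text \<open>Two-sided domination of C by A survives tensor powers. Each step of the induction
  consumes both signs, so the conclusion is carried as a conjunction. At n = 0 both powers are 1,
  and the two forms are 2|z|^2 and 0.\<close>

lemma kpw_dominated:
  assumes sp: "splitting hp tp I H"
    and "psdk H (\<lambda>s t. A s t + C s t)" "psdk H (\<lambda>s t. A s t - C s t)"
  shows "psdk (I n) (\<lambda>s t. kpw hp tp A n s t + kpw hp tp C n s t) \<and>
    psdk (I n) (\<lambda>s t. kpw hp tp A n s t - kpw hp tp C n s t)"
proof (induction n)
  case 0
  obtain s0 where "I 0 = {s0}" using sp by (auto simp: splitting_def)
  moreover have "0 \<le> cnj z * 2 * z" for z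
    by (simp add: less_eq_complex_def)
  ultimately show ?case by (simp add: psdk_def hform_def)
next
  case (Suc n)
  have bij: "bij_betw (\<lambda>s. (hp n s, tp n s)) (I (Suc n)) (H \<times> I n)" and fin: "finite H"
    using sp by (auto simp: splitting_def)
  note T = psdk_tensor_dominated[OF assms(2,3) Suc[THEN conjunct1] Suc[THEN conjunct2] fin]
  show ?case
    using T[THEN psdk_reindex[OF bij, THEN iffD2]] by simp
qed

lemma kpw_scale: "kpw hp tp (\<lambda>s t. c * K s t) n s t = c ^ n * kpw hp tp K n s t"
  by (induction n arbitrary: s t) auto

text \<open>Regroups the (head, tail) pairs of two systems into a pair of heads and a pair of tails:
  the passage from powers of A and of B to powers of AB.\<close>

lemma splitting_Times:
  fixes hp :: "nat \<Rightarrow> 'a \<Rightarrow> 'b" and hp' :: "nat \<Rightarrow> 'c \<Rightarrow> 'd"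
  assumes "splitting hp tp I H" "splitting hp' tp' I' H'"
  shows "splitting (\<lambda>n. map_prod (hp n) (hp' n)) (\<lambda>n. map_prod (tp n) (tp' n)) (\<lambda>n. I n \<times> I' n) (H \<times> H')"
  unfolding splitting_def
proof (intro conjI allI)
  show "finite (H \<times> H')" using assms by (simp add: splitting_def)
  show "\<exists>s0. I 0 \<times> I' 0 = {s0}" using assms by (fastforce simp: splitting_def)
  fix n
  have b: "bij_betw (\<lambda>s. (hp n s, tp n s)) (I (Suc n)) (H \<times> I n)"
    "bij_betw (\<lambda>s. (hp' n s, tp' n s)) (I' (Suc n)) (H' \<times> I' n)"
    using assms by (auto simp: splitting_def)
  define sh where "sh p = ((fst (fst p), fst (snd p)), (snd (fst p), snd (snd p)))"
    for p :: "('b \<times> 'a) \<times> ('d \<times> 'c)"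
  have "bij_betw sh ((H \<times> I n) \<times> (H' \<times> I' n)) ((H \<times> H') \<times> (I n \<times> I' n))"
    by (rule bij_betwI[of _ _ _ "\<lambda>p. ((fst (fst p), fst (snd p)), (snd (fst p), snd (snd p)))"])
      (auto simp: sh_def)
  from bij_betw_trans[OF bij_betw_map_prod[OF b] this]
  have "bij_betw (sh \<circ> map_prod (\<lambda>s. (hp n s, tp n s)) (\<lambda>s. (hp' n s, tp' n s)))
    (I (Suc n) \<times> I' (Suc n)) ((H \<times> H') \<times> (I n \<times> I' n))" .
  moreover have "sh \<circ> map_prod (\<lambda>s. (hp n s, tp n s)) (\<lambda>s. (hp' n s, tp' n s)) =
      (\<lambda>s. (map_prod (hp n) (hp' n) s, map_prod (tp n) (tp' n) s))"
    by (auto simp: sh_def fun_eq_iff)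
  ultimately show "bij_betw (\<lambda>s. (map_prod (hp n) (hp' n) s, map_prod (tp n) (tp' n) s))
      (I (Suc n) \<times> I' (Suc n)) ((H \<times> H') \<times> (I n \<times> I' n))" by simp
qed

lemma bij_betw_div_mod:
  fixes a b :: nat
  assumes "b > 0"
  shows "bij_betw (\<lambda>x. (x div b, x mod b)) {..<a * b} ({..<a} \<times> {..<b})"
proof (rule bij_betwI[of _ _ _ "\<lambda>(i, j). i * b + j"])
  have "i * b + j < a * b" if "i < a" "j < b" for i j
  proof -
    have "i * b + j < (i + 1) * b" using that by simp
    also have "\<dots> \<le> a * b" using that by (intro mult_right_mono) auto
    finally show ?thesis .
  qed
  then show "(\<lambda>(i, j). i * b + j) \<in> {..<a} \<times> {..<b} \<rightarrow> {..<a * b}" by auto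
qed (use assms in \<open>auto simp: less_mult_imp_div_less\<close>)

text \<open>The leading base-a digit belongs to the first copy, in agreement with
  \<open>bip_power\<close>, which puts the new factor on the left.\<close>

lemma splitting_nat:
  fixes a :: nat
  assumes "a > 0"
  shows "splitting (\<lambda>n x. x div a ^ n) (\<lambda>n x. x mod a ^ n) (\<lambda>n. {..<a ^ n}) {..<a}"
  unfolding splitting_def using bij_betw_div_mod[of "a ^ n" a for n] assms by (auto simp: lessThan_Suc)

section \<open>The trace norm\<close>

text \<open>The form is the sum of squared overlaps of f with the Gram vectors of K; if it vanishes,
  f is orthogonal to all of them and K f = 0.\<close>

lemma hform_zero_imp:
  fixes K :: "nat \<Rightarrow> nat \<Rightarrow> complex"
  assumes "psdk {..<n} K" "hform {..<n} K f = 0" "i < n"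
  shows "(\<Sum>j<n. K i j * f j) = 0"
proof -
  obtain k :: nat and g where g: "\<And>s t. s < n \<Longrightarrow> t < n \<Longrightarrow> K s t = (\<Sum>r<k. g r s * cnj (g r t))"
    using psdk_gram[OF assms(1)] by auto
  have "hform {..<n} K f = hform {..<n} (\<lambda>s t. \<Sum>r<k. g r s * cnj (g r t)) f"
    by (intro hform_cong) (auto simp: g)
  also have "\<dots> = complex_of_real (\<Sum>r<k. (cmod (\<Sum>s<n. cnj (g r s) * f s))\<^sup>2)"
    unfolding hform_sum hform_rank_one by simp
  finally have "complex_of_real (\<Sum>r<k. (cmod (\<Sum>s<n. cnj (g r s) * f s))\<^sup>2) = 0"
    using assms(2) by (simp only:)
  then have "(\<Sum>r<k. (cmod (\<Sum>s<n. cnj (g r s) * f s))\<^sup>2) = 0"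
    by (simp only: of_real_eq_0_iff)
  then have z: "(\<Sum>s<n. cnj (g r s) * f s) = 0" if "r < k" for r
    using that by (subst (asm) sum_nonneg_eq_0_iff) auto
  have "(\<Sum>j<n. K i j * f j) = (\<Sum>j<n. \<Sum>r<k. g r i * (cnj (g r j) * f j))"
    using assms(3) by (intro sum.cong refl) (simp add: g sum_distrib_right mult.assoc)
  also have "\<dots> = (\<Sum>r<k. g r i * (\<Sum>j<n. cnj (g r j) * f j))"
    by (subst sum.swap) (simp add: sum_distrib_left)
  finally show ?thesis by (simp add: z)
qed

lemma mat_mult_entry:
  assumes "A \<in> carrier_mat n m" "B \<in> carrier_mat m k" "i < n" "j < k"
  shows "(A * B) $$ (i, j) = (\<Sum>l<m. A $$ (i, l) * B $$ (l, j))"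
  using assms by (simp add: scalar_prod_def atLeast0LessThan)

lemma psd_hermitian:
  assumes "psd n M" "i < n" "j < n"
  shows "M $$ (j, i) = cnj (M $$ (i, j))"
  by (rule psdk_hermitian[of "{..<n}" "\<lambda>i j. M $$ (i, j)" i j])
    (use assms in \<open>auto simp: psd_iff_psdk\<close>)

text \<open>The columns of the Hermitian A serve as test vectors, so that positivity of P applies to
  each summand.\<close>

lemma mtrace_sandwich:
  assumes P: "P \<in> carrier_mat n n" and A: "A \<in> carrier_mat n n"
    and herm: "\<And>i j. i < n \<Longrightarrow> j < n \<Longrightarrow> A $$ (j, i) = cnj (A $$ (i, j))"
  shows "mtrace (A * (P * A)) = (\<Sum>i<n. hform {..<n} (\<lambda>i j. P $$ (i, j)) (\<lambda>j. A $$ (j, i)))"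
proof -
  have "mtrace (A * (P * A)) = (\<Sum>i<n. \<Sum>s<n. A $$ (i, s) * (\<Sum>t<n. P $$ (s, t) * A $$ (t, i)))"
    using P A by (simp add: mtrace_def mat_mult_entry[of _ n n _ n] del: index_mult_mat(1))
  also have "\<dots> = (\<Sum>i<n. hform {..<n} (\<lambda>i j. P $$ (i, j)) (\<lambda>j. A $$ (j, i)))"
  proof (intro sum.cong refl)
    fix i assume i: "i \<in> {..<n}"
    have "(\<Sum>s<n. A $$ (i, s) * (\<Sum>t<n. P $$ (s, t) * A $$ (t, i))) =
        (\<Sum>s<n. cnj (A $$ (s, i)) * (\<Sum>t<n. P $$ (s, t) * A $$ (t, i)))"
    proof (intro sum.cong refl)
      fix s assume "s \<in> {..<n}"
      then have "A $$ (i, s) = cnj (A $$ (s, i))" using herm[of s i] i by (simp only: lessThan_iff)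
      then show "A $$ (i, s) * (\<Sum>t<n. P $$ (s, t) * A $$ (t, i)) =
          cnj (A $$ (s, i)) * (\<Sum>t<n. P $$ (s, t) * A $$ (t, i))" by (simp only:)
    qed
    then show "(\<Sum>s<n. A $$ (i, s) * (\<Sum>t<n. P $$ (s, t) * A $$ (t, i))) =
        hform {..<n} (\<lambda>i j. P $$ (i, j)) (\<lambda>j. A $$ (j, i))"
      by (simp add: hform_def sum_distrib_left mult.assoc)
  qed
  finally show ?thesis .
qed

text \<open>
  With A = P - R, the operator P + R anticommutes with A, so A(P + R)A has trace zero; hence both
  APA and ARA vanish, and then so does the square of A.
\<close>

lemma psd_square_eq_imp_eq:
  assumes P: "psd n P" and R: "psd n R" and eq: "P * P = R * R"
  shows "P = R"
proof -
  have Pc: "P \<in> carrier_mat n n" and Rc: "R \<in> carrier_mat n n" using P R by (auto simp: psd_def)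
  define A where "A = P - R"
  have A: "A \<in> carrier_mat n n" unfolding A_def using Pc Rc by (intro minus_carrier_mat)
  have herm: "A $$ (j, i) = cnj (A $$ (i, j))" if "i < n" "j < n" for i j
    using psd_hermitian[OF P that] psd_hermitian[OF R that] that Pc Rc by (simp add: A_def)
  define S where "S = P + R"
  have S: "S \<in> carrier_mat n n" using Pc Rc by (simp add: S_def)
  have "S * A = P * P + R * P - (P * R + R * R)"
    unfolding S_def A_def using Pc Rc
    by (simp add: add_mult_distrib_mat[of _ n n] mult_minus_distrib_mat[of _ n n])
  moreover have "A * S = P * P + P * R - (R * P + R * R)"
    unfolding S_def A_def minus_mult_distrib_mat[OF Pc Rc S[unfolded S_def]]
      mult_add_distrib_mat[OF Pc Pc Rc] mult_add_distrib_mat[OF Rc Pc Rc] ..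
  ultimately have anti: "S * A = - (A * S)"
    unfolding eq using Pc Rc by (intro eq_matI) auto
  have tr: "mtrace (A * (S * A)) = 0"
  proof -
    have "mtrace (A * (S * A)) = mtrace (A * (- (A * S)))" unfolding anti by simp
    also have "\<dots> = mtrace (- (A * (A * S)))"
      using A S by simp
    also have "\<dots> = - mtrace (A * (A * S))"
      using A S by (simp add: mtrace_def sum_negf)
    also have "mtrace (A * (A * S)) = mtrace (A * S * A)" using mtrace_comm[of A n n "A * S"] A S by simp
    also have "A * S * A = A * (S * A)" using A S by simp
    finally show ?thesis by simp
  qed
  have "A * (S * A) = A * (P * A) + A * (R * A)"
    unfolding S_def add_mult_distrib_mat[OF Pc Rc A]
    by (rule mult_add_distrib_mat[OF A]) (use A Pc Rc in auto)
  moreover have "mtrace (A * (P * A) + A * (R * A)) = mtrace (A * (P * A)) + mtrace (A * (R * A))"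
    using A Pc Rc by (simp add: mtrace_def sum.distrib)
  ultimately have "(\<Sum>i<n. hform {..<n} (\<lambda>i j. P $$ (i, j)) (\<lambda>j. A $$ (j, i))) +
      (\<Sum>i<n. hform {..<n} (\<lambda>i j. R $$ (i, j)) (\<lambda>j. A $$ (j, i))) = 0"
    using tr mtrace_sandwich[OF Pc A herm] mtrace_sandwich[OF Rc A herm] by simp
  then have sum0: "(\<Sum>i<n. hform {..<n} (\<lambda>i j. P $$ (i, j)) (\<lambda>j. A $$ (j, i)) +
      hform {..<n} (\<lambda>i j. R $$ (i, j)) (\<lambda>j. A $$ (j, i))) = 0" by (simp add: sum.distrib)
  have pos: "0 \<le> hform {..<n} (\<lambda>i j. P $$ (i, j)) f" "0 \<le> hform {..<n} (\<lambda>i j. R $$ (i, j)) f" for f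
    using P R by (auto simp: psd_iff_psdk psdk_def)
  have both: "hform {..<n} (\<lambda>i j. P $$ (i, j)) (\<lambda>j. A $$ (j, i)) = 0 \<and>
      hform {..<n} (\<lambda>i j. R $$ (i, j)) (\<lambda>j. A $$ (j, i)) = 0" if "i < n" for i
  proof -
    have "hform {..<n} (\<lambda>i j. P $$ (i, j)) (\<lambda>j. A $$ (j, i)) +
      hform {..<n} (\<lambda>i j. R $$ (i, j)) (\<lambda>j. A $$ (j, i)) = 0"
      using sum0 that pos by (subst (asm) sum_nonneg_eq_0_iff) auto
    then show ?thesis using pos by (simp add: add_nonneg_eq_0_iff)
  qed
  have AA: "(\<Sum>t<n. A $$ (s, t) * A $$ (t, i)) = 0" if "s < n" "i < n" for s i
  proof -
    have "(\<Sum>t<n. P $$ (s, t) * A $$ (t, i)) = 0" "(\<Sum>t<n. R $$ (s, t) * A $$ (t, i)) = 0"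
      using hform_zero_imp[of n "\<lambda>i j. P $$ (i, j)"] hform_zero_imp[of n "\<lambda>i j. R $$ (i, j)"]
        P R both[OF that(2)] that by (auto simp: psd_iff_psdk)
    moreover have "(\<Sum>t<n. A $$ (s, t) * A $$ (t, i)) =
        (\<Sum>t<n. P $$ (s, t) * A $$ (t, i)) - (\<Sum>t<n. R $$ (s, t) * A $$ (t, i))"
      unfolding sum_subtractf[symmetric] using that Pc Rc
      by (intro sum.cong refl) (simp add: A_def left_diff_distrib)
    ultimately show ?thesis by simp
  qed
  have "A $$ (t, i) = 0" if "t < n" "i < n" for t i
  proof -
    have "complex_of_real (\<Sum>t<n. (cmod (A $$ (t, i)))\<^sup>2) = (\<Sum>t<n. A $$ (i, t) * A $$ (t, i))"
      unfolding of_real_sum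
    proof (intro sum.cong refl)
      fix t assume "t \<in> {..<n}"
      then show "complex_of_real ((cmod (A $$ (t, i)))\<^sup>2) = A $$ (i, t) * A $$ (t, i)"
        using herm[of t i] that by (simp only: complex_norm_square lessThan_iff mult.commute)
    qed
    also have "\<dots> = 0" using AA that by simp
    finally have "(\<Sum>t<n. (cmod (A $$ (t, i)))\<^sup>2) = 0" using of_real_eq_0_iff by blast
    then show ?thesis using that by (subst (asm) sum_nonneg_eq_0_iff) auto
  qed
  then show ?thesis using Pc Rc unfolding A_def by (intro eq_matI) auto
qed

text \<open>\<open>psd_sqrt\<close> is a definite description, so exhibiting a positive root
  determines it only together with uniqueness.\<close>

lemma psd_sqrt_eq:
  assumes "psd n P" "P * P = M" "dim_row M = n"
  shows "psd_sqrt M = P"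
  unfolding psd_sqrt_def assms(3)
  by (rule the_equality) (use assms psd_square_eq_imp_eq in auto)

text \<open>In an eigenbasis the trace norm is the sum of the absolute eigenvalues. For trace 0 the
  negative eigenvalues carry half of it, and no unit vector can detect more than the whole negative
  part.\<close>

lemma hermitian_trace_norm:
  assumes M: "M \<in> carrier_mat n n"
    and herm: "\<And>i j. i < n \<Longrightarrow> j < n \<Longrightarrow> M $$ (j, i) = cnj (M $$ (i, j))"
  shows "0 \<le> trace_norm M"
    and "mtrace M = 0 \<Longrightarrow> (\<Sum>i<n. (cmod (f i))\<^sup>2) = 1 \<Longrightarrow>
      - Re (hform {..<n} (\<lambda>i j. M $$ (i, j)) f) \<le> 1 / 2 * trace_norm M"
proof -
  obtain k v l where v: "onf n k v"
    and Mv: "\<And>i j. i < n \<Longrightarrow> j < n \<Longrightarrow> M $$ (i, j) = (\<Sum>r<k. complex_of_real (l r) * v r i * cnj (v r j))"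
    using spectral_decomposition[of n "\<lambda>i j. M $$ (i, j)", OF herm] by blast
  \<comment> \<open>Functional calculus on the eigenframe: \<open>G l\<close> is M itself, and the
    absolute values of \<open>l\<close> give the positive root of M^2.\<close>
  define G where "G a i j = (\<Sum>r<k. complex_of_real (a r) * (v r i * cnj (v r j)))" for a :: "nat \<Rightarrow> real" and i j
  have mult: "(\<Sum>j<n. G a i j * G b j m) = G (\<lambda>r. a r * b r) i m" for a b i m
  proof -
    have "(\<Sum>j<n. G a i j * G b j m) = (\<Sum>j<n. \<Sum>r<k. \<Sum>s<k. complex_of_real (a r) * complex_of_real (b s) * v r i * cnj (v s m) * (cnj (v r j) * v s j))"
      unfolding G_def sum_product by (intro sum.cong refl) (simp add: mult_ac)
    also have "\<dots> = (\<Sum>r<k. \<Sum>j<n. \<Sum>s<k. complex_of_real (a r) * complex_of_real (b s) * v r i * cnj (v s m) * (cnj (v r j) * v s j))"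
      by (rule sum.swap)
    also have "\<dots> = (\<Sum>r<k. \<Sum>s<k. complex_of_real (a r) * complex_of_real (b s) * v r i * cnj (v s m) * ip n (v r) (v s))"
      unfolding ip_def sum_distrib_left by (intro sum.cong refl sum.swap)
    also have "\<dots> = (\<Sum>r<k. \<Sum>s<k. if s = r then complex_of_real (a r * b r) * (v r i * cnj (v r m)) else 0)"
      using v by (intro sum.cong refl) (auto simp: onf_def)
    finally show ?thesis by (simp add: G_def)
  qed
  define P where "P = mat n n (\<lambda>(i, j). G (\<lambda>r. \<bar>l r\<bar>) i j)"
  have P: "psd n P"
  proof -
    have "psdk {..<n} (G (\<lambda>r. \<bar>l r\<bar>))"
      unfolding G_def by (intro psdk_sum psdk_scale psdk_rank_one) auto
    then show ?thesis unfolding psd_iff_psdk P_def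
      by (auto intro: psdk_cong[THEN iffD1, rotated])
  qed
  have adj: "mat_adjoint M = M"
  proof (rule eq_matI)
    fix i j assume ij: "i < dim_row M" "j < dim_col M"
    then show "mat_adjoint M $$ (i, j) = M $$ (i, j)"
      using M herm[of j i] by (simp add: mat_adjoint_def mat_of_rows_def)
  qed (use M in \<open>auto simp: mat_adjoint_def\<close>)
  have MG: "M $$ (i, j) = G l i j" if "i < n" "j < n" for i j
    unfolding Mv[OF that] G_def by (simp add: mult.assoc)
  have PP: "P * P = M * M"
  proof (rule eq_matI)
    fix i j assume "i < dim_row (M * M)" "j < dim_col (M * M)"
    then have ij: "i < n" "j < n" using M by auto
    have "(P * P) $$ (i, j) = (\<Sum>m<n. P $$ (i, m) * P $$ (m, j))"
      using ij P by (intro mat_mult_entry) (auto simp: psd_def)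
    also have "\<dots> = (\<Sum>m<n. G (\<lambda>r. \<bar>l r\<bar>) i m * G (\<lambda>r. \<bar>l r\<bar>) m j)" using ij by (simp add: P_def)
    also have "\<dots> = (\<Sum>m<n. G l i m * G l m j)" unfolding mult by simp
    also have "\<dots> = (\<Sum>m<n. M $$ (i, m) * M $$ (m, j))" using ij by (simp add: MG)
    also have "\<dots> = (M * M) $$ (i, j)" using mat_mult_entry[OF M M ij] by simp
    finally show "(P * P) $$ (i, j) = (M * M) $$ (i, j)" .
  qed (use M in \<open>auto simp: P_def\<close>)
  have tr: "(\<Sum>i<n. G a i i) = complex_of_real (\<Sum>r<k. a r)" for a
  proof -
    have "(\<Sum>i<n. G a i i) = (\<Sum>r<k. complex_of_real (a r) * ip n (v r) (v r))"
      unfolding G_def ip_def sum_distrib_left by (subst sum.swap) (simp add: mult_ac)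
    then show ?thesis using v by (simp add: onf_def)
  qed
  have tn: "trace_norm M = (\<Sum>r<k. \<bar>l r\<bar>)"
  proof -
    have "psd_sqrt (mat_adjoint M * M) = P"
      unfolding adj using M by (intro psd_sqrt_eq[OF P PP]) auto
    then show ?thesis unfolding trace_norm_def using tr[of "\<lambda>r. \<bar>l r\<bar>"] by (simp add: mtrace_def P_def)
  qed
  then show "0 \<le> trace_norm M" by (simp add: sum_nonneg)
  assume "mtrace M = 0" and f: "(\<Sum>i<n. (cmod (f i))\<^sup>2) = 1"
  then have l0: "(\<Sum>r<k. l r) = 0"
    using tr[of l] M MG by (simp add: mtrace_def del: of_real_sum)
  have "hform {..<n} (\<lambda>i j. M $$ (i, j)) f = hform {..<n} (G l) f"
    by (intro hform_cong) (auto simp: MG)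
  also have "\<dots> = (\<Sum>r<k. complex_of_real (l r) * complex_of_real ((cmod (ip n (v r) f))\<^sup>2))"
    unfolding G_def hform_sum hform_scale hform_rank_one ip_def by simp
  finally have "- Re (hform {..<n} (\<lambda>i j. M $$ (i, j)) f) = (\<Sum>r<k. - l r * (cmod (ip n (v r) f))\<^sup>2)"
    by (simp add: sum_negf flip: of_real_mult of_real_power)
  \<comment> \<open>By Bessel the weights lie between 0 and 1, so each term is at most the negative
    part of the eigenvalue \<open>l r\<close>.\<close>
  also have "\<dots> \<le> (\<Sum>r<k. (\<bar>l r\<bar> - l r) / 2)"
  proof (intro sum_mono)
    fix r assume r: "r \<in> {..<k}"
    have "(cmod (ip n (v r) f))\<^sup>2 \<le> (\<Sum>r<k. (cmod (ip n (v r) f))\<^sup>2)"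
      by (rule member_le_sum) (use r in auto)
    then have 1: "(cmod (ip n (v r) f))\<^sup>2 \<le> 1" using bessel[OF v, of f] f by linarith
    show "- l r * (cmod (ip n (v r) f))\<^sup>2 \<le> (\<bar>l r\<bar> - l r) / 2"
    proof (cases "l r \<ge> 0")
      case True
      then show ?thesis by simp
    next
      case False
      then show ?thesis using mult_left_mono[OF 1, of "- l r"] by simp
    qed
  qed
  also have "\<dots> = 1 / 2 * trace_norm M"
    by (simp add: tn l0 sum_subtractf flip: sum_divide_distrib)
  finally show "- Re (hform {..<n} (\<lambda>i j. M $$ (i, j)) f) \<le> 1 / 2 * trace_norm M" .
qed

lemma trace_norm_zero: "trace_norm (0\<^sub>m n n) = 0"
proof -
  have "mat_adjoint (0\<^sub>m n n :: op) = 0\<^sub>m n n"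
    by (rule eq_matI) (auto simp: mat_adjoint_def mat_of_rows_def)
  moreover have "psd n (0\<^sub>m n n)" by (auto simp: psd_iff_psdk psdk_def hform_def)
  ultimately have "psd_sqrt (mat_adjoint (0\<^sub>m n n) * 0\<^sub>m n n) = 0\<^sub>m n n"
    by (intro psd_sqrt_eq[of n]) auto
  then show ?thesis by (simp add: trace_norm_def mtrace_def)
qed

section \<open>Product vectors and the antisymmetric projector\<close>

abbreviation hp2 :: "nat \<Rightarrow> nat \<Rightarrow> nat \<Rightarrow> nat \<times> nat \<Rightarrow> nat \<times> nat" where
  "hp2 a b n \<equiv> map_prod (\<lambda>x. x div a ^ n) (\<lambda>x. x div b ^ n)"

abbreviation tp2 :: "nat \<Rightarrow> nat \<Rightarrow> nat \<Rightarrow> nat \<times> nat \<Rightarrow> nat \<times> nat" where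
  "tp2 a b n \<equiv> map_prod (\<lambda>x. x mod a ^ n) (\<lambda>x. x mod b ^ n)"

abbreviation pow2 :: "nat \<Rightarrow> nat \<Rightarrow> (nat \<times> nat \<Rightarrow> nat \<times> nat \<Rightarrow> complex) \<Rightarrow> nat \<Rightarrow> nat \<times> nat \<Rightarrow> nat \<times> nat \<Rightarrow> complex" where
  "pow2 a b \<equiv> kpw (hp2 a b) (tp2 a b)"

abbreviation sq2 :: "nat \<Rightarrow> (nat \<times> nat) set" where
  "sq2 D \<equiv> {..<D} \<times> {..<D}"

text \<open>Indices have the shape ((A, B), A'); each of the three components is cut into digits
  separately.\<close>

abbreviation pow3 :: "nat \<Rightarrow> ((nat \<times> nat) \<times> nat \<Rightarrow> (nat \<times> nat) \<times> nat \<Rightarrow> complex) \<Rightarrow> nat \<Rightarrow> (nat \<times> nat) \<times> nat \<Rightarrow> (nat \<times> nat) \<times> nat \<Rightarrow> complex" where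
  "pow3 d \<equiv> kpw (\<lambda>n. map_prod (hp2 d d n) (\<lambda>x. x div d ^ n)) (\<lambda>n. map_prod (tp2 d d n) (\<lambda>x. x mod d ^ n))"

lemma splitting2: "a > 0 \<Longrightarrow> b > 0 \<Longrightarrow> splitting (hp2 a b) (tp2 a b) (\<lambda>n. {..<a ^ n} \<times> {..<b ^ n}) ({..<a} \<times> {..<b})"
  using splitting_Times[OF splitting_nat splitting_nat] by simp

lemma splitting3: "d > 0 \<Longrightarrow> splitting (\<lambda>n. map_prod (hp2 d d n) (\<lambda>x. x div d ^ n))
    (\<lambda>n. map_prod (tp2 d d n) (\<lambda>x. x mod d ^ n)) (\<lambda>n. sq2 (d ^ n) \<times> {..<d ^ n}) (sq2 d \<times> {..<d})"
  using splitting_Times[OF splitting2 splitting_nat] by simp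

text \<open>
  For a projector P on AB and a third system A' isomorphic to A, these are the kernels of
  P, of P F P with F the swap of A and A', and of the partial transpose of P F P on A'.
\<close>

definition kerQ :: "(nat \<times> nat \<Rightarrow> nat \<times> nat \<Rightarrow> complex) \<Rightarrow> (nat \<times> nat) \<times> nat \<Rightarrow> (nat \<times> nat) \<times> nat \<Rightarrow> complex" where
  "kerQ P s t = P (fst s) (fst t) * of_bool (snd s = snd t)"

definition kerX :: "nat \<Rightarrow> (nat \<times> nat \<Rightarrow> nat \<times> nat \<Rightarrow> complex) \<Rightarrow> (nat \<times> nat) \<times> nat \<Rightarrow> (nat \<times> nat) \<times> nat \<Rightarrow> complex" where
  "kerX D P s t = (\<Sum>v<D. P (fst s) (snd t, v) * P (snd s, v) (fst t))"

definition kerG :: "nat \<Rightarrow> (nat \<times> nat \<Rightarrow> nat \<times> nat \<Rightarrow> complex) \<Rightarrow> (nat \<times> nat) \<times> nat \<Rightarrow> (nat \<times> nat) \<times> nat \<Rightarrow> complex" where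
  "kerG D P s t = (\<Sum>v<D. P (fst s) (snd s, v) * P (snd t, v) (fst t))"

text \<open>Partial transposition on the second tensor factor. This is A' for kernels over ((A, B),
  A') and B for kernels over (A, B); both uses occur.\<close>

definition transpose_snd :: "('a \<times> 'b \<Rightarrow> 'a \<times> 'b \<Rightarrow> complex) \<Rightarrow> 'a \<times> 'b \<Rightarrow> 'a \<times> 'b \<Rightarrow> complex" where
  "transpose_snd K s t = K (fst s, snd t) (fst t, snd s)"

lemma sum_div_mod:
  fixes a b :: nat
  assumes "b > 0"
  shows "(\<Sum>x<a * b. f (x div b) (x mod b)) = (\<Sum>i<a. \<Sum>j<b. f i j)"
  using sum.reindex_bij_betw[OF bij_betw_div_mod[OF assms, of a], of "\<lambda>(i, j). f i j"]
  by (simp add: sum.cartesian_product)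

lemma eq_iff_div_mod: "x = y \<longleftrightarrow> x div m = y div m \<and> x mod m = y mod (m::nat)"
  by (metis div_mult_mod_eq)

text \<open>The identity on A'^n is the power of the identity on A', since indices agree iff all
  digits do. At n = 0 the range condition forces the two A' indices to be equal.\<close>

lemma pow3_kerQ:
  "snd s < d ^ n \<Longrightarrow> snd t < d ^ n \<Longrightarrow> pow3 d (kerQ P) n s t = kerQ (pow2 d d P n) s t"
proof (induction n arbitrary: s t)
  case 0
  then show ?case by (simp add: kerQ_def)
next
  case (Suc n)
  then have d: "d ^ n > 0" by (cases "d = 0") auto
  have "snd s = snd t \<longleftrightarrow> snd s div d ^ n = snd t div d ^ n \<and> snd s mod d ^ n = snd t mod d ^ n"
    by (rule eq_iff_div_mod)
  then show ?case using d Suc.IH[of "map_prod (tp2 d d n) (\<lambda>x. x mod d ^ n) s" "map_prod (tp2 d d n) (\<lambda>x. x mod d ^ n) t"]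
    by (simp add: kerQ_def)
qed

text \<open>The swap of A^n with A'^n is the n-th power of the single swap; accordingly the sum over
  the B-index v factors digit by digit.\<close>

lemma pow3_kerX:
  assumes "d > 0"
  shows "pow3 d (kerX d P) n s t = kerX (d ^ n) (pow2 d d P n) s t"
proof (induction n arbitrary: s t)
  case 0
  then show ?case by (simp add: kerX_def)
next
  case (Suc n)
  let ?h = "hp2 d d n" and ?t = "tp2 d d n" and ?N = "d ^ n"
  have "kerX (d ^ Suc n) (pow2 d d P (Suc n)) s t =
     (\<Sum>v<d * ?N. P (?h (fst s)) (snd t div ?N, v div ?N) * P (snd s div ?N, v div ?N) (?h (fst t)) *
        (pow2 d d P n (?t (fst s)) (snd t mod ?N, v mod ?N) * pow2 d d P n (snd s mod ?N, v mod ?N) (?t (fst t))))"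
    by (simp add: kerX_def mult_ac)
  also have "\<dots> = (\<Sum>i<d. \<Sum>j<?N. P (?h (fst s)) (snd t div ?N, i) * P (snd s div ?N, i) (?h (fst t)) *
        (pow2 d d P n (?t (fst s)) (snd t mod ?N, j) * pow2 d d P n (snd s mod ?N, j) (?t (fst t))))"
    using assms by (subst sum_div_mod[symmetric]) simp_all
  also have "\<dots> = pow3 d (kerX d P) (Suc n) s t"
    unfolding kpw.simps Suc.IH by (simp add: kerX_def sum_product)
  finally show ?case by (rule sym)
qed

lemma kpw_transpose_snd:
  "kpw (\<lambda>n. map_prod (h n) (h' n)) (\<lambda>n. map_prod (t n) (t' n)) (transpose_snd K) n p q =
    transpose_snd (kpw (\<lambda>n. map_prod (h n) (h' n)) (\<lambda>n. map_prod (t n) (t' n)) K n) p q"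
  by (induction n arbitrary: p q) (simp_all add: transpose_snd_def)

text \<open>Exchanging the summation indices of the second factor conjugates that factor of the
  vector. Product vectors thus evaluate a kernel and its partial transpose alike, although
  positivity may hold for only one of the two.\<close>

lemma hform_transpose_snd:
  "hform (I \<times> J) (transpose_snd K) (\<lambda>s. f (fst s) * cnj (g (snd s))) = hform (I \<times> J) K (\<lambda>s. f (fst s) * g (snd s))"
proof -
  have "hform (I \<times> J) (transpose_snd K) (\<lambda>s. f (fst s) * cnj (g (snd s))) =
      (\<Sum>p\<in>I. \<Sum>k\<in>J. \<Sum>q\<in>I. \<Sum>l\<in>J. cnj (f p) * g k * K (p, l) (q, k) * (f q * cnj (g l)))"
    by (simp add: hform_def transpose_snd_def sum.cartesian_product')
  also have "\<dots> = (\<Sum>p\<in>I. \<Sum>q\<in>I. \<Sum>k\<in>J. \<Sum>l\<in>J. cnj (f p) * g k * K (p, l) (q, k) * (f q * cnj (g l)))"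
    by (intro sum.cong refl sum.swap)
  also have "\<dots> = (\<Sum>p\<in>I. \<Sum>q\<in>I. \<Sum>l\<in>J. \<Sum>k\<in>J. cnj (f p) * g k * K (p, l) (q, k) * (f q * cnj (g l)))"
    by (intro sum.cong refl sum.swap)
  also have "\<dots> = (\<Sum>p\<in>I. \<Sum>l\<in>J. \<Sum>q\<in>I. \<Sum>k\<in>J. cnj (f p) * g k * K (p, l) (q, k) * (f q * cnj (g l)))"
    by (intro sum.cong refl sum.swap)
  also have "\<dots> = hform (I \<times> J) K (\<lambda>s. f (fst s) * g (snd s))"
    by (simp add: hform_def sum.cartesian_product' mult_ac)
  finally show ?thesis .
qed

text \<open>The vector obtained from f by applying P on AB and the identity on A', with separate
  indices for A, B and A'.\<close>

definition act :: "nat \<Rightarrow> (nat \<times> nat \<Rightarrow> nat \<times> nat \<Rightarrow> complex) \<Rightarrow> ((nat \<times> nat) \<times> nat \<Rightarrow> complex) \<Rightarrow> nat \<Rightarrow> nat \<Rightarrow> nat \<Rightarrow> complex" where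
  "act D P f x y z = (\<Sum>p\<in>sq2 D. P (x, y) p * f (p, z))"

text \<open>Hermiticity is stated for all indices, not just those in range, so that it passes to
  tensor powers without side conditions.\<close>

definition symk :: "(nat \<times> nat \<Rightarrow> nat \<times> nat \<Rightarrow> complex) \<Rightarrow> bool" where
  "symk P \<longleftrightarrow> (\<forall>p q. P p q = cnj (P q p))"

lemma symkD: "symk P \<Longrightarrow> P p q = cnj (P q p)"
  unfolding symk_def by (erule allE)+

lemma act_cnj: "symk P \<Longrightarrow> (\<Sum>p\<in>sq2 D. cnj (f (p, z)) * P p (x, y)) = cnj (act D P f x y z)"
  unfolding act_def cnj_sum complex_cnj_mult by (intro sum.cong refl) (subst symkD[of P], simp_all add: mult.commute)

lemma hform_kerQ: "hform (sq2 D \<times> {..<D}) (kerQ P) f = (\<Sum>k<D. hform (sq2 D) P (\<lambda>p. f (p, k)))"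
proof -
  have "hform (sq2 D \<times> {..<D}) (kerQ P) f =
      (\<Sum>p\<in>sq2 D. \<Sum>k<D. \<Sum>q\<in>sq2 D. \<Sum>l<D. if l = k then cnj (f (p, k)) * P p q * f (q, k) else 0)"
    unfolding hform_def sum.cartesian_product'[of _ "sq2 D"]
    by (intro sum.cong refl) (auto simp: kerQ_def)
  also have "\<dots> = (\<Sum>p\<in>sq2 D. \<Sum>k<D. \<Sum>q\<in>sq2 D. cnj (f (p, k)) * P p q * f (q, k))"
    by (intro sum.cong refl) simp
  also have "\<dots> = (\<Sum>k<D. \<Sum>p\<in>sq2 D. \<Sum>q\<in>sq2 D. cnj (f (p, k)) * P p q * f (q, k))" by (rule sum.swap)
  finally show ?thesis by (simp add: hform_def)
qed

text \<open>The expectation of P F P in f is that of F in P f, and F exchanges x and z.\<close>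

lemma hform_kerX:
  assumes "symk P"
  shows "hform (sq2 D \<times> {..<D}) (kerX D P) f =
    (\<Sum>x<D. \<Sum>y<D. \<Sum>z<D. cnj (act D P f x y z) * act D P f z y x)"
proof -
  have "hform (sq2 D \<times> {..<D}) (kerX D P) f =
      (\<Sum>s\<in>sq2 D. \<Sum>z<D. \<Sum>t\<in>sq2 D. \<Sum>x<D. \<Sum>y<D. cnj (f (s, z)) * P s (x, y) * (P (z, y) t * f (t, x)))"
    by (simp add: hform_def kerX_def sum.cartesian_product'[of _ "sq2 D"] sum_distrib_left sum_distrib_right mult.assoc)
  also have "\<dots> = (\<Sum>s\<in>sq2 D. \<Sum>z<D. \<Sum>x<D. \<Sum>t\<in>sq2 D. \<Sum>y<D. cnj (f (s, z)) * P s (x, y) * (P (z, y) t * f (t, x)))"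
    by (intro sum.cong refl sum.swap)
  also have "\<dots> = (\<Sum>s\<in>sq2 D. \<Sum>z<D. \<Sum>x<D. \<Sum>y<D. \<Sum>t\<in>sq2 D. cnj (f (s, z)) * P s (x, y) * (P (z, y) t * f (t, x)))"
    by (intro sum.cong refl sum.swap)
  also have "\<dots> = (\<Sum>s\<in>sq2 D. \<Sum>z<D. \<Sum>x<D. \<Sum>y<D. cnj (f (s, z)) * P s (x, y) * act D P f z y x)"
    by (simp add: act_def sum_distrib_left)
  also have "\<dots> = (\<Sum>z<D. \<Sum>s\<in>sq2 D. \<Sum>x<D. \<Sum>y<D. cnj (f (s, z)) * P s (x, y) * act D P f z y x)"
    by (rule sum.swap)
  also have "\<dots> = (\<Sum>z<D. \<Sum>x<D. \<Sum>s\<in>sq2 D. \<Sum>y<D. cnj (f (s, z)) * P s (x, y) * act D P f z y x)"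
    by (intro sum.cong refl sum.swap)
  also have "\<dots> = (\<Sum>z<D. \<Sum>x<D. \<Sum>y<D. \<Sum>s\<in>sq2 D. cnj (f (s, z)) * P s (x, y) * act D P f z y x)"
    by (intro sum.cong refl sum.swap)
  also have "\<dots> = (\<Sum>z<D. \<Sum>x<D. \<Sum>y<D. cnj (act D P f x y z) * act D P f z y x)"
    unfolding sum_distrib_right[symmetric] act_cnj[OF assms] ..
  also have "\<dots> = (\<Sum>x<D. \<Sum>z<D. \<Sum>y<D. cnj (act D P f x y z) * act D P f z y x)" by (rule sum.swap)
  also have "\<dots> = (\<Sum>x<D. \<Sum>y<D. \<Sum>z<D. cnj (act D P f x y z) * act D P f z y x)"
    by (intro sum.cong refl sum.swap)
  finally show ?thesis .
qed

text \<open>\<open>kerG\<close> is the unnormalized maximally entangled projector on AA', compressed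
  by P. It is a sum of rank-one kernels over v, and its form is the squared norm of the vector left
  on B after contracting P f along x = z.\<close>

lemma hform_kerG:
  assumes "symk P"
  shows "hform (sq2 D \<times> {..<D}) (kerG D P) f = (\<Sum>y<D. complex_of_real ((cmod (\<Sum>x<D. act D P f x y x))\<^sup>2))"
proof -
  have sc: "P p q = cnj (P q p)" for p q by (rule symkD[OF assms])
  have 1: "kerG D P s t = (\<Sum>v<D. P (fst s) (snd s, v) * cnj (P (fst t) (snd t, v)))" for s t
    unfolding kerG_def by (intro sum.cong refl arg_cong2[where f = "(*)"] sc)
  have 2: "(\<Sum>s\<in>sq2 D \<times> {..<D}. cnj (P (fst s) (snd s, v)) * f s) = (\<Sum>x<D. act D P f x v x)" for v
  proof -
    have "(\<Sum>s\<in>sq2 D \<times> {..<D}. cnj (P (fst s) (snd s, v)) * f s) =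
        (\<Sum>p\<in>sq2 D. \<Sum>x<D. P (x, v) p * f (p, x))"
      unfolding sum.cartesian_product'[of _ "sq2 D"] sc[symmetric] fst_conv snd_conv ..
    also have "\<dots> = (\<Sum>x<D. \<Sum>p\<in>sq2 D. P (x, v) p * f (p, x))" by (rule sum.swap)
    finally show ?thesis by (simp add: act_def)
  qed
  show ?thesis unfolding 1[abs_def] hform_sum hform_rank_one 2 ..
qed

section \<open>The antisymmetric projector on one copy and its three-system forms\<close>

definition antisymk :: "nat \<times> nat \<Rightarrow> nat \<times> nat \<Rightarrow> complex" where
  "antisymk p q = ((if p = q then 1 else 0) - (if p = (snd q, fst q) then 1 else 0)) / 2"

lemma antisymk_left: "antisymk (x, y) p = ((if p = (x, y) then 1 else 0) - (if p = (y, x) then 1 else 0)) / 2"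
proof -
  have "(x, y) = p \<longleftrightarrow> p = (x, y)" "(x, y) = (snd p, fst p) \<longleftrightarrow> p = (y, x)" by (cases p, fastforce)+
  then show ?thesis unfolding antisymk_def by (simp only:)
qed

lemma symk_antisymk: "symk antisymk"
  unfolding symk_def
proof (intro allI)
  fix p q :: "nat \<times> nat"
  have "p = q \<longleftrightarrow> q = p" "p = (snd q, fst q) \<longleftrightarrow> q = (snd p, fst p)" by (cases p, cases q, fastforce)+
  then have "antisymk p q = antisymk q p" unfolding antisymk_def by (simp only:)
  moreover have "cnj (antisymk q p) = antisymk q p" by (simp add: antisymk_def)
  ultimately show "antisymk p q = cnj (antisymk q p)" by (simp only:)
qed

lemma act_antisymk:
  assumes "x < d" "y < d"
  shows "act d antisymk f x y z = (f ((x, y), z) - f ((y, x), z)) / 2"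
proof -
  have half: "((if A then 1 else 0) - (if B then 1 else 0)) / 2 * w = (if A then w / 2 else 0) - (if B then w / 2 else 0)"
    for A B and w :: complex by simp
  have "act d antisymk f x y z = (\<Sum>p\<in>sq2 d. (if p = (x, y) then f (p, z) / 2 else 0) - (if p = (y, x) then f (p, z) / 2 else 0))"
    unfolding act_def by (intro sum.cong refl) (simp only: antisymk_left half)
  also have "\<dots> = f ((x, y), z) / 2 - f ((y, x), z) / 2"
    using assms by (simp add: sum_subtractf)
  finally show ?thesis by (simp add: diff_divide_distrib)
qed

lemma sum3_swap13: "(\<Sum>x<d. \<Sum>y<d. \<Sum>z<d. F z y x) = (\<Sum>x<d. \<Sum>y<d. \<Sum>z<(d::nat). F x y z)"
  for F :: "nat \<Rightarrow> nat \<Rightarrow> nat \<Rightarrow> 'a::comm_monoid_add"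
proof -
  have "(\<Sum>x<d. \<Sum>y<d. \<Sum>z<d. F z y x) = (\<Sum>y<d. \<Sum>x<d. \<Sum>z<d. F z y x)" by (rule sum.swap)
  also have "\<dots> = (\<Sum>y<d. \<Sum>z<d. \<Sum>x<d. F z y x)" by (intro sum.cong refl sum.swap)
  also have "\<dots> = (\<Sum>z<d. \<Sum>y<d. \<Sum>x<d. F z y x)" by (rule sum.swap)
  finally show ?thesis .
qed

lemma sum3_swap12: "(\<Sum>x<d. \<Sum>y<d. \<Sum>z<d. F y x z) = (\<Sum>x<d. \<Sum>y<d. \<Sum>z<(d::nat). F x y z)"
  for F :: "nat \<Rightarrow> nat \<Rightarrow> nat \<Rightarrow> 'a::comm_monoid_add"
  by (rule sum.swap)

lemma sum3_swap23: "(\<Sum>x<d. \<Sum>y<d. \<Sum>z<d. F x z y) = (\<Sum>x<d. \<Sum>y<d. \<Sum>z<(d::nat). F x y z)"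
  for F :: "nat \<Rightarrow> nat \<Rightarrow> nat \<Rightarrow> 'a::comm_monoid_add"
  by (intro sum.cong refl sum.swap)

text \<open>On \<open>g\<close> the permutation (12) acts as -1; S is the squared norm and T the
  expectation of (13). The first two bounds are squared norms: of g + (13)g, equal to 2(S + T), and
  of g - (13)g - (23)g, which is three times the total antisymmetrization, equal to 3(S - 2T). The
  third combines Cauchy-Schwarz with the disjointness of the entries z = x and z = y.\<close>

lemma antisymmetric_forms:
  fixes g :: "nat \<Rightarrow> nat \<Rightarrow> nat \<Rightarrow> complex"
  assumes anti: "\<And>x y z. x < d \<Longrightarrow> y < d \<Longrightarrow> g y x z = - g x y z"
  defines "S \<equiv> (\<Sum>x<d. \<Sum>y<d. \<Sum>z<d. cnj (g x y z) * g x y z)"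
    and "T \<equiv> (\<Sum>x<d. \<Sum>y<d. \<Sum>z<d. cnj (g x y z) * g z y x)"
  shows "0 \<le> S + T" "0 \<le> S - 2 * T"
    "(\<Sum>y<d. complex_of_real ((cmod (\<Sum>x<d. g x y x))\<^sup>2)) \<le> of_nat d / 2 * S"
proof -
  note sumrules = sum.distrib sum_subtractf sum_negf
  have nonneg: "0 \<le> (\<Sum>x<d. \<Sum>y<d. \<Sum>z<d. cnj (h x y z) * h x y z)" for h :: "nat \<Rightarrow> nat \<Rightarrow> nat \<Rightarrow> complex"
    by (intro sum_nonneg cnj_mult_self_nonneg)
  have S13: "(\<Sum>x<d. \<Sum>y<d. \<Sum>z<d. cnj (g z y x) * g z y x) = S"
    unfolding S_def by (rule sum3_swap13)
  have S23: "(\<Sum>x<d. \<Sum>y<d. \<Sum>z<d. cnj (g x z y) * g x z y) = S"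
    unfolding S_def by (rule sum3_swap23)
  have T13: "(\<Sum>x<d. \<Sum>y<d. \<Sum>z<d. cnj (g z y x) * g x y z) = T"
    unfolding T_def by (rule sum3_swap13)
  have "(\<Sum>x<d. \<Sum>y<d. \<Sum>z<d. cnj (g x y z + g z y x) * (g x y z + g z y x)) = S + T + (T + S)"
    by (simp add: distrib_left distrib_right sumrules S13 T13 flip: S_def T_def)
  then have "0 \<le> 2 * (S + T)" using nonneg[of "\<lambda>x y z. g x y z + g z y x"] by (simp add: algebra_simps)
  then show "0 \<le> S + T" by (simp add: less_eq_complex_def)
  \<comment> \<open>(23) is conjugate to (13) by (12), and the two signs from (12) cancel.\<close>
  have U: "(\<Sum>x<d. \<Sum>y<d. \<Sum>z<d. cnj (g x y z) * g x z y) = T"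
  proof -
    have "(\<Sum>x<d. \<Sum>y<d. \<Sum>z<d. cnj (g x y z) * g x z y) = (\<Sum>x<d. \<Sum>y<d. \<Sum>z<d. cnj (g y x z) * g z x y)"
    proof (intro sum.cong refl)
      fix x y z assume "x \<in> {..<d}" "y \<in> {..<d}" "z \<in> {..<d}"
      then show "cnj (g x y z) * g x z y = cnj (g y x z) * g z x y"
        using anti[of y x z] anti[of z x y] by simp
    qed
    also have "\<dots> = T" unfolding T_def by (rule sum3_swap12)
    finally show ?thesis .
  qed
  have U': "(\<Sum>x<d. \<Sum>y<d. \<Sum>z<d. cnj (g x z y) * g x y z) = T"
    unfolding U[symmetric] by (rule sum3_swap23)
  \<comment> \<open>The product of (13) and (23) is a 3-cycle, that is, a transposition times (12);
    hence the sign.\<close>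
  have V: "(\<Sum>x<d. \<Sum>y<d. \<Sum>z<d. cnj (g z y x) * g x z y) = - T"
  proof -
    have "(\<Sum>x<d. \<Sum>y<d. \<Sum>z<d. cnj (g z y x) * g x z y) = (\<Sum>x<d. \<Sum>y<d. \<Sum>z<d. - (cnj (g z y x) * g z x y))"
    proof (intro sum.cong refl)
      fix x y z assume "x \<in> {..<d}" "y \<in> {..<d}" "z \<in> {..<d}"
      then show "cnj (g z y x) * g x z y = - (cnj (g z y x) * g z x y)"
        using anti[of z x y] by simp
    qed
    also have "\<dots> = - (\<Sum>x<d. \<Sum>y<d. \<Sum>z<d. cnj (g z y x) * g z x y)" by (simp add: sum_negf)
    also have "(\<Sum>x<d. \<Sum>y<d. \<Sum>z<d. cnj (g z y x) * g z x y) = T"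
      unfolding U[symmetric] by (rule sum3_swap13)
    finally show ?thesis .
  qed
  have V': "(\<Sum>x<d. \<Sum>y<d. \<Sum>z<d. cnj (g x z y) * g z y x) = - T"
  proof -
    have "(\<Sum>x<d. \<Sum>y<d. \<Sum>z<d. cnj (g x z y) * g z y x) = cnj (\<Sum>x<d. \<Sum>y<d. \<Sum>z<d. cnj (g z y x) * g x z y)"
      by (simp add: mult.commute)
    also have "\<dots> = - cnj T" unfolding V by simp
    also have "cnj T = (\<Sum>x<d. \<Sum>y<d. \<Sum>z<d. cnj (g z y x) * g x y z)" by (simp add: T_def mult.commute)
    also have "\<dots> = T" by (rule T13)
    finally show ?thesis .
  qed
  have "(\<Sum>x<d. \<Sum>y<d. \<Sum>z<d. cnj (g x y z - g z y x - g x z y) * (g x y z - g z y x - g x z y)) =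
      (\<Sum>x<d. \<Sum>y<d. \<Sum>z<d. cnj (g x y z) * g x y z + cnj (g z y x) * g z y x + cnj (g x z y) * g x z y
        - cnj (g x y z) * g z y x - cnj (g z y x) * g x y z
        - cnj (g x y z) * g x z y - cnj (g x z y) * g x y z
        + cnj (g z y x) * g x z y + cnj (g x z y) * g z y x)"
    by (intro sum.cong refl) (simp add: algebra_simps)
  also have "\<dots> = 3 * (S - 2 * T)"
    unfolding sumrules S13 S23 T13 U U' V V' S_def[symmetric] T_def[symmetric] by simp
  finally have "0 \<le> 3 * (S - 2 * T)" using nonneg[of "\<lambda>x y z. g x y z - g z y x - g x z y"] by simp
  then show "0 \<le> S - 2 * T" by (simp add: less_eq_complex_def)
  have Sr: "S = complex_of_real (\<Sum>x<d. \<Sum>y<d. \<Sum>z<d. (cmod (g x y z))\<^sup>2)"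
    unfolding S_def of_real_sum by (intro sum.cong refl) (simp only: complex_norm_square mult.commute)
  have diag: "g x x z = 0" if "x < d" for x z
    using anti[OF that that, of z] by simp
  \<comment> \<open>Antisymmetry gives g x x z = 0, and for x \<noteq> y the entries z = x and z = y
    are different summands. They have the same total weight, which produces the 1/2 in d/2.\<close>
  have "(\<Sum>x<d. \<Sum>y<d. (cmod (g x y x))\<^sup>2 + (cmod (g x y y))\<^sup>2) \<le> (\<Sum>x<d. \<Sum>y<d. \<Sum>z<d. (cmod (g x y z))\<^sup>2)"
  proof (intro sum_mono)
    fix x y assume xy: "x \<in> {..<d}" "y \<in> {..<d}"
    show "(cmod (g x y x))\<^sup>2 + (cmod (g x y y))\<^sup>2 \<le> (\<Sum>z<d. (cmod (g x y z))\<^sup>2)"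
    proof (cases "x = y")
      case True
      then show ?thesis using diag xy by simp
    next
      case False
      then have "(cmod (g x y x))\<^sup>2 + (cmod (g x y y))\<^sup>2 = (\<Sum>z\<in>{x, y}. (cmod (g x y z))\<^sup>2)" by simp
      also have "\<dots> \<le> (\<Sum>z<d. (cmod (g x y z))\<^sup>2)" using xy by (intro sum_mono2) auto
      finally show ?thesis .
    qed
  qed
  moreover have "(\<Sum>x<d. \<Sum>y<d. (cmod (g x y y))\<^sup>2) = (\<Sum>x<d. \<Sum>y<d. (cmod (g x y x))\<^sup>2)"
  proof -
    have "(\<Sum>x<d. \<Sum>y<d. (cmod (g x y y))\<^sup>2) = (\<Sum>x<d. \<Sum>y<d. (cmod (g y x y))\<^sup>2)"
    proof (intro sum.cong refl)
      fix x y assume "x \<in> {..<d}" "y \<in> {..<d}"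
      then show "(cmod (g x y y))\<^sup>2 = (cmod (g y x y))\<^sup>2" using anti[of x y y] by simp
    qed
    then show ?thesis by (subst (asm) sum.swap)
  qed
  ultimately have half: "2 * (\<Sum>x<d. \<Sum>y<d. (cmod (g x y x))\<^sup>2) \<le> (\<Sum>x<d. \<Sum>y<d. \<Sum>z<d. (cmod (g x y z))\<^sup>2)"
    by (simp add: sum.distrib)
  have "(\<Sum>y<d. (cmod (\<Sum>x<d. g x y x))\<^sup>2) \<le> (\<Sum>y<d. real d * (\<Sum>x<d. (cmod (g x y x))\<^sup>2))"
  proof (rule sum_mono)
    fix y
    have "(cmod (\<Sum>x<d. g x y x))\<^sup>2 \<le> (\<Sum>x<d. 1 * cmod (g x y x))\<^sup>2"
      by (intro power_mono) (simp_all add: norm_sum)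
    also have "\<dots> \<le> (\<Sum>x<d. 1\<^sup>2) * (\<Sum>x<d. (cmod (g x y x))\<^sup>2)" by (rule Cauchy_Schwarz_ineq_sum)
    finally show "(cmod (\<Sum>x<d. g x y x))\<^sup>2 \<le> real d * (\<Sum>x<d. (cmod (g x y x))\<^sup>2)" by simp
  qed
  also have "\<dots> = real d * (\<Sum>x<d. \<Sum>y<d. (cmod (g x y x))\<^sup>2)"
    unfolding sum_distrib_left by (rule sum.swap)
  also have "\<dots> \<le> real d / 2 * (\<Sum>x<d. \<Sum>y<d. \<Sum>z<d. (cmod (g x y z))\<^sup>2)"
    using mult_left_mono[OF half, of "real d / 2"] by simp
  finally have "complex_of_real (\<Sum>y<d. (cmod (\<Sum>x<d. g x y x))\<^sup>2) \<le>
      complex_of_real (real d / 2 * (\<Sum>x<d. \<Sum>y<d. \<Sum>z<d. (cmod (g x y z))\<^sup>2))"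
    by (simp only: less_eq_complex_def Re_complex_of_real Im_complex_of_real)
  then show "(\<Sum>y<d. complex_of_real ((cmod (\<Sum>x<d. g x y x))\<^sup>2)) \<le> of_nat d / 2 * S"
    unfolding Sr by (simp only: of_real_sum of_real_mult of_real_divide of_real_of_nat_eq of_real_numeral)
qed

lemma hform_antisymk: "hform (sq2 d) antisymk f =
    (\<Sum>x<d. \<Sum>y<d. cnj ((f (x, y) - f (y, x)) / 2) * ((f (x, y) - f (y, x)) / 2))"
proof -
  have "hform (sq2 d) antisymk f = (\<Sum>x<d. \<Sum>y<d. cnj (f (x, y)) * act d antisymk (\<lambda>s. f (fst s)) x y 0)"
    by (simp add: hform_def act_def sum.cartesian_product' sum_distrib_left mult.assoc)
  also have "\<dots> = (\<Sum>x<d. \<Sum>y<d. cnj (f (x, y)) * ((f (x, y) - f (y, x)) / 2))"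
    by (intro sum.cong refl) (simp add: act_antisymk)
  finally have 1: "hform (sq2 d) antisymk f = (\<Sum>x<d. \<Sum>y<d. cnj (f (x, y)) * ((f (x, y) - f (y, x)) / 2))" .
  then have 2: "hform (sq2 d) antisymk f = (\<Sum>x<d. \<Sum>y<d. cnj (f (y, x)) * ((f (y, x) - f (x, y)) / 2))"
    by (subst sum.swap)
  have "hform (sq2 d) antisymk f = (hform (sq2 d) antisymk f + hform (sq2 d) antisymk f) / 2" by simp
  also have "\<dots> = (\<Sum>x<d. \<Sum>y<d. (cnj (f (x, y)) * ((f (x, y) - f (y, x)) / 2) +
      cnj (f (y, x)) * ((f (y, x) - f (x, y)) / 2)) / 2)"
    by (subst (1) 1, subst 2) (simp only: sum.distrib sum_divide_distrib add_divide_distrib)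
  also have "\<dots> = (\<Sum>x<d. \<Sum>y<d. cnj ((f (x, y) - f (y, x)) / 2) * ((f (x, y) - f (y, x)) / 2))"
    by (intro sum.cong refl) (simp add: field_simps)
  finally show ?thesis .
qed

lemma antisymk_kernels:
  shows "psdk (sq2 d \<times> {..<d}) (kerQ antisymk)"
    and "psdk (sq2 d \<times> {..<d}) (\<lambda>s t. kerQ antisymk s t + kerX d antisymk s t)"
    and "psdk (sq2 d \<times> {..<d}) (\<lambda>s t. kerQ antisymk s t - 2 * kerX d antisymk s t)"
    and "psdk (sq2 d \<times> {..<d}) (kerG d antisymk)"
    and "psdk (sq2 d \<times> {..<d}) (\<lambda>s t. of_nat d / 2 * kerQ antisymk s t - kerG d antisymk s t)"
proof -
  let ?I = "sq2 d \<times> {..<d}"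
  have Q: "hform ?I (kerQ antisymk) f = (\<Sum>x<d. \<Sum>y<d. \<Sum>z<d. cnj (act d antisymk f x y z) * act d antisymk f x y z)" for f
  proof -
    have "hform ?I (kerQ antisymk) f = (\<Sum>z<d. \<Sum>x<d. \<Sum>y<d. cnj (act d antisymk f x y z) * act d antisymk f x y z)"
      unfolding hform_kerQ hform_antisymk by (intro sum.cong refl) (simp add: act_antisymk)
    also have "\<dots> = (\<Sum>x<d. \<Sum>z<d. \<Sum>y<d. cnj (act d antisymk f x y z) * act d antisymk f x y z)" by (rule sum.swap)
    finally show ?thesis by (simp only: sum3_swap23[of "\<lambda>x y z. cnj (act d antisymk f x y z) * act d antisymk f x y z"])
  qed
  have anti: "act d antisymk f y x z = - act d antisymk f x y z" if "x < d" "y < d" for f x y z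
    using that by (simp add: act_antisymk field_simps)
  note A = antisymmetric_forms[of d "act d antisymk f" for f, OF anti]
  show "psdk ?I (kerQ antisymk)"
    unfolding psdk_def Q by (auto intro!: sum_nonneg cnj_mult_self_nonneg)
  show "psdk ?I (\<lambda>s t. kerQ antisymk s t + kerX d antisymk s t)"
    unfolding psdk_def hform_add Q hform_kerX[OF symk_antisymk] using A(1) by blast
  show "psdk ?I (\<lambda>s t. kerQ antisymk s t - 2 * kerX d antisymk s t)"
    unfolding psdk_def hform_diff hform_scale Q hform_kerX[OF symk_antisymk] using A(2) by blast
  show "psdk ?I (kerG d antisymk)"
    unfolding psdk_def hform_kerG[OF symk_antisymk] by (auto intro!: sum_nonneg simp: less_eq_complex_def)
  show "psdk ?I (\<lambda>s t. of_nat d / 2 * kerQ antisymk s t - kerG d antisymk s t)"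
    unfolding psdk_def hform_diff hform_scale Q hform_kerG[OF symk_antisymk] using A(3) by simp
qed

lemma symk_pow2: "symk P \<Longrightarrow> symk (pow2 a b P n)"
proof (induction n)
  case (Suc n)
  show ?case unfolding symk_def kpw.simps complex_cnj_mult
      symkD[OF Suc.prems, symmetric] symkD[OF Suc.IH[OF Suc.prems], symmetric] by simp
qed (simp add: symk_def)

text \<open>
  Let p be the expectation of P in the product vector ab, where P is the n-th power of the
  projector, and let F swap A with a copy A' in the state a. By Cauchy-Schwarz, p^2 is at most the
  expectation of PFP in aba. On the range of P, a shifted multiple W of F dominates F in absolute
  value for n = 1, hence for all n; and the partial transpose of W is bounded by \<open>\<alpha>\<close>.
\<close>

lemma antisym_power_product_overlap:
  fixes a b :: "nat \<Rightarrow> complex"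
  assumes d: "d \<ge> 7"
  shows "Re (hform (sq2 (d ^ n)) (pow2 d d antisymk n) (\<lambda>p. a (fst p) * b (snd p))) \<le>
    ((real d - 1) / (real d + 2)) ^ n * ((\<Sum>x<d ^ n. (cmod (a x))\<^sup>2) * (\<Sum>x<d ^ n. (cmod (b x))\<^sup>2))"
proof -
  define N where "N = d ^ n"
  define P where "P = pow2 d d antisymk n"
  \<comment> \<open>Single-copy constraints: \<open>W1\<close> asks for \<alpha> \<ge> 1 - \<beta>,
    taken with equality; \<open>W2\<close> then asks for \<beta> \<le> 1/3, which for this choice is
    d \<ge> 7; \<open>G1\<close> asks for \<beta> \<le> 4/(d + 4). Beating the DNE rate needs
    \<alpha> < (d - 1)/(d + 1), that is \<beta> > 2/(d + 1). The value 3/(d + 2) lies in between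
    with room to spare.\<close>
  define \<beta> where "\<beta> = 3 / (real d + 2)"
  define \<alpha> where "\<alpha> = (real d - 1) / (real d + 2)"
  have \<alpha>\<beta>: "\<alpha> = 1 - \<beta>" unfolding \<alpha>_def \<beta>_def by (simp add: field_simps)
  have pos: "0 \<le> \<alpha>" "0 \<le> \<beta>" unfolding \<alpha>_def \<beta>_def using d by simp_all
  define W where "W s t = complex_of_real \<alpha> * kerQ antisymk s t - complex_of_real \<beta> * kerX d antisymk s t" for s t
  let ?I = "sq2 d \<times> {..<d}" and ?J = "sq2 N \<times> {..<N}"
  have W1: "psdk ?I (\<lambda>s t. W s t + kerX d antisymk s t)"
  proof -
    have "W s t + kerX d antisymk s t = complex_of_real \<alpha> * (kerQ antisymk s t + kerX d antisymk s t)" for s t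
      unfolding W_def \<alpha>\<beta> by (simp add: algebra_simps)
    then show ?thesis using psdk_scale[OF pos(1) antisymk_kernels(2)] by simp
  qed
  have W2: "psdk ?I (\<lambda>s t. W s t - kerX d antisymk s t)"
  proof -
    have c: "0 \<le> (1 + \<beta>) / 2" "0 \<le> (1 - 3 * \<beta>) / 2" using pos d unfolding \<beta>_def by (simp_all add: field_simps)
    have "W s t - kerX d antisymk s t = complex_of_real ((1 + \<beta>) / 2) * (kerQ antisymk s t - 2 * kerX d antisymk s t)
        + complex_of_real ((1 - 3 * \<beta>) / 2) * kerQ antisymk s t" for s t
      unfolding W_def \<alpha>\<beta> by (simp add: field_simps)
    then show ?thesis
      using psdk_add[OF psdk_scale[OF c(1) antisymk_kernels(3)] psdk_scale[OF c(2) antisymk_kernels(1)]] by simp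
  qed
  have WX: "psdk ?J (\<lambda>s t. pow3 d W n s t - pow3 d (kerX d antisymk) n s t)"
    using kpw_dominated[OF splitting3 W1 W2, of n] d by (simp add: N_def)
  \<comment> \<open>\<open>kerQ\<close> is diagonal in the A' index and so is fixed by the partial
    transposition, while \<open>kerX\<close> becomes \<open>kerG\<close>.\<close>
  have tW: "transpose_snd W s t = complex_of_real \<alpha> * kerQ antisymk s t - complex_of_real \<beta> * kerG d antisymk s t" for s t
    by (cases "snd s = snd t") (simp_all add: transpose_snd_def W_def kerQ_def kerX_def kerG_def)
  have G1: "psdk ?I (\<lambda>s t. complex_of_real \<alpha> * kerQ antisymk s t + transpose_snd W s t)"
  proof -
    have "\<beta> * real d = 3 - 2 * \<beta>" "\<beta> \<le> 1 / 3" using d by (simp_all add: \<beta>_def field_simps)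
    then have c: "0 \<le> 2 * \<alpha> - \<beta> * real d / 2" unfolding \<alpha>\<beta> by simp
    have "complex_of_real \<alpha> * kerQ antisymk s t + transpose_snd W s t =
        complex_of_real \<beta> * (of_nat d / 2 * kerQ antisymk s t - kerG d antisymk s t) +
        complex_of_real (2 * \<alpha> - \<beta> * real d / 2) * kerQ antisymk s t" for s t
      unfolding tW by (simp add: field_simps)
    then show ?thesis
      using psdk_add[OF psdk_scale[OF pos(2) antisymk_kernels(5)] psdk_scale[OF c antisymk_kernels(1)]] by simp
  qed
  have G2: "psdk ?I (\<lambda>s t. complex_of_real \<alpha> * kerQ antisymk s t - transpose_snd W s t)"
    using psdk_scale[OF pos(2) antisymk_kernels(4)] unfolding tW by simp
  have GQ: "psdk ?J (\<lambda>s t. complex_of_real \<alpha> ^ n * pow3 d (kerQ antisymk) n s t - transpose_snd (pow3 d W n) s t)"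
    using kpw_dominated[OF splitting3 G1 G2, of n] d by (simp add: N_def kpw_scale kpw_transpose_snd)
  \<comment> \<open>The third system carries a second copy of \<open>a\<close>. In \<open>f'\<close>
    this factor is conjugated, to match the partial transposition on A'.\<close>
  define f where "f s = a (fst (fst s)) * b (snd (fst s)) * a (snd s)" for s :: "(nat \<times> nat) \<times> nat"
  define f' where "f' s = a (fst (fst s)) * b (snd (fst s)) * cnj (a (snd s))" for s :: "(nat \<times> nat) \<times> nat"
  define p where "p = hform (sq2 N) P (\<lambda>p. a (fst p) * b (snd p))"
  define \<psi> where "\<psi> x y = (\<Sum>q\<in>sq2 N. P (x, y) q * (a (fst q) * b (snd q)))" for x y
  define A where "A = (\<Sum>x<N. (cmod (a x))\<^sup>2)"
  define B where "B = (\<Sum>x<N. (cmod (b x))\<^sup>2)"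
  have AB: "A \<ge> 0" "B \<ge> 0" unfolding A_def B_def by (auto intro: sum_nonneg)
  have sym: "symk P" unfolding P_def by (rule symk_pow2[OF symk_antisymk])
  \<comment> \<open>The vector left on B when the projected vector \<psi> is contracted with
    \<open>a\<close> on A. Its inner product with \<open>b\<close> is p, and its squared norm is the
    expectation of P F P in aba; Cauchy-Schwarz for \<open>b\<close> and \<open>c\<close> links the
    two.\<close>
  define c where "c y = (\<Sum>x<N. \<psi> x y * cnj (a x))" for y
  have act: "act N P f x y z = \<psi> x y * a z" for x y z
    unfolding act_def \<psi>_def f_def by (simp add: sum_distrib_right mult.assoc)
  have HX: "hform ?J (pow3 d (kerX d antisymk) n) f = complex_of_real (\<Sum>y<N. (cmod (c y))\<^sup>2)"
  proof -
    have "hform ?J (pow3 d (kerX d antisymk) n) f = hform ?J (kerX N P) f"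
      using d by (intro hform_cong) (simp_all add: pow3_kerX N_def P_def)
    also have "\<dots> = (\<Sum>x<N. \<Sum>y<N. \<Sum>z<N. cnj (\<psi> x y * cnj (a x)) * (\<psi> z y * cnj (a z)))"
      unfolding hform_kerX[OF sym] act by (simp add: mult_ac)
    also have "\<dots> = (\<Sum>y<N. \<Sum>x<N. \<Sum>z<N. cnj (\<psi> x y * cnj (a x)) * (\<psi> z y * cnj (a z)))" by (rule sum.swap)
    also have "\<dots> = (\<Sum>y<N. cnj (c y) * c y)" unfolding c_def cnj_sum sum_product ..
    also have "\<dots> = complex_of_real (\<Sum>y<N. (cmod (c y))\<^sup>2)"
      by (simp only: of_real_sum complex_norm_square mult.commute)
    finally show ?thesis .
  qed
  have pc: "p = (\<Sum>y<N. cnj (b y) * c y)"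
  proof -
    have "p = (\<Sum>x<N. \<Sum>y<N. cnj (a x) * cnj (b y) * \<psi> x y)"
      by (simp add: p_def hform_def \<psi>_def sum.cartesian_product' sum_distrib_left mult.assoc)
    also have "\<dots> = (\<Sum>y<N. \<Sum>x<N. cnj (a x) * cnj (b y) * \<psi> x y)" by (rule sum.swap)
    also have "\<dots> = (\<Sum>y<N. cnj (b y) * c y)"
      unfolding c_def sum_distrib_left by (intro sum.cong refl) (simp only: mult_ac)
    finally show ?thesis .
  qed
  have "(cmod p)\<^sup>2 \<le> (\<Sum>y<N. cmod (b y) * cmod (c y))\<^sup>2"
  proof (intro power_mono)
    show "cmod p \<le> (\<Sum>y<N. cmod (b y) * cmod (c y))"
      unfolding pc by (rule order_trans[OF norm_sum]) (simp add: norm_mult)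
  qed simp
  also have "\<dots> \<le> B * (\<Sum>y<N. (cmod (c y))\<^sup>2)" unfolding B_def by (rule Cauchy_Schwarz_ineq_sum)
  finally have 1: "(cmod p)\<^sup>2 \<le> B * Re (hform ?J (pow3 d (kerX d antisymk) n) f)" unfolding HX by simp
  have "0 \<le> hform ?J (pow3 d W n) f - hform ?J (pow3 d (kerX d antisymk) n) f"
    using WX unfolding psdk_def hform_diff by blast
  then have 2: "Re (hform ?J (pow3 d (kerX d antisymk) n) f) \<le> Re (hform ?J (pow3 d W n) f)"
    by (simp add: less_eq_complex_def)
  have 3: "hform ?J (pow3 d W n) f = hform ?J (transpose_snd (pow3 d W n)) f'"
    unfolding f_def f'_def
    using hform_transpose_snd[of "sq2 N" "{..<N}" "pow3 d W n" "\<lambda>p. a (fst p) * b (snd p)" a] by simp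
  have "0 \<le> complex_of_real \<alpha> ^ n * hform ?J (pow3 d (kerQ antisymk) n) f' - hform ?J (transpose_snd (pow3 d W n)) f'"
    using GQ unfolding psdk_def hform_diff hform_scale by blast
  \<comment> \<open>Since P acts trivially on A', the upper bound for p^2 contains p itself, and one
    factor p cancels at the end.\<close>
  moreover have "hform ?J (pow3 d (kerQ antisymk) n) f' = p * complex_of_real A"
  proof -
    have "hform ?J (pow3 d (kerQ antisymk) n) f' = hform ?J (kerQ P) f'"
      by (intro hform_cong) (auto simp: pow3_kerQ N_def P_def)
    also have "\<dots> = (\<Sum>k<N. hform (sq2 N) P (\<lambda>p. f' (p, k)))" by (rule hform_kerQ)
    also have "\<dots> = (\<Sum>k<N. p * complex_of_real ((cmod (a k))\<^sup>2))"
    proof (intro sum.cong refl)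
      fix k
      have "hform (sq2 N) P (\<lambda>p. f' (p, k)) = p * (a k * cnj (a k))"
        unfolding p_def hform_def f'_def sum_distrib_right by (intro sum.cong refl) (simp add: mult_ac)
      then show "hform (sq2 N) P (\<lambda>p. f' (p, k)) = p * complex_of_real ((cmod (a k))\<^sup>2)"
        by (simp only: complex_norm_square)
    qed
    also have "\<dots> = p * complex_of_real A" unfolding A_def of_real_sum sum_distrib_left ..
    finally show ?thesis .
  qed
  ultimately have 4: "Re (hform ?J (pow3 d W n) f) \<le> \<alpha> ^ n * (Re p * A)"
    unfolding 3 by (simp add: less_eq_complex_def flip: of_real_power)
  have "(Re p)\<^sup>2 \<le> (cmod p)\<^sup>2" by (simp add: cmod_power2)
  also have "\<dots> \<le> B * (\<alpha> ^ n * (Re p * A))"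
    using 1 mult_left_mono[OF order_trans[OF 2 4] AB(2)] by linarith
  finally have fin: "Re p * Re p \<le> Re p * (\<alpha> ^ n * (A * B))" by (simp add: power2_eq_square mult_ac)
  have "Re p \<le> \<alpha> ^ n * (A * B)"
  proof (cases "Re p > 0")
    case True
    then show ?thesis using fin by simp
  next
    case False
    then show ?thesis using pos AB by (meson mult_nonneg_nonneg not_less order_trans zero_le_power)
  qed
  then show ?thesis by (simp add: p_def P_def N_def A_def B_def \<alpha>_def)
qed

section \<open>The cone of separable operators\<close>

definition pv :: "nat \<Rightarrow> (nat \<Rightarrow> complex) \<Rightarrow> (nat \<Rightarrow> complex) \<Rightarrow> nat \<Rightarrow> complex" where
  "pv b u v r = u (r div b) * v (r mod b)"

definition nrm2 :: "nat \<Rightarrow> (nat \<Rightarrow> complex) \<Rightarrow> real" where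
  "nrm2 n f = (\<Sum>i<n. (cmod (f i))\<^sup>2)"

text \<open>The cone spanned by pure product states, with weights absorbed in the vectors. No trace
  is prescribed, so pulled-back operators and summands of a state belong to it as well.\<close>

definition sepc :: "nat \<Rightarrow> nat \<Rightarrow> op \<Rightarrow> bool" where
  "sepc a b X \<longleftrightarrow> X \<in> carrier_mat (a * b) (a * b) \<and>
     (\<exists>(K::nat) u v. \<forall>r<a * b. \<forall>c<a * b. X $$ (r, c) = (\<Sum>k<K. pv b (u k) (v k) r * cnj (pv b (u k) (v k) c)))"

lemma nrm2_nonneg: "nrm2 n f \<ge> 0"
  by (simp add: nrm2_def sum_nonneg)

lemma of_real_nrm2: "complex_of_real (nrm2 n f) = (\<Sum>i<n. f i * cnj (f i))"
  unfolding nrm2_def of_real_sum by (simp only: complex_norm_square)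

lemma nrm2_pv:
  assumes "b > 0"
  shows "nrm2 (a * b) (pv b u v) = nrm2 a u * nrm2 b v"
  unfolding nrm2_def pv_def sum_div_mod[OF assms, of "\<lambda>i j. (cmod (u i * v j))\<^sup>2"]
  by (simp add: sum_product norm_mult power_mult_distrib)

text \<open>Convenient introduction form: any finite index set, and nonnegative weights whose square
  roots are absorbed in the A-factor.\<close>

lemma sepcI:
  fixes J :: "'i set"
  assumes J: "finite J" and X: "X \<in> carrier_mat (a * b) (a * b)" and w: "\<And>j. j \<in> J \<Longrightarrow> 0 \<le> w j"
    and entry: "\<And>r c. r < a * b \<Longrightarrow> c < a * b \<Longrightarrow>
      X $$ (r, c) = (\<Sum>j\<in>J. complex_of_real (w j) * (pv b (u j) (v j) r * cnj (pv b (u j) (v j) c)))"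
  shows "sepc a b X"
proof -
  obtain h where h: "bij_betw h {..<card J} J"
    using ex_bij_betw_nat_finite[OF J] by (auto simp: atLeast0LessThan)
  have hJ: "h k \<in> J" if "k < card J" for k using h that by (auto simp: bij_betw_def)
  define u' where "u' k x = complex_of_real (sqrt (w (h k))) * u (h k) x" for k x
  have "X $$ (r, c) = (\<Sum>k<card J. pv b (u' k) (v (h k)) r * cnj (pv b (u' k) (v (h k)) c))"
    if "r < a * b" "c < a * b" for r c
  proof -
    have "X $$ (r, c) = (\<Sum>k<card J. complex_of_real (w (h k)) * (pv b (u (h k)) (v (h k)) r * cnj (pv b (u (h k)) (v (h k)) c)))"
      unfolding entry[OF that] by (rule sum.reindex_bij_betw[OF h, symmetric])
    also have "\<dots> = (\<Sum>k<card J. pv b (u' k) (v (h k)) r * cnj (pv b (u' k) (v (h k)) c))"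
    proof (intro sum.cong refl)
      fix k assume "k \<in> {..<card J}"
      then have sq: "complex_of_real (sqrt (w (h k))) * complex_of_real (sqrt (w (h k))) = complex_of_real (w (h k))"
        using w[OF hJ] by (simp flip: of_real_mult)
      have "pv b (u' k) (v (h k)) x = complex_of_real (sqrt (w (h k))) * pv b (u (h k)) (v (h k)) x" for x
        by (simp add: pv_def u'_def)
      then have "pv b (u' k) (v (h k)) r * cnj (pv b (u' k) (v (h k)) c) =
          (complex_of_real (sqrt (w (h k))) * complex_of_real (sqrt (w (h k)))) *
          (pv b (u (h k)) (v (h k)) r * cnj (pv b (u (h k)) (v (h k)) c))" by simp
      then show "complex_of_real (w (h k)) * (pv b (u (h k)) (v (h k)) r * cnj (pv b (u (h k)) (v (h k)) c)) =
          pv b (u' k) (v (h k)) r * cnj (pv b (u' k) (v (h k)) c)" unfolding sq by (rule sym)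
    qed
    finally show ?thesis .
  qed
  then show ?thesis unfolding sepc_def
    by (intro conjI X exI[of _ "card J"] exI[of _ u'] exI[of _ "\<lambda>k. v (h k)"] allI impI)
qed

lemma sepc_add:
  assumes "sepc a b X" "sepc a b Y" "0 \<le> p" "0 \<le> q" "Z \<in> carrier_mat (a * b) (a * b)"
    and Z: "\<And>r c. r < a * b \<Longrightarrow> c < a * b \<Longrightarrow> Z $$ (r, c) = complex_of_real p * X $$ (r, c) + complex_of_real q * Y $$ (r, c)"
  shows "sepc a b Z"
proof -
  obtain K :: nat and u v where X: "\<And>r c. r < a * b \<Longrightarrow> c < a * b \<Longrightarrow> X $$ (r, c) = (\<Sum>k<K. pv b (u k) (v k) r * cnj (pv b (u k) (v k) c))"
    using assms(1) unfolding sepc_def by blast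
  obtain L :: nat and u' v' where Y: "\<And>r c. r < a * b \<Longrightarrow> c < a * b \<Longrightarrow> Y $$ (r, c) = (\<Sum>k<L. pv b (u' k) (v' k) r * cnj (pv b (u' k) (v' k) c))"
    using assms(2) unfolding sepc_def by blast
  show ?thesis
  proof (rule sepcI[of "{..<K} <+> {..<L}" _ _ _ "case_sum (\<lambda>_. p) (\<lambda>_. q)" "case_sum u u'" "case_sum v v'"])
    fix r c assume "r < a * b" "c < a * b"
    then show "Z $$ (r, c) = (\<Sum>j\<in>{..<K} <+> {..<L}. complex_of_real (case_sum (\<lambda>_. p) (\<lambda>_. q) j) *
        (pv b (case_sum u u' j) (case_sum v v' j) r * cnj (pv b (case_sum u u' j) (case_sum v v' j) c)))"
      by (simp add: Z X Y sum.Plus sum_distrib_left)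
  qed (use assms in auto)
qed

lemma sepc_scale:
  assumes "sepc a b X" "0 \<le> p"
  shows "sepc a b (complex_of_real p \<cdot>\<^sub>m X)"
proof -
  have "X \<in> carrier_mat (a * b) (a * b)" using assms(1) unfolding sepc_def by blast
  then show ?thesis by (intro sepc_add[OF assms(1,1,2) order_refl]) auto
qed

lemma mtrace_mult:
  assumes "A \<in> carrier_mat n m" "B \<in> carrier_mat m n"
  shows "mtrace (A * B) = (\<Sum>i<n. \<Sum>j<m. A $$ (i, j) * B $$ (j, i))"
  using assms by (simp add: mtrace_def scalar_prod_def atLeast0LessThan)

lemma gram_expectation:
  assumes T: "T \<in> carrier_mat n n" and X: "X \<in> carrier_mat n n"
    and entry: "\<And>r c. r < n \<Longrightarrow> c < n \<Longrightarrow> X $$ (r, c) = (\<Sum>k\<in>J. w k r * cnj (w k c))"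
  shows "mtrace (T * X) = (\<Sum>k\<in>J. hform {..<n} (\<lambda>r c. T $$ (r, c)) (w k))"
    and "mtrace X = (\<Sum>k\<in>J. complex_of_real (nrm2 n (w k)))"
proof -
  have "mtrace (T * X) = (\<Sum>r<n. \<Sum>c<n. \<Sum>k\<in>J. cnj (w k r) * T $$ (r, c) * w k c)"
    unfolding mtrace_mult[OF T X] by (intro sum.cong refl) (simp add: entry sum_distrib_left mult_ac)
  also have "\<dots> = (\<Sum>r<n. \<Sum>k\<in>J. \<Sum>c<n. cnj (w k r) * T $$ (r, c) * w k c)"
    by (intro sum.cong refl sum.swap)
  also have "\<dots> = (\<Sum>k\<in>J. \<Sum>r<n. \<Sum>c<n. cnj (w k r) * T $$ (r, c) * w k c)" by (rule sum.swap)
  finally show "mtrace (T * X) = (\<Sum>k\<in>J. hform {..<n} (\<lambda>r c. T $$ (r, c)) (w k))" by (simp add: hform_def)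
  have "mtrace X = (\<Sum>r<n. \<Sum>k\<in>J. w k r * cnj (w k r))" using X by (simp add: mtrace_def entry)
  also have "\<dots> = (\<Sum>k\<in>J. \<Sum>r<n. w k r * cnj (w k r))" by (rule sum.swap)
  finally show "mtrace X = (\<Sum>k\<in>J. complex_of_real (nrm2 n (w k)))" by (simp add: of_real_nrm2)
qed

lemma sepc_expectation_le:
  assumes X: "sepc a b X" and T: "T \<in> carrier_mat (a * b) (a * b)" and b: "b > 0"
    and le: "\<And>u v. Re (hform {..<a * b} (\<lambda>r c. T $$ (r, c)) (pv b u v)) \<le> h * (nrm2 a u * nrm2 b v)"
  shows "Re (mtrace (T * X)) \<le> h * Re (mtrace X)"
proof -
  obtain K :: nat and u v where X: "X \<in> carrier_mat (a * b) (a * b)"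
      "\<And>r c. r < a * b \<Longrightarrow> c < a * b \<Longrightarrow> X $$ (r, c) = (\<Sum>k<K. pv b (u k) (v k) r * cnj (pv b (u k) (v k) c))"
    using X unfolding sepc_def by blast
  have "mtrace (T * X) = (\<Sum>k<K. hform {..<a * b} (\<lambda>r c. T $$ (r, c)) (pv b (u k) (v k)))"
    by (rule gram_expectation(1)[OF T X])
  moreover have "mtrace X = (\<Sum>k<K. complex_of_real (nrm2 (a * b) (pv b (u k) (v k))))"
    by (rule gram_expectation(2)[OF X(1) X])
  ultimately show ?thesis using le
    by (simp add: sum_distrib_left nrm2_pv[OF b] sum_mono)
qed

lemma sepc_psd:
  assumes "sepc a b X"
  shows "psd (a * b) X"
proof -
  obtain K :: nat and u v where X: "X \<in> carrier_mat (a * b) (a * b)"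
      "\<And>r c. r < a * b \<Longrightarrow> c < a * b \<Longrightarrow> X $$ (r, c) = (\<Sum>k<K. pv b (u k) (v k) r * cnj (pv b (u k) (v k) c))"
    using assms unfolding sepc_def by blast
  have "psdk {..<a * b} (\<lambda>r c. \<Sum>k<K. pv b (u k) (v k) r * cnj (pv b (u k) (v k) c))"
    by (intro psdk_sum psdk_rank_one)
  then have "psdk {..<a * b} (\<lambda>r c. X $$ (r, c))"
    by (rule psdk_cong[THEN iffD1, rotated]) (simp add: X(2))
  then show ?thesis using X(1) by (simp add: psd_iff_psdk)
qed

lemma mtrace_kron:
  assumes "A \<in> carrier_mat a a" "B \<in> carrier_mat b b" "b > 0"
  shows "(\<Sum>r<a * b. kron A B $$ (r, r)) = mtrace A * mtrace B"
proof -
  have "(\<Sum>r<a * b. kron A B $$ (r, r)) = (\<Sum>r<a * b. A $$ (r div b, r div b) * B $$ (r mod b, r mod b))"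
    using assms by (intro sum.cong refl) (simp add: kron_def)
  also have "\<dots> = (\<Sum>i<a. \<Sum>j<b. A $$ (i, i) * B $$ (j, j))" by (rule sum_div_mod[OF assms(3)])
  finally show ?thesis using assms by (simp add: mtrace_def sum_product)
qed

lemma psd_gram:
  assumes "psd n M"
  shows "\<exists>(k::nat) g. \<forall>i<n. \<forall>j<n. M $$ (i, j) = (\<Sum>r<k. g r i * cnj (g r j))"
  using assms psdk_gram_nat[of n "\<lambda>i j. M $$ (i, j)"] by (simp add: psd_iff_psdk)

text \<open>Gram decompositions of both factors split each product state into pure product terms;
  \<open>J\<close> collects the triples of a mixture index and two Gram indices.\<close>

lemma separable_imp_sepc:
  assumes S: "X \<in> separable a b" and ab: "a > 0" "b > 0"
  shows "sepc a b X" "mtrace X = 1"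
proof -
  obtain K :: nat and p \<rho> \<tau> where X: "X = mat (a * b) (a * b) (\<lambda>ij. \<Sum>k<K. complex_of_real (p k) * kron (\<rho> k) (\<tau> k) $$ ij)"
    and st: "\<And>k. k < K \<Longrightarrow> 0 \<le> p k \<and> \<rho> k \<in> density a \<and> \<tau> k \<in> density b" and p1: "(\<Sum>k<K. p k) = 1"
    using S unfolding separable_def by blast
  have car: "\<rho> k \<in> carrier_mat a a" "\<tau> k \<in> carrier_mat b b" if "k < K" for k
    using st[OF that] by (auto simp: density_def psd_def)
  have "\<forall>k. \<exists>(R::nat) g. k < K \<longrightarrow> (\<forall>i<a. \<forall>j<a. \<rho> k $$ (i, j) = (\<Sum>r<R. g r i * cnj (g r j)))"
    using st psd_gram unfolding density_def by blast
  then obtain R :: "nat \<Rightarrow> nat" and g where g: "\<And>k i j. k < K \<Longrightarrow> i < a \<Longrightarrow> j < a \<Longrightarrow> \<rho> k $$ (i, j) = (\<Sum>r<R k. g k r i * cnj (g k r j))"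
    by metis
  have "\<forall>k. \<exists>(R::nat) g. k < K \<longrightarrow> (\<forall>i<b. \<forall>j<b. \<tau> k $$ (i, j) = (\<Sum>r<R. g r i * cnj (g r j)))"
    using st psd_gram unfolding density_def by blast
  then obtain S :: "nat \<Rightarrow> nat" and h where h: "\<And>k i j. k < K \<Longrightarrow> i < b \<Longrightarrow> j < b \<Longrightarrow> \<tau> k $$ (i, j) = (\<Sum>r<S k. h k r i * cnj (h k r j))"
    by metis
  define J where "J = Sigma {..<K} (\<lambda>k. {..<R k} \<times> {..<S k})"
  show "sepc a b X"
  proof (rule sepcI[of J _ _ _ "\<lambda>j. p (fst j)" "\<lambda>j. g (fst j) (fst (snd j))" "\<lambda>j. h (fst j) (snd (snd j))"])
    fix r c assume rc: "r < a * b" "c < a * b"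
    then have dm: "r div b < a" "r mod b < b" "c div b < a" "c mod b < b"
      using ab by (simp_all add: less_mult_imp_div_less)
    have "X $$ (r, c) = (\<Sum>k<K. complex_of_real (p k) * (\<rho> k $$ (r div b, c div b) * \<tau> k $$ (r mod b, c mod b)))"
    proof -
      have "X $$ (r, c) = (\<Sum>k<K. complex_of_real (p k) * kron (\<rho> k) (\<tau> k) $$ (r, c))" using rc by (simp add: X)
      also have "\<dots> = (\<Sum>k<K. complex_of_real (p k) * (\<rho> k $$ (r div b, c div b) * \<tau> k $$ (r mod b, c mod b)))"
      proof (intro sum.cong refl)
        fix k assume "k \<in> {..<K}"
        then have "\<rho> k \<in> carrier_mat a a" "\<tau> k \<in> carrier_mat b b" using car by auto
        then show "complex_of_real (p k) * kron (\<rho> k) (\<tau> k) $$ (r, c) =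
            complex_of_real (p k) * (\<rho> k $$ (r div b, c div b) * \<tau> k $$ (r mod b, c mod b))"
          using rc by (simp add: kron_def)
      qed
      finally show ?thesis .
    qed
    also have "\<dots> = (\<Sum>k<K. \<Sum>q\<in>{..<R k} \<times> {..<S k}. complex_of_real (p k) *
        (pv b (g k (fst q)) (h k (snd q)) r * cnj (pv b (g k (fst q)) (h k (snd q)) c)))"
    proof (intro sum.cong refl)
      fix k assume "k \<in> {..<K}"
      then have k: "k < K" by simp
      show "complex_of_real (p k) * (\<rho> k $$ (r div b, c div b) * \<tau> k $$ (r mod b, c mod b)) =
          (\<Sum>q\<in>{..<R k} \<times> {..<S k}. complex_of_real (p k) *
            (pv b (g k (fst q)) (h k (snd q)) r * cnj (pv b (g k (fst q)) (h k (snd q)) c)))"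
        unfolding g[OF k dm(1,3)] h[OF k dm(2,4)] sum_product
        unfolding sum.cartesian_product' sum_distrib_left
        by (intro sum.cong refl) (simp add: pv_def mult_ac)
    qed
    also have "\<dots> = (\<Sum>j\<in>J. complex_of_real (p (fst j)) *
        (pv b (g (fst j) (fst (snd j))) (h (fst j) (snd (snd j))) r * cnj (pv b (g (fst j) (fst (snd j))) (h (fst j) (snd (snd j))) c)))"
      unfolding J_def by (subst sum.Sigma) (auto intro!: sum.cong)
    finally show "X $$ (r, c) = (\<Sum>j\<in>J. complex_of_real (p (fst j)) *
        (pv b (g (fst j) (fst (snd j))) (h (fst j) (snd (snd j))) r * cnj (pv b (g (fst j) (fst (snd j))) (h (fst j) (snd (snd j))) c)))" .
  qed (use st in \<open>auto simp: J_def X\<close>)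
  have "mtrace X = (\<Sum>r<a * b. \<Sum>k<K. complex_of_real (p k) * kron (\<rho> k) (\<tau> k) $$ (r, r))"
    by (simp add: mtrace_def X)
  also have "\<dots> = (\<Sum>k<K. complex_of_real (p k) * (\<Sum>r<a * b. kron (\<rho> k) (\<tau> k) $$ (r, r)))"
    by (subst sum.swap) (simp add: sum_distrib_left)
  also have "\<dots> = (\<Sum>k<K. complex_of_real (p k))"
    using car st ab by (intro sum.cong refl) (simp add: mtrace_kron density_def)
  finally show "mtrace X = 1" using p1 by (simp flip: of_real_sum)
qed

lemma ket_bra_density:
  assumes "nrm2 n f = 1"
  shows "ket_bra (vec n f) \<in> density n"
proof -
  have "psdk {..<n} (\<lambda>i j. ket_bra (vec n f) $$ (i, j))"
    by (rule psdk_cong[THEN iffD1, OF _ psdk_rank_one[of _ f]]) (simp add: ket_bra_def)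
  moreover have "mtrace (ket_bra (vec n f)) = complex_of_real (nrm2 n f)"
    by (simp add: mtrace_def ket_bra_def of_real_nrm2)
  ultimately show ?thesis using assms by (simp add: density_def psd_iff_psdk ket_bra_def)
qed

text \<open>A zero vector is written as 0 times the first basis vector, which is where n > 0 enters.
  Every product vector thus yields a product state and a weight, possibly 0.\<close>

lemma normalized_vector:
  assumes "n > 0"
  shows "\<exists>g. nrm2 n g = 1 \<and> (\<forall>i<n. f i = complex_of_real (sqrt (nrm2 n f)) * g i)"
proof (cases "nrm2 n f = 0")
  case True
  have "f i = 0" if "i < n" for i
    using True that unfolding nrm2_def by (subst (asm) sum_nonneg_eq_0_iff) auto
  moreover have "nrm2 n (\<lambda>i. if i = 0 then 1 else 0) = (\<Sum>i<n. if i = 0 then 1 else 0)"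
    unfolding nrm2_def by (intro sum.cong) auto
  ultimately show ?thesis using True assms by (intro exI[of _ "\<lambda>i. if i = 0 then 1 else 0"]) auto
next
  case False
  then have pos: "nrm2 n f > 0" using nrm2_nonneg[of n f] by linarith
  define s where "s = sqrt (nrm2 n f)"
  have s: "s > 0" "s\<^sup>2 = nrm2 n f" using pos by (auto simp: s_def)
  have "nrm2 n (\<lambda>i. f i / complex_of_real s) = nrm2 n f / s\<^sup>2"
    by (simp add: nrm2_def norm_divide power_divide sum_divide_distrib)
  then show ?thesis using s by (intro exI[of _ "\<lambda>i. f i / complex_of_real s"]) (auto simp: s_def[symmetric])
qed

text \<open>The weight of a term is the squared norm of its product vector, so trace 1 says that the
  weights sum to 1.\<close>

lemma sepc_imp_separable:
  assumes "sepc a b X" "mtrace X = 1" and ab: "a > 0" "b > 0"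
  shows "X \<in> separable a b"
proof -
  obtain K :: nat and u v where X: "X \<in> carrier_mat (a * b) (a * b)"
      "\<And>r c. r < a * b \<Longrightarrow> c < a * b \<Longrightarrow> X $$ (r, c) = (\<Sum>k<K. pv b (u k) (v k) r * cnj (pv b (u k) (v k) c))"
    using assms(1) unfolding sepc_def by blast
  obtain g where g: "\<And>k. nrm2 a (g k) = 1" "\<And>k i. i < a \<Longrightarrow> u k i = complex_of_real (sqrt (nrm2 a (u k))) * g k i"
    using choice[of "\<lambda>k g. nrm2 a g = 1 \<and> (\<forall>i<a. u k i = complex_of_real (sqrt (nrm2 a (u k))) * g i)"]
      normalized_vector[OF ab(1)] by blast
  obtain h where h: "\<And>k. nrm2 b (h k) = 1" "\<And>k i. i < b \<Longrightarrow> v k i = complex_of_real (sqrt (nrm2 b (v k))) * h k i"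
    using choice[of "\<lambda>k g. nrm2 b g = 1 \<and> (\<forall>i<b. v k i = complex_of_real (sqrt (nrm2 b (v k))) * g i)"]
      normalized_vector[OF ab(2)] by blast
  define p where "p k = nrm2 a (u k) * nrm2 b (v k)" for k
  have sq: "complex_of_real (sqrt (nrm2 n f)) * complex_of_real (sqrt (nrm2 n f)) = complex_of_real (nrm2 n f)" for n f
    by (simp add: nrm2_nonneg flip: of_real_mult)
  have entry: "pv b (u k) (v k) r * cnj (pv b (u k) (v k) c) =
      complex_of_real (p k) * kron (ket_bra (vec a (g k))) (ket_bra (vec b (h k))) $$ (r, c)"
    if rc: "r < a * b" "c < a * b" for k r c
  proof -
    have dm: "r div b < a" "r mod b < b" "c div b < a" "c mod b < b"
      using ab rc by (simp_all add: less_mult_imp_div_less)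
    have "pv b (u k) (v k) r * cnj (pv b (u k) (v k) c) =
       (complex_of_real (sqrt (nrm2 a (u k))) * complex_of_real (sqrt (nrm2 a (u k)))) *
       (complex_of_real (sqrt (nrm2 b (v k))) * complex_of_real (sqrt (nrm2 b (v k)))) *
       (g k (r div b) * cnj (g k (c div b)) * (h k (r mod b) * cnj (h k (c mod b))))"
      unfolding pv_def by (subst g(2)[OF dm(1)], subst g(2)[OF dm(3)], subst h(2)[OF dm(2)], subst h(2)[OF dm(4)])
        (simp only: complex_cnj_mult complex_cnj_complex_of_real mult_ac)
    then show ?thesis unfolding sq p_def using rc dm by (simp add: kron_def ket_bra_def)
  qed
  have "X = mat (a * b) (a * b) (\<lambda>ij. \<Sum>k<K. complex_of_real (p k) * kron (ket_bra (vec a (g k))) (ket_bra (vec b (h k))) $$ ij)"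
    using X by (intro eq_matI) (auto simp: entry)
  moreover have "(\<Sum>k<K. p k) = 1"
  proof -
    have "mtrace X = (\<Sum>k<K. complex_of_real (nrm2 (a * b) (pv b (u k) (v k))))"
      by (rule gram_expectation(2)[where w = "\<lambda>k. pv b (u k) (v k)" and J = "{..<K}", OF X(1) X])
    then have "complex_of_real (\<Sum>k<K. p k) = 1" using assms(2) by (simp add: nrm2_pv[OF ab(2)] p_def)
    then show ?thesis using of_real_eq_1_iff by blast
  qed
  moreover have "0 \<le> p k \<and> ket_bra (vec a (g k)) \<in> density a \<and> ket_bra (vec b (h k)) \<in> density b" for k
    using g h by (simp add: p_def nrm2_nonneg ket_bra_density)
  ultimately show ?thesis unfolding separable_def mem_Collect_eq
    by (intro exI[of _ K] exI[of _ p] exI[of _ "\<lambda>k. ket_bra (vec a (g k))"] exI[of _ "\<lambda>k. ket_bra (vec b (h k))"] conjI allI impI) auto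
qed

section \<open>Tensor powers of bipartite operators\<close>

definition mk :: "nat \<Rightarrow> op \<Rightarrow> nat \<times> nat \<Rightarrow> nat \<times> nat \<Rightarrow> complex" where
  "mk b M p q = M $$ (fst p * b + snd p, fst q * b + snd q)"

lemma bip_power_carrier: "bip_power a b M n \<in> carrier_mat (a ^ n * b ^ n) (a ^ n * b ^ n)"
proof (cases n)
  case (Suc m)
  have "a * a ^ m * (b * b ^ m) = a * (b * (a ^ m * b ^ m))" by (simp only: mult_ac)
  then show ?thesis by (simp add: Suc bip_tensor_def)
qed auto

text \<open>Bridge from matrices to kernels: the interleaved indices of \<open>bip_tensor\<close>
  become the leading and trailing digits of the A- and B-parts of a flattened index.\<close>

lemma bip_power_entry:
  assumes ab: "a > 0" "b > 0"
  shows "r < a ^ n * b ^ n \<Longrightarrow> c < a ^ n * b ^ n \<Longrightarrow>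
    bip_power a b M n $$ (r, c) = pow2 a b (mk b M) n (r div b ^ n, r mod b ^ n) (c div b ^ n, c mod b ^ n)"
proof (induction n arbitrary: r c)
  case 0
  then show ?case by simp
next
  case (Suc n)
  have pos: "a ^ n > 0" "b ^ n > 0" using ab by simp_all
  have idx: "idx_snd b (a ^ n) (b ^ n) s < a ^ n * b ^ n" for s
  proof -
    have "s div (b * b ^ n) mod a ^ n * b ^ n + s mod (b * b ^ n) mod b ^ n < (s div (b * b ^ n) mod a ^ n + 1) * b ^ n"
      using pos by simp
    also have "\<dots> \<le> a ^ n * b ^ n" using pos by (intro mult_right_mono) (simp_all add: Suc_le_eq)
    finally show ?thesis by (simp add: idx_snd_def)
  qed
  have dm: "idx_snd b (a ^ n) (b ^ n) s div b ^ n = s div (b * b ^ n) mod a ^ n"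
    "idx_snd b (a ^ n) (b ^ n) s mod b ^ n = s mod (b * b ^ n) mod b ^ n" for s
    using pos by (simp_all add: idx_snd_def)
  have "bip_power a b M (Suc n) $$ (r, c) = M $$ (idx_fst b (a ^ n) (b ^ n) r, idx_fst b (a ^ n) (b ^ n) c) *
      bip_power a b M n $$ (idx_snd b (a ^ n) (b ^ n) r, idx_snd b (a ^ n) (b ^ n) c)"
    using Suc.prems by (simp add: bip_tensor_def)
  also have "\<dots> = pow2 a b (mk b M) (Suc n) (r div b ^ Suc n, r mod b ^ Suc n) (c div b ^ Suc n, c mod b ^ Suc n)"
    unfolding Suc.IH[OF idx idx] dm by (simp add: mk_def idx_fst_def)
  finally show ?case .
qed

lemma kpw_cong:
  assumes sp: "splitting hp tp I H" and KL: "\<And>s t. s \<in> H \<Longrightarrow> t \<in> H \<Longrightarrow> K s t = L s t"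
  shows "s \<in> I n \<Longrightarrow> t \<in> I n \<Longrightarrow> kpw hp tp K n s t = kpw hp tp L n s t"
proof (induction n arbitrary: s t)
  case (Suc n)
  have "(hp n s, tp n s) \<in> H \<times> I n" "(hp n t, tp n t) \<in> H \<times> I n"
    using sp Suc.prems unfolding splitting_def bij_betw_def by blast+
  then show ?case using KL Suc.IH by simp
qed simp

lemma kpw_compose:
  assumes sp: "splitting hp tp I H"
  shows "(\<Sum>u\<in>I n. kpw hp tp K n s u * kpw hp tp L n u t) = kpw hp tp (\<lambda>s t. \<Sum>u\<in>H. K s u * L u t) n s t"
proof (induction n arbitrary: s t)
  case 0
  then show ?case using sp by (auto simp: splitting_def)
next
  case (Suc n)
  have bij: "bij_betw (\<lambda>s. (hp n s, tp n s)) (I (Suc n)) (H \<times> I n)" using sp by (simp add: splitting_def)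
  have "(\<Sum>u\<in>I (Suc n). kpw hp tp K (Suc n) s u * kpw hp tp L (Suc n) u t) =
      (\<Sum>u\<in>H \<times> I n. (K (hp n s) (fst u) * L (fst u) (hp n t)) *
        (kpw hp tp K n (tp n s) (snd u) * kpw hp tp L n (snd u) (tp n t)))"
    unfolding sum.reindex_bij_betw[OF bij, symmetric] by (intro sum.cong refl) (simp add: mult_ac)
  then show ?case by (simp add: sum.cartesian_product' sum_product flip: Suc.IH)
qed

lemma kpw_trace:
  assumes sp: "splitting hp tp I H"
  shows "(\<Sum>s\<in>I n. kpw hp tp K n s s) = (\<Sum>h\<in>H. K h h) ^ n"
proof (induction n)
  case 0
  then show ?case using sp by (auto simp: splitting_def)
next
  case (Suc n)
  have bij: "bij_betw (\<lambda>s. (hp n s, tp n s)) (I (Suc n)) (H \<times> I n)" using sp by (simp add: splitting_def)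
  have "(\<Sum>u\<in>I (Suc n). kpw hp tp K (Suc n) u u) = (\<Sum>u\<in>H \<times> I n. K (fst u) (fst u) * kpw hp tp K n (snd u) (snd u))"
    unfolding sum.reindex_bij_betw[OF bij, symmetric] by simp
  then show ?case by (simp add: sum.cartesian_product' sum_product flip: Suc.IH)
qed

text \<open>A positive kernel dominates itself: K + K and K - K = 0 are positive, and the sum of the
  two powers is twice the power.\<close>

lemma kpw_psd:
  assumes sp: "splitting hp tp I H" and K: "psdk H K"
  shows "psdk (I n) (kpw hp tp K n)"
proof -
  have "psdk H (\<lambda>s t. K s t - K s t)" by (simp add: psdk_def hform_def)
  from kpw_dominated[OF sp psdk_add[OF K K] this]
  have "psdk (I n) (\<lambda>s t. kpw hp tp K n s t + kpw hp tp K n s t)" by blast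
  from psdk_scale[OF _ this, of "1/2"] show ?thesis by simp
qed

lemma hform_bipartite:
  assumes "b > 0"
  shows "hform {..<a * b} (\<lambda>r c. K (r div b, r mod b) (c div b, c mod b)) (pv b u v) =
    hform ({..<a} \<times> {..<b}) K (\<lambda>p. u (fst p) * v (snd p))"
  using hform_reindex[OF bij_betw_div_mod[OF assms, of a], of K "\<lambda>p. u (fst p) * v (snd p)"]
  by (simp add: pv_def[abs_def])

lemma mtrace_bip_power:
  assumes ab: "a > 0" "b > 0" and M: "M \<in> carrier_mat (a * b) (a * b)"
  shows "mtrace (bip_power a b M n) = mtrace M ^ n"
proof -
  have "mtrace (bip_power a b M n) = (\<Sum>r<a ^ n * b ^ n. pow2 a b (mk b M) n (r div b ^ n, r mod b ^ n) (r div b ^ n, r mod b ^ n))"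
    using bip_power_carrier[of a b M n] by (simp add: mtrace_def bip_power_entry[OF ab])
  also have "\<dots> = (\<Sum>p\<in>{..<a ^ n} \<times> {..<b ^ n}. pow2 a b (mk b M) n p p)"
    using ab by (intro sum.reindex_bij_betw[OF bij_betw_div_mod]) simp
  also have "\<dots> = (\<Sum>p\<in>{..<a} \<times> {..<b}. mk b M p p) ^ n" by (rule kpw_trace[OF splitting2[OF ab]])
  also have "(\<Sum>p\<in>{..<a} \<times> {..<b}. mk b M p p) = (\<Sum>r<a * b. mk b M (r div b, r mod b) (r div b, r mod b))"
    using ab by (intro sum.reindex_bij_betw[OF bij_betw_div_mod, symmetric])
  also have "\<dots> = mtrace M" using M by (simp add: mtrace_def mk_def)
  finally show ?thesis .
qed

text \<open>The A-factors of all copies are multiplied together, and so are the B-factors; the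
  resulting vector is again a product across A^n:B^n.\<close>

lemma sepc_bip_power:
  assumes ab: "a > 0" "b > 0" and M: "sepc a b M"
  shows "sepc (a ^ n) (b ^ n) (bip_power a b M n)"
proof (induction n)
  case 0
  show ?case
    by (rule sepcI[of "{0::nat}" _ _ _ "\<lambda>_. 1" "\<lambda>_ _. 1" "\<lambda>_ _. 1"]) (auto simp: pv_def)
next
  case (Suc n)
  obtain K :: nat and u v where X: "\<And>r c. r < a * b \<Longrightarrow> c < a * b \<Longrightarrow> M $$ (r, c) = (\<Sum>k<K. pv b (u k) (v k) r * cnj (pv b (u k) (v k) c))"
    using M unfolding sepc_def by blast
  obtain L :: nat and u' v' where Y: "\<And>r c. r < a ^ n * b ^ n \<Longrightarrow> c < a ^ n * b ^ n \<Longrightarrow>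
      bip_power a b M n $$ (r, c) = (\<Sum>k<L. pv (b ^ n) (u' k) (v' k) r * cnj (pv (b ^ n) (u' k) (v' k) c))"
    using Suc unfolding sepc_def by blast
  have pos: "a ^ n > 0" "b ^ n > 0" using ab by simp_all
  have lt: "p * m + q < l * m" if "p < l" "q < m" for p q l m :: nat
  proof -
    have "p * m + q < (p + 1) * m" using that by simp
    also have "\<dots> \<le> l * m" using that by (intro mult_right_mono) auto
    finally show ?thesis .
  qed
  show ?case
  proof (rule sepcI[of "{..<K} \<times> {..<L}" _ _ _ "\<lambda>_. 1" "\<lambda>j x. u (fst j) (x div a ^ n) * u' (snd j) (x mod a ^ n)"
        "\<lambda>j y. v (fst j) (y div b ^ n) * v' (snd j) (y mod b ^ n)"])
    fix r c assume rc: "r < a ^ Suc n * b ^ Suc n" "c < a ^ Suc n * b ^ Suc n"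
    have parts: "idx_fst b (a ^ n) (b ^ n) s < a * b" "idx_snd b (a ^ n) (b ^ n) s < a ^ n * b ^ n"
      if "s < a ^ Suc n * b ^ Suc n" for s
    proof -
      have 1: "s div (b * b ^ n) < a * a ^ n" using that by (simp add: less_mult_imp_div_less)
      have 2: "s mod (b * b ^ n) < b * b ^ n" using ab by simp
      show "idx_fst b (a ^ n) (b ^ n) s < a * b" unfolding idx_fst_def
        using less_mult_imp_div_less[OF 1] less_mult_imp_div_less[OF 2] by (intro lt)
      show "idx_snd b (a ^ n) (b ^ n) s < a ^ n * b ^ n" unfolding idx_snd_def
        using pos by (intro lt) auto
    qed
    have dm: "idx_snd b (a ^ n) (b ^ n) s div b ^ n = s div (b * b ^ n) mod a ^ n"
      "idx_snd b (a ^ n) (b ^ n) s mod b ^ n = s mod (b * b ^ n) mod b ^ n"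
      "idx_fst b (a ^ n) (b ^ n) s div b = s div (b * b ^ n) div a ^ n"
      "idx_fst b (a ^ n) (b ^ n) s mod b = s mod (b * b ^ n) div b ^ n" for s
      using pos ab less_mult_imp_div_less[of "s mod (b * b ^ n)" b "b ^ n"] by (simp_all add: idx_snd_def idx_fst_def)
    have "bip_power a b M (Suc n) $$ (r, c) = M $$ (idx_fst b (a ^ n) (b ^ n) r, idx_fst b (a ^ n) (b ^ n) c) *
      bip_power a b M n $$ (idx_snd b (a ^ n) (b ^ n) r, idx_snd b (a ^ n) (b ^ n) c)"
      using rc by (simp add: bip_tensor_def)
    also have "\<dots> = (\<Sum>k<K. \<Sum>l<L.
        (pv b (u k) (v k) (idx_fst b (a ^ n) (b ^ n) r) * cnj (pv b (u k) (v k) (idx_fst b (a ^ n) (b ^ n) c))) *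
        (pv (b ^ n) (u' l) (v' l) (idx_snd b (a ^ n) (b ^ n) r) * cnj (pv (b ^ n) (u' l) (v' l) (idx_snd b (a ^ n) (b ^ n) c))))"
      unfolding X[OF parts(1)[OF rc(1)] parts(1)[OF rc(2)]] Y[OF parts(2)[OF rc(1)] parts(2)[OF rc(2)]] sum_product ..
    finally show "bip_power a b M (Suc n) $$ (r, c) = (\<Sum>j\<in>{..<K} \<times> {..<L}. complex_of_real 1 *
        (pv (b ^ Suc n) (\<lambda>x. u (fst j) (x div a ^ n) * u' (snd j) (x mod a ^ n)) (\<lambda>y. v (fst j) (y div b ^ n) * v' (snd j) (y mod b ^ n)) r *
         cnj (pv (b ^ Suc n) (\<lambda>x. u (fst j) (x div a ^ n) * u' (snd j) (x mod a ^ n)) (\<lambda>y. v (fst j) (y div b ^ n) * v' (snd j) (y mod b ^ n)) c)))"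
      by (simp add: sum.cartesian_product' pv_def dm mult_ac)
  qed (use bip_power_carrier[of a b M "Suc n"] in simp_all)
qed

text \<open>An inequality on product vectors alone transfers to separable operators; this is exactly
  what an argument by partial transposition provides.\<close>

lemma sepc_expectation_mono:
  assumes "sepc a b X" "S \<in> carrier_mat (a * b) (a * b)" "T \<in> carrier_mat (a * b) (a * b)"
    and "\<And>u v. Re (hform {..<a * b} (\<lambda>r c. S $$ (r, c)) (pv b u v)) \<le> Re (hform {..<a * b} (\<lambda>r c. T $$ (r, c)) (pv b u v))"
  shows "Re (mtrace (S * X)) \<le> Re (mtrace (T * X))"
proof -
  obtain K :: nat and u v where X: "X \<in> carrier_mat (a * b) (a * b)"
      "\<And>r c. r < a * b \<Longrightarrow> c < a * b \<Longrightarrow> X $$ (r, c) = (\<Sum>k<K. pv b (u k) (v k) r * cnj (pv b (u k) (v k) c))"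
    using assms(1) unfolding sepc_def by blast
  have "mtrace (S * X) = (\<Sum>k<K. hform {..<a * b} (\<lambda>r c. S $$ (r, c)) (pv b (u k) (v k)))"
    by (rule gram_expectation(1)[OF assms(2) X])
  moreover have "mtrace (T * X) = (\<Sum>k<K. hform {..<a * b} (\<lambda>r c. T $$ (r, c)) (pv b (u k) (v k)))"
    by (rule gram_expectation(1)[OF assms(3) X])
  ultimately show ?thesis using assms(4) by (simp add: sum_mono)
qed

section \<open>Matrices of kernels on index pairs\<close>

definition kmat :: "nat \<Rightarrow> nat \<Rightarrow> (nat \<times> nat \<Rightarrow> nat \<times> nat \<Rightarrow> complex) \<Rightarrow> op" where
  "kmat a b K = mat (a * b) (a * b) (\<lambda>(r, c). K (r div b, r mod b) (c div b, c mod b))"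

lemma kmat_carrier: "kmat a b K \<in> carrier_mat (a * b) (a * b)"
  by (simp add: kmat_def)

lemma kmat_entry: "r < a * b \<Longrightarrow> c < a * b \<Longrightarrow> kmat a b K $$ (r, c) = K (r div b, r mod b) (c div b, c mod b)"
  by (simp add: kmat_def)

lemma pair_in_range: "b > 0 \<Longrightarrow> r < a * b \<Longrightarrow> (r div b, r mod b) \<in> {..<a} \<times> {..<(b::nat)}"
  by (simp add: less_mult_imp_div_less)

lemma kmat_cong:
  assumes "b > 0" "\<And>p q. p \<in> {..<a} \<times> {..<b} \<Longrightarrow> q \<in> {..<a} \<times> {..<b} \<Longrightarrow> K p q = L p q"
  shows "kmat a b K = kmat a b L"
  unfolding kmat_def using assms(2)[OF pair_in_range[OF assms(1)] pair_in_range[OF assms(1)]]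
  by (intro eq_matI) auto

lemma hform_kmat:
  assumes "b > 0"
  shows "hform {..<a * b} (\<lambda>r c. kmat a b K $$ (r, c)) (pv b u v) = hform ({..<a} \<times> {..<b}) K (\<lambda>p. u (fst p) * v (snd p))"
  unfolding hform_bipartite[OF assms, symmetric] by (intro hform_cong) (auto simp: kmat_entry)

lemma psd_kmat:
  assumes "b > 0" "psdk ({..<a} \<times> {..<b}) K"
  shows "psd (a * b) (kmat a b K)"
proof -
  have "psdk {..<a * b} (\<lambda>r c. K (r div b, r mod b) (c div b, c mod b))"
    by (rule psdk_reindex[OF bij_betw_div_mod[OF assms(1)], THEN iffD2]) (rule assms(2))
  then have "psdk {..<a * b} (\<lambda>r c. kmat a b K $$ (r, c))"
    by (rule psdk_cong[THEN iffD1, rotated]) (simp add: kmat_entry)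
  then show ?thesis by (simp add: psd_iff_psdk kmat_carrier)
qed

lemma mtrace_kmat:
  assumes "b > 0"
  shows "mtrace (kmat a b K) = (\<Sum>p\<in>{..<a} \<times> {..<b}. K p p)"
  unfolding sum.reindex_bij_betw[OF bij_betw_div_mod[OF assms, of a], symmetric]
  by (simp add: mtrace_def kmat_def)

lemma kmat_mult:
  assumes "b > 0"
  shows "kmat a b K * kmat a b L = kmat a b (\<lambda>p q. \<Sum>s\<in>{..<a} \<times> {..<b}. K p s * L s q)"
proof (rule eq_matI)
  fix r c assume "r < dim_row (kmat a b (\<lambda>p q. \<Sum>s\<in>{..<a} \<times> {..<b}. K p s * L s q))"
    "c < dim_col (kmat a b (\<lambda>p q. \<Sum>s\<in>{..<a} \<times> {..<b}. K p s * L s q))"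
  then have rc: "r < a * b" "c < a * b" by (simp_all add: kmat_def)
  have "(kmat a b K * kmat a b L) $$ (r, c) = (\<Sum>l<a * b. kmat a b K $$ (r, l) * kmat a b L $$ (l, c))"
    by (rule mat_mult_entry[OF kmat_carrier kmat_carrier rc])
  also have "\<dots> = (\<Sum>l<a * b. K (r div b, r mod b) (l div b, l mod b) * L (l div b, l mod b) (c div b, c mod b))"
    using rc by (simp add: kmat_entry)
  also have "\<dots> = (\<Sum>s\<in>{..<a} \<times> {..<b}. K (r div b, r mod b) s * L s (c div b, c mod b))"
    by (rule sum.reindex_bij_betw[OF bij_betw_div_mod[OF assms]])
  also have "\<dots> = kmat a b (\<lambda>p q. \<Sum>s\<in>{..<a} \<times> {..<b}. K p s * L s q) $$ (r, c)"
    using rc by (simp add: kmat_entry)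
  finally show "(kmat a b K * kmat a b L) $$ (r, c) = kmat a b (\<lambda>p q. \<Sum>s\<in>{..<a} \<times> {..<b}. K p s * L s q) $$ (r, c)" .
qed (simp_all add: kmat_def)

lemma bip_power_kmat:
  assumes ab: "a > 0" "b > 0"
  shows "bip_power a b (kmat a b K) n = kmat (a ^ n) (b ^ n) (pow2 a b K n)"
proof -
  have lt: "fst p * b + snd p < a * b" if "p \<in> {..<a} \<times> {..<b}" for p
  proof -
    have "fst p * b + snd p < (fst p + 1) * b" using that by auto
    also have "\<dots> \<le> a * b" using that by (intro mult_right_mono) auto
    finally show ?thesis .
  qed
  have mk: "mk b (kmat a b K) p q = K p q" if "p \<in> {..<a} \<times> {..<b}" "q \<in> {..<a} \<times> {..<b}" for p q
    using that lt[OF that(1)] lt[OF that(2)] by (cases p, cases q) (simp add: mk_def kmat_entry)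
  have "bip_power a b (kmat a b K) n = kmat (a ^ n) (b ^ n) (pow2 a b (mk b (kmat a b K)) n)"
  proof (rule eq_matI)
    fix r s assume "r < dim_row (kmat (a ^ n) (b ^ n) (pow2 a b (mk b (kmat a b K)) n))"
      "s < dim_col (kmat (a ^ n) (b ^ n) (pow2 a b (mk b (kmat a b K)) n))"
    then have rs: "r < a ^ n * b ^ n" "s < a ^ n * b ^ n" by (simp_all add: kmat_def)
    show "bip_power a b (kmat a b K) n $$ (r, s) = kmat (a ^ n) (b ^ n) (pow2 a b (mk b (kmat a b K)) n) $$ (r, s)"
      unfolding bip_power_entry[OF ab rs] kmat_entry[OF rs] ..
  qed (use bip_power_carrier[of a b "kmat a b K" n] in \<open>auto simp: kmat_carrier[THEN carrier_matD(1)] kmat_carrier[THEN carrier_matD(2)]\<close>)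
  also have "\<dots> = kmat (a ^ n) (b ^ n) (pow2 a b K n)"
    using ab mk by (intro kmat_cong kpw_cong[OF splitting2[OF ab]]) auto
  finally show ?thesis .
qed

section \<open>Phase averages\<close>

text \<open>Powers of 2 form a Sidon set. After division by the strictly smallest power 2^a the
  right side is even, so 1 + 2^(b - a) is even and equals 2, whereas the right side is at least
  4.\<close>

lemma sum_two_powers_unique:
  fixes a b c e :: nat
  assumes "(2::nat) ^ a + 2 ^ b = 2 ^ c + 2 ^ e"
  shows "(a = c \<and> b = e) \<or> (a = e \<and> b = c)"
proof -
  have not_less: "\<not> a < c" if eq: "(2::nat) ^ a + 2 ^ b = 2 ^ c + 2 ^ e" and "a \<le> b" "c \<le> e" for a b c e :: nat
  proof
    assume ac: "a < c"
    have split: "(2::nat) ^ x = 2 ^ a * 2 ^ (x - a)" if "a \<le> x" for x using that by (simp flip: power_add)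
    have "2 ^ a * (1 + 2 ^ (b - a)) = (2::nat) ^ a * (2 ^ (c - a) + 2 ^ (e - a))"
      using eq split[of b] split[of c] split[of e] ac that by (simp add: distrib_left)
    moreover have "0 < (2::nat) ^ a" by simp
    ultimately have 1: "1 + (2::nat) ^ (b - a) = 2 ^ (c - a) + 2 ^ (e - a)" by (simp only: nat_mult_eq_cancel1)
    have "even ((2::nat) ^ (c - a) + 2 ^ (e - a))" using ac that by simp
    then have "odd ((2::nat) ^ (b - a))" using 1 by (metis even_plus_one_iff add.commute)
    then have "(2::nat) ^ (b - a) = 1" by simp
    moreover have "(2::nat) ^ 1 \<le> 2 ^ (c - a)" "(2::nat) ^ 1 \<le> 2 ^ (e - a)"
      using ac that by (intro power_increasing; simp)+
    ultimately show False using 1 by simp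
  qed
  have sorted: "a = c \<and> b = e" if eq: "(2::nat) ^ a + 2 ^ b = 2 ^ c + 2 ^ e" and "a \<le> b" "c \<le> e" for a b c e :: nat
  proof -
    have "a = c" using not_less[OF that] not_less[OF eq[symmetric] that(3,2)] by simp
    then show ?thesis using eq by simp
  qed
  have swap: "(2::nat) ^ x + 2 ^ y = 2 ^ y + 2 ^ x" for x y :: nat by simp
  show ?thesis
    using sorted[of a b c e] sorted[of b a c e] sorted[of a b e c] sorted[of b a e c] assms
    by (metis add.commute nat_le_linear)
qed

text \<open>A geometric sum over N-th roots of unity; |k| < N prevents a nonzero k from being a
  multiple of N.\<close>

lemma cis_sum_roots:
  fixes k :: int
  assumes N: "N > 0" and k: "\<bar>k\<bar> < int N"
  shows "(\<Sum>t<N. cis (real t * (2 * pi * (real_of_int k / real N)))) = of_nat N * of_bool (k = 0)"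
proof (cases "k = 0")
  case False
  define r where "r = cis (2 * pi * (real_of_int k / real N))"
  have "r \<noteq> 1"
  proof
    assume "r = 1"
    then have "cos (2 * pi * (real_of_int k / real N)) = 1" unfolding r_def by (metis cis.simps(1) one_complex.simps(1))
    then obtain j :: int where "2 * pi * (real_of_int k / real N) = of_int j * 2 * pi"
      using cos_one_2pi_int by blast
    then have "real_of_int k = real_of_int (j * int N)" using N by (simp add: field_simps)
    then have kj: "k = j * int N" by linarith
    then have "\<bar>j\<bar> * int N < 1 * int N" using k by (simp add: abs_mult)
    then have "\<bar>j\<bar> < 1" using N by (simp add: mult_less_cancel_right)
    then show False using kj False by simp
  qed
  moreover have "r ^ N = 1"
  proof -
    have "r ^ N = cis (2 * pi * real_of_int k)" using N by (simp add: r_def DeMoivre)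
    then show ?thesis by (simp add: cis_multiple_2pi)
  qed
  ultimately have "(\<Sum>t<N. r ^ t) = 0" by (simp add: geometric_sum)
  then show ?thesis using False by (simp add: r_def DeMoivre)
qed simp

text \<open>The phases are \<open>exp (2 \<pi> i t 2^x / N)\<close>; sums of two powers of 2 determine the two exponents.\<close>

lemma phase_average:
  fixes D :: nat
  shows "\<exists>(N::nat) \<omega>. N > 0 \<and> (\<forall>x<D. \<forall>y<D. \<forall>x'<D. \<forall>y'<D.
     (\<Sum>t<N. \<omega> t x * \<omega> t y * cnj (\<omega> t x' * \<omega> t y')) = of_nat N * of_bool ((x = x' \<and> y = y') \<or> (x = y' \<and> y = x')))"
proof -
  \<comment> \<open>Each of the four powers is below 2^D, so the difference of two pair sums is
    below 2 * 2^D in absolute value; this N lets \<open>cis_sum_roots\<close> detect whether it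
    vanishes.\<close>
  define N :: nat where "N = 2 ^ Suc D"
  define \<omega> where "\<omega> t x = cis (real t * (2 * pi * (2 ^ x / real N)))" for t x :: nat
  have N: "N > 0" by (simp add: N_def)
  have "(\<Sum>t<N. \<omega> t x * \<omega> t y * cnj (\<omega> t x' * \<omega> t y')) = of_nat N * of_bool ((x = x' \<and> y = y') \<or> (x = y' \<and> y = x'))"
    if lt: "x < D" "y < D" "x' < D" "y' < D" for x y x' y'
  proof -
    define k :: int where "k = 2 ^ x + 2 ^ y - 2 ^ x' - 2 ^ y'"
    have trm: "\<omega> t x * \<omega> t y * cnj (\<omega> t x' * \<omega> t y') = cis (real t * (2 * pi * (real_of_int k / real N)))" for t
    proof -
      have "\<omega> t x * \<omega> t y * cnj (\<omega> t x' * \<omega> t y') = cis (real t * (2 * pi * (2 ^ x / real N)) + real t * (2 * pi * (2 ^ y / real N))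
          + - (real t * (2 * pi * (2 ^ x' / real N)) + real t * (2 * pi * (2 ^ y' / real N))))"
        unfolding \<omega>_def by (simp only: complex_cnj_mult cis_cnj cis_mult)
      also have "real t * (2 * pi * (2 ^ x / real N)) + real t * (2 * pi * (2 ^ y / real N))
          + - (real t * (2 * pi * (2 ^ x' / real N)) + real t * (2 * pi * (2 ^ y' / real N))) =
          real t * (2 * pi * (real_of_int k / real N))"
        unfolding k_def by (simp add: algebra_simps add_divide_distrib diff_divide_distrib)
      finally show ?thesis .
    qed
    have b: "0 < (2::int) ^ z" "(2::int) ^ z < 2 ^ D" if "z < D" for z using that by simp_all
    have "int N = 2 * 2 ^ D" by (simp add: N_def)
    then have "\<bar>k\<bar> < int N" unfolding k_def using b[OF lt(1)] b[OF lt(2)] b[OF lt(3)] b[OF lt(4)] by linarith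
    then have 1: "(\<Sum>t<N. \<omega> t x * \<omega> t y * cnj (\<omega> t x' * \<omega> t y')) = of_nat N * of_bool (k = 0)"
      unfolding trm by (rule cis_sum_roots[OF N])
    have "k = 0 \<longleftrightarrow> int (2 ^ x + 2 ^ y) = int (2 ^ x' + 2 ^ y')" unfolding k_def by auto
    also have "\<dots> \<longleftrightarrow> (2::nat) ^ x + 2 ^ y = 2 ^ x' + 2 ^ y'" by (rule of_nat_eq_iff)
    also have "\<dots> \<longleftrightarrow> (x = x' \<and> y = y') \<or> (x = y' \<and> y = x')" using sum_two_powers_unique by auto
    finally show ?thesis unfolding 1 by (simp only:)
  qed
  then show ?thesis using N by blast
qed

lemma sum_delta4:
  "x < (D::nat) \<Longrightarrow> (\<Sum>j<D. of_bool (x = j) * of_bool (y = j) * cnj (of_bool (x' = j) * of_bool (y' = j))) =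
    (of_bool (x = y \<and> x = x' \<and> x = y') :: complex)"
proof -
  assume "x < D"
  have "(\<Sum>j<D. of_bool (x = j) * of_bool (y = j) * cnj (of_bool (x' = j) * of_bool (y' = j))) =
      (\<Sum>j<D. if j = x then of_bool (y = x) * of_bool (x' = x) * of_bool (y' = x) else 0 :: complex)"
    by (intro sum.cong refl) auto
  then show ?thesis using \<open>x < D\<close> by auto
qed

definition symmk :: "nat \<times> nat \<Rightarrow> nat \<times> nat \<Rightarrow> complex" where
  "symmk p q = ((if p = q then 1 else 0) + (if p = (snd q, fst q) then 1 else 0)) / 2"

text \<open>A phase average counts equality of unordered pairs once, while 1 + F counts it twice on
  pairs (x, x). The second indicator is this diagonal correction.\<close>

lemma symmk_of_bool: "symmk (x, y) (x', y') =
    (of_bool ((x = x' \<and> y = y') \<or> (x = y' \<and> y = x')) + of_bool (x = y \<and> x = x' \<and> x = y')) / 2"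
proof (cases "x = y")
  case True
  then show ?thesis by (cases "x = x'"; cases "x = y'") (simp_all add: symmk_def)
next
  case False
  have "(if A then 1 else 0) + (if B then 1 else 0) = (of_bool (A \<or> B) + of_bool False :: complex)"
    if "\<not> (A \<and> B)" for A B using that by auto
  moreover have "\<not> ((x = x' \<and> y = y') \<and> (x = y' \<and> y = x'))" using False by blast
  ultimately show ?thesis using False by (simp only: symmk_def prod.inject fst_conv snd_conv simp_thms)
qed

text \<open>
  The operator 1 + F is the average of the product vectors with equal phases on both sides, which
  counts the vectors |jj> only once, plus the sum of the |jj><jj|.
\<close>

lemma sepc_symmetric:
  assumes "d > 0" "0 \<le> c"
  shows "sepc d d (kmat d d (\<lambda>p q. complex_of_real c * symmk p q))"
proof -
  obtain N :: nat and \<omega> where N: "N > 0" and avg: "\<And>x y x' y'. x < d \<Longrightarrow> y < d \<Longrightarrow> x' < d \<Longrightarrow> y' < d \<Longrightarrow>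
     (\<Sum>t<N. \<omega> t x * \<omega> t y * cnj (\<omega> t x' * \<omega> t y')) = of_nat N * of_bool ((x = x' \<and> y = y') \<or> (x = y' \<and> y = x'))"
    using phase_average[of d] by blast
  define e :: "nat \<Rightarrow> nat \<Rightarrow> complex" where "e j x = of_bool (x = j)" for j x
  define u where "u = case_sum \<omega> e"
  show ?thesis
  proof (rule sepcI[of "{..<N} <+> {..<d}" _ _ _ "case_sum (\<lambda>_. c / 2 / real N) (\<lambda>_. c / 2)" u u])
    fix r s assume rs: "r < d * d" "s < d * d"
    then have lt: "r div d < d" "r mod d < d" "s div d < d" "s mod d < d"
      using assms by (simp_all add: less_mult_imp_div_less)
    have delta: "(\<Sum>j<d. e j (r div d) * e j (r mod d) * cnj (e j (s div d) * e j (s mod d))) =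
        of_bool (r div d = r mod d \<and> r div d = s div d \<and> r div d = s mod d)"
      unfolding e_def by (rule sum_delta4[OF lt(1)])
    have "(\<Sum>j\<in>{..<N} <+> {..<d}. complex_of_real (case_sum (\<lambda>_. c / 2 / real N) (\<lambda>_. c / 2) j) * (pv d (u j) (u j) r * cnj (pv d (u j) (u j) s))) =
      complex_of_real (c / 2 / real N) * (\<Sum>t<N. \<omega> t (r div d) * \<omega> t (r mod d) * cnj (\<omega> t (s div d) * \<omega> t (s mod d))) +
      complex_of_real (c / 2) * (\<Sum>j<d. e j (r div d) * e j (r mod d) * cnj (e j (s div d) * e j (s mod d)))"
      by (simp add: sum.Plus u_def pv_def sum_distrib_left mult.assoc)
    also have "\<dots> = complex_of_real (c / 2) * (of_bool ((r div d = s div d \<and> r mod d = s mod d) \<or> (r div d = s mod d \<and> r mod d = s div d))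
       + of_bool (r div d = r mod d \<and> r div d = s div d \<and> r div d = s mod d))"
      unfolding avg[OF lt] delta using N by (simp add: distrib_left)
    also have "\<dots> = complex_of_real c * symmk (r div d, r mod d) (s div d, s mod d)"
      unfolding symmk_of_bool by simp
    finally show "kmat d d (\<lambda>p q. complex_of_real c * symmk p q) $$ (r, s) =
      (\<Sum>j\<in>{..<N} <+> {..<d}. complex_of_real (case_sum (\<lambda>_. c / 2 / real N) (\<lambda>_. c / 2) j) * (pv d (u j) (u j) r * cnj (pv d (u j) (u j) s)))"
      using rs by (simp add: kmat_entry)
  qed (use assms in \<open>auto simp: kmat_carrier\<close>)
qed

text \<open>K times the projector onto the maximally entangled vector of Schmidt rank K. Without the
  normalization the kernel does not depend on K.\<close>

definition maxent :: "nat \<times> nat \<Rightarrow> nat \<times> nat \<Rightarrow> complex" where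
  "maxent p q = of_bool (fst p = snd p) * of_bool (fst q = snd q)"

definition offdiag :: "nat \<times> nat \<Rightarrow> nat \<times> nat \<Rightarrow> complex" where
  "offdiag p q = of_bool (p = q \<and> fst p \<noteq> snd p)"

text \<open>The right side is the unordered-pair indicator of \<open>phase_average\<close> with y
  and y' exchanged, that is, its partial transpose on B.\<close>

lemma maxent_offdiag: "maxent (x, y) (x', y') + offdiag (x, y) (x', y') =
    of_bool ((x = x' \<and> y' = y) \<or> (x = y \<and> y' = x'))"
proof (cases "x = y")
  case True
  then show ?thesis by (cases "x' = y'") (simp_all add: maxent_def offdiag_def)
next
  case False
  then show ?thesis by (simp add: maxent_def offdiag_def eq_commute[of y y'])
qed

text \<open>An average over product vectors with phases \<omega> on A and their conjugates on
  B.\<close>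

lemma sepc_maxent_offdiag:
  assumes "K > 0" "0 \<le> c"
  shows "sepc K K (kmat K K (\<lambda>p q. complex_of_real c * (maxent p q + offdiag p q)))"
proof -
  obtain N :: nat and \<omega> where N: "N > 0" and avg: "\<And>x y x' y'. x < K \<Longrightarrow> y < K \<Longrightarrow> x' < K \<Longrightarrow> y' < K \<Longrightarrow>
     (\<Sum>t<N. \<omega> t x * \<omega> t y * cnj (\<omega> t x' * \<omega> t y')) = of_nat N * of_bool ((x = x' \<and> y = y') \<or> (x = y' \<and> y = x'))"
    using phase_average[of K] by blast
  show ?thesis
  proof (rule sepcI[of "{..<N}" _ _ _ "\<lambda>_. c / real N" \<omega> "\<lambda>t y. cnj (\<omega> t y)"])
    fix r s assume rs: "r < K * K" "s < K * K"
    then have lt: "r div K < K" "r mod K < K" "s div K < K" "s mod K < K"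
      using assms by (simp_all add: less_mult_imp_div_less)
    have "(\<Sum>t<N. complex_of_real (c / real N) * (pv K (\<omega> t) (\<lambda>y. cnj (\<omega> t y)) r * cnj (pv K (\<omega> t) (\<lambda>y. cnj (\<omega> t y)) s))) =
      complex_of_real (c / real N) * (\<Sum>t<N. \<omega> t (r div K) * \<omega> t (s mod K) * cnj (\<omega> t (s div K) * \<omega> t (r mod K)))"
      by (simp add: pv_def sum_distrib_left mult_ac)
    also have "\<dots> = complex_of_real c * of_bool ((r div K = s div K \<and> s mod K = r mod K) \<or> (r div K = r mod K \<and> s mod K = s div K))"
      \<comment> \<open>The conjugate phases exchange the roles of the two B-indices, hence the
        permuted order of the range facts.\<close>
      unfolding avg[OF lt(1,4,3,2)] using N by simp
    also have "\<dots> = complex_of_real c * (maxent (r div K, r mod K) (s div K, s mod K) + offdiag (r div K, r mod K) (s div K, s mod K))"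
      unfolding maxent_offdiag ..
    finally show "kmat K K (\<lambda>p q. complex_of_real c * (maxent p q + offdiag p q)) $$ (r, s) =
      (\<Sum>t<N. complex_of_real (c / real N) * (pv K (\<omega> t) (\<lambda>y. cnj (\<omega> t y)) r * cnj (pv K (\<omega> t) (\<lambda>y. cnj (\<omega> t y)) s)))"
      using rs by (simp add: kmat_entry)
  qed (use assms in \<open>auto simp: kmat_carrier\<close>)
qed

lemma sepc_diagonal:
  assumes b: "b > 0" and w: "\<And>p. 0 \<le> w p"
  shows "sepc a b (kmat a b (\<lambda>p q. complex_of_real (w p) * of_bool (p = q)))"
proof (rule sepcI[of "{..<a} \<times> {..<b}" _ _ _ w "\<lambda>j x. of_bool (x = fst j)" "\<lambda>j y. of_bool (y = snd j)"])
  fix r s assume rs: "r < a * b" "s < a * b"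
  have "(\<Sum>j\<in>{..<a} \<times> {..<b}. complex_of_real (w j) * (pv b (\<lambda>x. of_bool (x = fst j)) (\<lambda>y. of_bool (y = snd j)) r *
      cnj (pv b (\<lambda>x. of_bool (x = fst j)) (\<lambda>y. of_bool (y = snd j)) s))) =
      (\<Sum>j\<in>{..<a} \<times> {..<b}. if j = (r div b, r mod b) then complex_of_real (w j) * of_bool (j = (s div b, s mod b)) else 0)"
    by (intro sum.cong refl) (auto simp: pv_def)
  also have "\<dots> = complex_of_real (w (r div b, r mod b)) * of_bool ((r div b, r mod b) = (s div b, s mod b))"
    using pair_in_range[OF b rs(1)] by (subst sum.delta) auto
  finally show "kmat a b (\<lambda>p q. complex_of_real (w p) * of_bool (p = q)) $$ (r, s) =
      (\<Sum>j\<in>{..<a} \<times> {..<b}. complex_of_real (w j) * (pv b (\<lambda>x. of_bool (x = fst j)) (\<lambda>y. of_bool (y = snd j)) r *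
      cnj (pv b (\<lambda>x. of_bool (x = fst j)) (\<lambda>y. of_bool (y = snd j)) s)))"
    using rs by (simp add: kmat_entry)
qed (use w in \<open>auto simp: kmat_carrier\<close>)

lemma sepc_offdiag:
  assumes "K > 0" "0 \<le> c"
  shows "sepc K K (kmat K K (\<lambda>p q. complex_of_real c * offdiag p q))"
proof -
  have "(\<lambda>p q. complex_of_real c * offdiag p q) = (\<lambda>p q. complex_of_real (c * of_bool (fst p \<noteq> snd p)) * of_bool (p = q))"
    by (auto simp: offdiag_def fun_eq_iff)
  then show ?thesis using sepc_diagonal[of K "\<lambda>p. c * of_bool (fst p \<noteq> snd p)" K] assms by simp
qed

section \<open>The maximally entangled and the antisymmetric states\<close>

lemma Phi2_kmat: "Phi2 = kmat 2 2 (\<lambda>p q. 1 / 2 * maxent p q)"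
proof -
  have dim: "dim_vec phi2_vec = 4" by (simp add: phi2_vec_def tensor_vec_def)
  have entry: "phi2_vec $ i = complex_of_real (1 / sqrt 2) * of_bool (i div 2 = i mod 2)" if "i < 4" for i
  proof -
    have "i = 0 \<or> i = 1 \<or> i = 2 \<or> i = 3" using that by auto
    then show ?thesis by (elim disjE) (simp_all add: phi2_vec_def tensor_vec_def unit_vec_def)
  qed
  have sq: "complex_of_real (1 / sqrt 2) * complex_of_real (1 / sqrt 2) = 1 / 2"
    by (simp flip: of_real_mult)
  have "phi2_vec $ r * cnj (phi2_vec $ s) = 1 / 2 * maxent (r div 2, r mod 2) (s div 2, s mod 2)" if "r < 4" "s < 4" for r s
  proof -
    have "phi2_vec $ r * cnj (phi2_vec $ s) = (complex_of_real (1 / sqrt 2) * complex_of_real (1 / sqrt 2)) *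
        (of_bool (r div 2 = r mod 2) * of_bool (s div 2 = s mod 2))"
      unfolding entry[OF that(1)] entry[OF that(2)] by simp
    then show ?thesis unfolding sq maxent_def by simp
  qed
  then show ?thesis unfolding Phi2_def ket_bra_def kmat_def dim by (intro eq_matI) auto
qed

text \<open>The A- and B-index agree iff their leading digits and their remainders agree, so the
  coincidence condition factors over the copies.\<close>

lemma pow2_maxent:
  "p \<in> {..<2 ^ n} \<times> {..<2 ^ n} \<Longrightarrow> q \<in> {..<2 ^ n} \<times> {..<2 ^ n} \<Longrightarrow>
    pow2 2 2 (\<lambda>p q. 1 / 2 * maxent p q) n p q = 1 / 2 ^ n * maxent p q"
proof (induction n arbitrary: p q)
  case 0
  then show ?case by (auto simp: maxent_def)
next
  case (Suc n)
  have r: "tp2 2 2 n s \<in> {..<2 ^ n} \<times> {..<2 ^ n}" for s by (cases s) simp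
  have m: "maxent (hp2 2 2 n p) (hp2 2 2 n q) * maxent (tp2 2 2 n p) (tp2 2 2 n q) = maxent p q"
    using eq_iff_div_mod[of "fst p" "snd p" "2 ^ n"] eq_iff_div_mod[of "fst q" "snd q" "2 ^ n"]
    by (cases p; cases q) (auto simp: maxent_def)
  have "pow2 2 2 (\<lambda>p q. 1 / 2 * maxent p q) (Suc n) p q =
      1 / 2 ^ Suc n * (maxent (hp2 2 2 n p) (hp2 2 2 n q) * maxent (tp2 2 2 n p) (tp2 2 2 n q))"
    unfolding kpw.simps Suc.IH[OF r r] by simp
  then show ?case unfolding m .
qed

lemma Phi2_power: "bip_power 2 2 Phi2 m = kmat (2 ^ m) (2 ^ m) (\<lambda>p q. 1 / 2 ^ m * maxent p q)"
  unfolding Phi2_kmat bip_power_kmat[OF pos2 pos2] by (intro kmat_cong pow2_maxent) auto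

lemma antisym_state_kmat:
  assumes "d > 0"
  shows "antisym_state d = kmat d d (\<lambda>p q. complex_of_real (2 / (real d * (real d - 1))) * antisymk p q)"
proof (rule eq_matI)
  fix r s assume "r < dim_row (kmat d d (\<lambda>p q. complex_of_real (2 / (real d * (real d - 1))) * antisymk p q))"
    "s < dim_col (kmat d d (\<lambda>p q. complex_of_real (2 / (real d * (real d - 1))) * antisymk p q))"
  then have rs: "r < d * d" "s < d * d" by (simp_all add: kmat_def)
  have eq: "r = s \<longleftrightarrow> (r div d, r mod d) = (s div d, s mod d)" using eq_iff_div_mod[of r s d] by simp
  have "antisym_state d $$ (r, s) = 1 / (of_nat d * (of_nat d - 1)) *
      ((if r = s then 1 else 0) - (if r div d = s mod d \<and> r mod d = s div d then 1 else 0))"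
    using rs by (simp add: antisym_state_def swap_op_def)
  also have "\<dots> = complex_of_real (2 / (real d * (real d - 1))) * antisymk (r div d, r mod d) (s div d, s mod d)"
  proof -
    have eq2: "(r div d, r mod d) = (snd (s div d, s mod d), fst (s div d, s mod d)) \<longleftrightarrow> r div d = s mod d \<and> r mod d = s div d"
      by simp
    have half: "1 / (of_nat d * (of_nat d - 1)) * z = complex_of_real (2 / (real d * (real d - 1))) * (z / 2)" for z :: complex
      by simp
    show ?thesis unfolding eq antisymk_def eq2 by (rule half)
  qed
  finally show "antisym_state d $$ (r, s) = kmat d d (\<lambda>p q. complex_of_real (2 / (real d * (real d - 1))) * antisymk p q) $$ (r, s)"
    using rs by (simp add: kmat_entry)
qed (simp_all add: antisym_state_def swap_op_def kmat_def)

lemma antisymk_idem: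
  assumes "p \<in> sq2 d"
  shows "(\<Sum>s\<in>sq2 d. antisymk p s * antisymk s q) = antisymk p q"
proof -
  obtain x y where p: "p = (x, y)" by (cases p)
  have "(\<Sum>s\<in>sq2 d. antisymk p s * antisymk s q) = act d antisymk (\<lambda>s. antisymk (fst s) q) x y 0"
    by (simp add: act_def p)
  also have "\<dots> = (antisymk (x, y) q - antisymk (y, x) q) / 2"
    using assms p by (simp add: act_antisymk)
  also have "\<dots> = antisymk p q" 
  proof -
    have "((a - b) / 2 - (b - a) / 2) / 2 = (a - b) / 2" for a b :: complex by (simp add: field_simps)
    then show ?thesis unfolding p antisymk_left .
  qed
  finally show ?thesis .
qed

lemma hform_delta: "finite I \<Longrightarrow> hform I (\<lambda>p q. if p = q then 1 else 0) f = (\<Sum>p\<in>I. cnj (f p) * f p)"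
  unfolding hform_def by (intro sum.cong refl) (simp add: if_distrib if_distribR cong: if_cong)

lemma psdk_delta: "finite I \<Longrightarrow> psdk I (\<lambda>p q. if p = q then 1 else 0)"
  unfolding psdk_def by (simp add: hform_delta sum_nonneg cnj_mult_self_nonneg)

lemma psdk_antisymk: "psdk (sq2 d) antisymk"
  unfolding psdk_def hform_antisymk by (intro allI sum_nonneg cnj_mult_self_nonneg)

text \<open>The complement is the symmetric projector: its form at f is the squared norm of the
  symmetrized vector.\<close>

lemma psdk_delta_minus_antisymk: "psdk (sq2 d) (\<lambda>p q. (if p = q then 1 else 0) - antisymk p q)"
  unfolding psdk_def
proof
  fix f :: "nat \<times> nat \<Rightarrow> complex"
  have 1: "hform (sq2 d) (\<lambda>p q. if p = q then 1 else 0) f = (\<Sum>x<d. \<Sum>y<d. cnj (f (x, y)) * f (x, y))"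
    by (simp add: hform_delta sum.cartesian_product')
  then have 2: "hform (sq2 d) (\<lambda>p q. if p = q then 1 else 0) f = (\<Sum>x<d. \<Sum>y<d. cnj (f (y, x)) * f (y, x))"
    by (subst sum.swap)
  have "hform (sq2 d) (\<lambda>p q. if p = q then 1 else 0) f =
      (hform (sq2 d) (\<lambda>p q. if p = q then 1 else 0) f + hform (sq2 d) (\<lambda>p q. if p = q then 1 else 0) f) / 2" by simp
  also have "\<dots> = (\<Sum>x<d. \<Sum>y<d. (cnj (f (x, y)) * f (x, y) + cnj (f (y, x)) * f (y, x)) / 2)"
    by (subst (1) 1, subst 2) (simp only: sum.distrib sum_divide_distrib add_divide_distrib)
  finally have "hform (sq2 d) (\<lambda>p q. (if p = q then 1 else 0) - antisymk p q) f =
      (\<Sum>x<d. \<Sum>y<d. (cnj (f (x, y)) * f (x, y) + cnj (f (y, x)) * f (y, x)) / 2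
        - cnj ((f (x, y) - f (y, x)) / 2) * ((f (x, y) - f (y, x)) / 2))"
    unfolding hform_diff hform_antisymk by (simp only: sum_subtractf)
  also have "\<dots> = (\<Sum>x<d. \<Sum>y<d. cnj ((f (x, y) + f (y, x)) / 2) * ((f (x, y) + f (y, x)) / 2))"
    by (intro sum.cong refl) (simp add: field_simps)
  also have "0 \<le> \<dots>" by (intro sum_nonneg cnj_mult_self_nonneg)
  finally show "0 \<le> hform (sq2 d) (\<lambda>p q. (if p = q then 1 else 0) - antisymk p q) f" .
qed

definition antisym_proj :: "nat \<Rightarrow> nat \<Rightarrow> op" where
  "antisym_proj d n = kmat (d ^ n) (d ^ n) (pow2 d d antisymk n)"

lemma antisym_proj_carrier: "antisym_proj d n \<in> carrier_mat (d ^ n * d ^ n) (d ^ n * d ^ n)"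
  unfolding antisym_proj_def by (rule kmat_carrier)

lemma antisym_power:
  assumes "d > 0"
  shows "bip_power d d (antisym_state d) n = complex_of_real ((2 / (real d * (real d - 1))) ^ n) \<cdot>\<^sub>m antisym_proj d n"
  unfolding antisym_state_kmat[OF assms] bip_power_kmat[OF assms assms] kpw_scale antisym_proj_def
  by (intro eq_matI) (auto simp: kmat_def)

lemma antisym_proj_idem:
  assumes "d > 0"
  shows "antisym_proj d n * antisym_proj d n = antisym_proj d n"
proof -
  have "antisym_proj d n * antisym_proj d n = kmat (d ^ n) (d ^ n) (pow2 d d (\<lambda>p q. \<Sum>s\<in>sq2 d. antisymk p s * antisymk s q) n)"
    unfolding antisym_proj_def using assms
    by (simp only: kmat_mult zero_less_power kpw_compose[OF splitting2[OF assms assms]])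
  also have "\<dots> = antisym_proj d n" unfolding antisym_proj_def
    using assms by (intro kmat_cong kpw_cong[OF splitting2[OF assms assms]]) (auto simp: antisymk_idem)
  finally show ?thesis .
qed

lemma antisym_state_trace:
  assumes "d > 1"
  shows "mtrace (antisym_state d) = 1"
proof -
  have "(\<Sum>p\<in>sq2 d. antisymk p p) = (\<Sum>x<d. \<Sum>y<d. (1 - (if y = x then 1 else 0)) / 2)"
    unfolding sum.cartesian_product' by (intro sum.cong refl) (simp add: antisymk_left)
  also have "\<dots> = of_nat d * (of_nat d - 1) / 2"
    by (simp add: sum_subtractf flip: sum_divide_distrib)
  finally have s: "(\<Sum>p\<in>sq2 d. antisymk p p) = of_nat d * (of_nat d - 1) / 2" .
  have "mtrace (antisym_state d) = complex_of_real (2 / (real d * (real d - 1))) * (\<Sum>p\<in>sq2 d. antisymk p p)"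
    using assms by (simp add: antisym_state_kmat mtrace_kmat sum_distrib_left)
  also have "\<dots> = complex_of_real (2 / (real d * (real d - 1)) * (real d * (real d - 1) / 2))"
    unfolding s by simp
  also have "2 / (real d * (real d - 1)) * (real d * (real d - 1) / 2) = 1" using assms by simp
  finally show ?thesis by simp
qed

lemma antisym_state_carrier: "antisym_state d \<in> carrier_mat (d * d) (d * d)"
  unfolding antisym_state_def by (intro smult_carrier_mat minus_carrier_mat) (simp add: swap_op_def)

lemma antisym_power_trace:
  assumes "d > 1"
  shows "mtrace (bip_power d d (antisym_state d) n) = 1"
  using mtrace_bip_power[OF _ _ antisym_state_carrier, of d n] assms by (simp add: antisym_state_trace)

lemma antisym_proj_power:
  assumes "d > 1"
  shows "antisym_proj d n * bip_power d d (antisym_state d) n = bip_power d d (antisym_state d) n"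
  using assms antisym_proj_carrier[of d n] antisym_proj_idem[of d n]
  by (simp add: antisym_power mult_smult_distrib[of _ "d ^ n * d ^ n" "d ^ n * d ^ n"])

text \<open>For the second claim, the identity dominates the antisymmetric projector in absolute
  value on one copy, and the powers of the identity are identities.\<close>

lemma antisym_proj_psd:
  assumes "d > 0"
  shows "psd (d ^ n * d ^ n) (antisym_proj d n)"
    and "psd (d ^ n * d ^ n) (1\<^sub>m (d ^ n * d ^ n) - antisym_proj d n)"
proof -
  show "psd (d ^ n * d ^ n) (antisym_proj d n)" unfolding antisym_proj_def
    using assms by (intro psd_kmat kpw_psd[OF splitting2[OF assms assms] psdk_antisymk]) simp
  have "psdk (sq2 d) (\<lambda>p q. (if p = q then 1 else 0) + antisymk p q)"
    by (intro psdk_add psdk_delta psdk_antisymk) simp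
  from kpw_dominated[OF splitting2[OF assms assms] this psdk_delta_minus_antisymk]
  have 1: "psdk (sq2 (d ^ n)) (\<lambda>p q. pow2 d d (\<lambda>p q. if p = q then 1 else 0) n p q - pow2 d d antisymk n p q)" by blast
  have delta: "p \<in> sq2 (d ^ n) \<Longrightarrow> q \<in> sq2 (d ^ n) \<Longrightarrow>
      pow2 d d (\<lambda>p q. if p = q then 1 else 0) n p q = (if p = q then 1 else 0)" for p q
  proof (induction n arbitrary: p q)
    case 0
    then show ?case by auto
  next
    case (Suc n)
    have r: "tp2 d d n s \<in> sq2 (d ^ n)" for s using assms by (cases s) simp
    have "p = q \<longleftrightarrow> hp2 d d n p = hp2 d d n q \<and> tp2 d d n p = tp2 d d n q"
      using eq_iff_div_mod[of "fst p" "fst q" "d ^ n"] eq_iff_div_mod[of "snd p" "snd q" "d ^ n"]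
      by (cases p; cases q) auto
    then show ?case unfolding kpw.simps Suc.IH[OF r r] by simp
  qed
  have "1\<^sub>m (d ^ n * d ^ n) - antisym_proj d n = kmat (d ^ n) (d ^ n) (\<lambda>p q. (if p = q then 1 else 0) - pow2 d d antisymk n p q)"
  proof (rule eq_matI)
    fix r s assume "r < dim_row (kmat (d ^ n) (d ^ n) (\<lambda>p q. (if p = q then 1 else 0) - pow2 d d antisymk n p q))"
      "s < dim_col (kmat (d ^ n) (d ^ n) (\<lambda>p q. (if p = q then 1 else 0) - pow2 d d antisymk n p q))"
    then have rs: "r < d ^ n * d ^ n" "s < d ^ n * d ^ n" by (simp_all add: kmat_def)
    have eq: "r = s \<longleftrightarrow> (r div d ^ n, r mod d ^ n) = (s div d ^ n, s mod d ^ n)" using eq_iff_div_mod[of r s "d ^ n"] by simp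
    have "(1\<^sub>m (d ^ n * d ^ n) - antisym_proj d n) $$ (r, s) = (if r = s then 1 else 0) - antisym_proj d n $$ (r, s)"
      using rs antisym_proj_carrier[of d n] by simp
    also have "\<dots> = kmat (d ^ n) (d ^ n) (\<lambda>p q. (if p = q then 1 else 0) - pow2 d d antisymk n p q) $$ (r, s)"
      unfolding eq antisym_proj_def kmat_entry[OF rs] ..
    finally show "(1\<^sub>m (d ^ n * d ^ n) - antisym_proj d n) $$ (r, s) =
        kmat (d ^ n) (d ^ n) (\<lambda>p q. (if p = q then 1 else 0) - pow2 d d antisymk n p q) $$ (r, s)" .
  qed (simp_all add: kmat_def antisym_proj_def)
  also have "\<dots> = kmat (d ^ n) (d ^ n) (\<lambda>p q. pow2 d d (\<lambda>p q. if p = q then 1 else 0) n p q - pow2 d d antisymk n p q)"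
    using assms by (intro kmat_cong) (auto simp: delta)
  finally show "psd (d ^ n * d ^ n) (1\<^sub>m (d ^ n * d ^ n) - antisym_proj d n)"
    using psd_kmat[OF _ 1] assms by simp
qed

lemma antisym_power_psd:
  assumes "d > 1"
  shows "psd (d ^ n * d ^ n) (bip_power d d (antisym_state d) n)"
proof -
  have "psdk {..<d ^ n * d ^ n} (\<lambda>i j. complex_of_real ((2 / (real d * (real d - 1))) ^ n) * antisym_proj d n $$ (i, j))"
    using assms antisym_proj_psd(1)[of d n] by (intro psdk_scale) (auto simp: psd_iff_psdk)
  then have "psdk {..<d ^ n * d ^ n} (\<lambda>i j. bip_power d d (antisym_state d) n $$ (i, j))"
    by (rule psdk_cong[THEN iffD1, rotated]) (use assms antisym_proj_carrier[of d n] in \<open>simp add: antisym_power\<close>)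
  then show ?thesis using bip_power_carrier by (auto simp: psd_iff_psdk)
qed

lemma antisym_proj_separable_overlap:
  assumes d: "d \<ge> 7" and X: "sepc (d ^ n) (d ^ n) X"
  shows "Re (mtrace (antisym_proj d n * X)) \<le> ((real d - 1) / (real d + 2)) ^ n * Re (mtrace X)"
proof (rule sepc_expectation_le[OF X antisym_proj_carrier])
  show "0 < d ^ n" using d by simp
  fix u v
  show "Re (hform {..<d ^ n * d ^ n} (\<lambda>r c. antisym_proj d n $$ (r, c)) (pv (d ^ n) u v))
      \<le> ((real d - 1) / (real d + 2)) ^ n * (nrm2 (d ^ n) u * nrm2 (d ^ n) v)"
    unfolding antisym_proj_def nrm2_def using antisym_power_product_overlap[OF d, of n u v] d
    by (simp add: hform_kmat)
qed

section \<open>The symmetric state and the comparison on separable operators\<close>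

definition sym_state :: "nat \<Rightarrow> op" where
  "sym_state d = kmat d d (\<lambda>p q. complex_of_real (2 / (real d * (real d + 1))) * symmk p q)"

lemma sym_state_trace:
  assumes "d > 0"
  shows "mtrace (sym_state d) = 1"
proof -
  have "(\<Sum>p\<in>sq2 d. symmk p p) = (\<Sum>x<d. \<Sum>y<d. (1 + (if y = x then 1 else 0)) / 2)"
    unfolding sum.cartesian_product' by (intro sum.cong refl) (auto simp: symmk_def)
  also have "\<dots> = of_nat d * (of_nat d + 1) / 2"
    by (simp add: sum.distrib flip: sum_divide_distrib)
  finally have s: "(\<Sum>p\<in>sq2 d. symmk p p) = of_nat d * (of_nat d + 1) / 2" .
  have "mtrace (sym_state d) = complex_of_real (2 / (real d * (real d + 1))) * (\<Sum>p\<in>sq2 d. symmk p p)"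
    using assms by (simp add: sym_state_def mtrace_kmat sum_distrib_left)
  also have "\<dots> = complex_of_real (2 / (real d * (real d + 1)) * (real d * (real d + 1) / 2))"
    unfolding s by simp
  also have "2 / (real d * (real d + 1)) * (real d * (real d + 1) / 2) = 1" using assms by simp
  finally show ?thesis by simp
qed

lemma sym_power_sepc:
  assumes "d > 0"
  shows "sepc (d ^ n) (d ^ n) (bip_power d d (sym_state d) n)"
  unfolding sym_state_def by (intro sepc_bip_power sepc_symmetric assms) simp

lemma sym_power_trace:
  assumes "d > 0"
  shows "mtrace (bip_power d d (sym_state d) n) = 1"
proof -
  have "sym_state d \<in> carrier_mat (d * d) (d * d)" by (simp add: sym_state_def kmat_carrier)
  then show ?thesis using mtrace_bip_power[of d d "sym_state d" n] assms by (simp add: sym_state_trace)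
qed

text \<open>
  Partial transposition on B turns 1 into itself and F into an unnormalized maximally entangled
  projector, so the partial transpose of 1 + F dominates that of 1 - F in absolute value.
\<close>

lemma antisym_le_sym_product:
  assumes d: "d > 0"
  shows "Re (hform (sq2 (d ^ n)) (pow2 d d antisymk n) (\<lambda>p. u (fst p) * v (snd p))) \<le>
    Re (hform (sq2 (d ^ n)) (pow2 d d symmk n) (\<lambda>p. u (fst p) * v (snd p)))"
proof -
  have "transpose_snd symmk p q + transpose_snd antisymk p q = (if p = q then 1 else 0)" for p q
  proof -
    have "(fst p, snd q) = (fst q, snd p) \<longleftrightarrow> p = q" by (cases p; cases q) auto
    then show ?thesis by (simp add: transpose_snd_def symmk_def antisymk_def)
  qed
  then have 1: "psdk (sq2 d) (\<lambda>p q. transpose_snd symmk p q + transpose_snd antisymk p q)"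
    using psdk_delta[of "sq2 d"] by simp
  have "transpose_snd symmk p q - transpose_snd antisymk p q = of_bool (fst p = snd p) * cnj (of_bool (fst q = snd q))" for p q
  proof -
    have e: "(fst p, snd q) = (snd (fst q, snd p), fst (fst q, snd p)) \<longleftrightarrow> fst p = snd p \<and> fst q = snd q"
      by (cases p; cases q) auto
    have "(x + (if A \<and> B then 1 else 0)) / 2 - (x - (if A \<and> B then 1 else 0)) / 2 = of_bool A * cnj (of_bool B)"
      for x :: complex and A B by (simp add: field_simps)
    then show ?thesis unfolding transpose_snd_def symmk_def antisymk_def e .
  qed
  then have 2: "psdk (sq2 d) (\<lambda>p q. transpose_snd symmk p q - transpose_snd antisymk p q)"
    using psdk_rank_one[of "sq2 d" "\<lambda>p. of_bool (fst p = snd p)"] by simp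
  have "psdk (sq2 (d ^ n)) (\<lambda>p q. pow2 d d (transpose_snd symmk) n p q - pow2 d d (transpose_snd antisymk) n p q)"
    using kpw_dominated[OF splitting2[OF d d] 1 2] by blast
  then have "0 \<le> hform (sq2 (d ^ n)) (pow2 d d (transpose_snd symmk) n) (\<lambda>p. u (fst p) * cnj (v (snd p)))
      - hform (sq2 (d ^ n)) (pow2 d d (transpose_snd antisymk) n) (\<lambda>p. u (fst p) * cnj (v (snd p)))"
    unfolding psdk_def hform_diff by blast
  moreover have "hform (sq2 (d ^ n)) (pow2 d d (transpose_snd K) n) (\<lambda>p. u (fst p) * cnj (v (snd p))) =
      hform (sq2 (d ^ n)) (pow2 d d K n) (\<lambda>p. u (fst p) * v (snd p))" for K
    unfolding hform_transpose_snd[symmetric] by (intro hform_cong kpw_transpose_snd refl)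
  ultimately show ?thesis by (simp add: less_eq_complex_def)
qed

text \<open>Between the powers of the projectors the comparison holds with constant 1. The factor is
  the ratio of the normalizations 2/(d(d - 1)) and 2/(d(d + 1)), once per copy.\<close>

lemma antisym_power_le_sym_power:
  assumes d: "d > 1" and X: "sepc (d ^ n) (d ^ n) X"
  shows "Re (mtrace (bip_power d d (antisym_state d) n * X)) \<le>
    ((real d + 1) / (real d - 1)) ^ n * Re (mtrace (bip_power d d (sym_state d) n * X))"
proof -
  define N where "N = d ^ n"
  have d0: "d > 0" and N: "N > 0" using d by (simp_all add: N_def)
  define k1 where "k1 = (2 / (real d * (real d - 1))) ^ n"
  define k2 where "k2 = (2 / (real d * (real d + 1))) ^ n"
  have "2 / (x * y) = z / y * (2 / (x * z))" if "z \<noteq> 0" for x y z :: real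
    using that by (cases "x = 0"; cases "y = 0") (simp_all add: field_simps)
  from this[of "real d + 1" "real d" "real d - 1"]
  have "2 / (real d * (real d - 1)) = (real d + 1) / (real d - 1) * (2 / (real d * (real d + 1)))" by simp
  then have k: "k1 = ((real d + 1) / (real d - 1)) ^ n * k2" unfolding k1_def k2_def power_mult_distrib[symmetric] by simp
  have k1: "k1 > 0" unfolding k1_def using d by simp
  define A where "A = kmat N N (pow2 d d antisymk n)"
  define S where "S = kmat N N (pow2 d d symmk n)"
  have AS: "A \<in> carrier_mat (N * N) (N * N)" "S \<in> carrier_mat (N * N) (N * N)" by (simp_all add: A_def S_def kmat_carrier)
  have a: "bip_power d d (antisym_state d) n = complex_of_real k1 \<cdot>\<^sub>m A"
    using antisym_power[of d n] d by (simp add: k1_def A_def antisym_proj_def N_def)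
  have s: "bip_power d d (sym_state d) n = complex_of_real k2 \<cdot>\<^sub>m S"
    unfolding sym_state_def S_def N_def k2_def bip_power_kmat[OF d0 d0] kpw_scale
    by (intro eq_matI) (auto simp: kmat_def)
  have X': "X \<in> carrier_mat (N * N) (N * N)" using X by (simp add: sepc_def N_def)
  have "Re (mtrace (A * X)) \<le> Re (mtrace (S * X))"
    using X unfolding N_def[symmetric]
  proof (rule sepc_expectation_mono[OF _ AS])
    fix u v
    show "Re (hform {..<N * N} (\<lambda>r c. A $$ (r, c)) (pv N u v)) \<le> Re (hform {..<N * N} (\<lambda>r c. S $$ (r, c)) (pv N u v))"
      unfolding A_def S_def hform_kmat[OF N] using antisym_le_sym_product[OF d0, of n u v] by (simp add: N_def)
  qed
  then have "k1 * Re (mtrace (A * X)) \<le> k1 * Re (mtrace (S * X))" using k1 by simp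
  moreover have sm: "Re (mtrace ((complex_of_real c \<cdot>\<^sub>m Y) * X)) = c * Re (mtrace (Y * X))"
    if "Y \<in> carrier_mat (N * N) (N * N)" for c Y
  proof -
    have "mtrace ((complex_of_real c \<cdot>\<^sub>m Y) * X) = complex_of_real c * mtrace (Y * X)"
      using that X' by (simp add: mtrace_mult[of _ "N * N" "N * N"] sum_distrib_left mult.assoc)
    then show ?thesis by simp
  qed
  ultimately show ?thesis unfolding a s sm[OF AS(1)] sm[OF AS(2)] mult.assoc[symmetric] k[symmetric] by simp
qed

section \<open>Linear maps and their adjoints\<close>

lemma mtrace_add_right:
  assumes "X \<in> carrier_mat n n" "A \<in> carrier_mat n n" "B \<in> carrier_mat n n"
  shows "mtrace (X * (A + B)) = mtrace (X * A) + mtrace (X * B)"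
  using assms by (simp add: mtrace_mult[of _ n n] sum.distrib distrib_left)

lemma mtrace_smult_right:
  assumes "X \<in> carrier_mat n n" "A \<in> carrier_mat n n"
  shows "mtrace (X * (c \<cdot>\<^sub>m A)) = c * mtrace (X * A)"
  using assms by (simp add: mtrace_mult[of _ n n] sum_distrib_left mult_ac)

lemma mtrace_add_left:
  assumes "X \<in> carrier_mat n n" "A \<in> carrier_mat n n" "B \<in> carrier_mat n n"
  shows "mtrace ((A + B) * X) = mtrace (A * X) + mtrace (B * X)"
  using assms by (simp add: mtrace_mult[of _ n n] sum.distrib distrib_right)

lemma mtrace_smult_left:
  assumes "X \<in> carrier_mat n n" "A \<in> carrier_mat n n"
  shows "mtrace ((c \<cdot>\<^sub>m A) * X) = c * mtrace (A * X)"
  using assms by (simp add: mtrace_mult[of _ n n] sum_distrib_left mult_ac)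

definition unit_mat :: "nat \<Rightarrow> nat \<Rightarrow> nat \<Rightarrow> op" where
  "unit_mat n i j = mat n n (\<lambda>(r, c). if r = i \<and> c = j then 1 else 0)"

lemma unit_mat_carrier: "unit_mat n i j \<in> carrier_mat n n"
  by (simp add: unit_mat_def)

lemma mtrace_mult_unit_mat:
  assumes "Z \<in> carrier_mat n n" "i < n" "j < n"
  shows "mtrace (Z * unit_mat n i j) = Z $$ (j, i)"
proof -
  have "mtrace (Z * unit_mat n i j) = (\<Sum>a<n. \<Sum>b<n. if b = i then (if a = j then Z $$ (a, b) else 0) else 0)"
    unfolding mtrace_mult[OF assms(1) unit_mat_carrier]
    by (intro sum.cong refl) (simp add: unit_mat_def)
  then show ?thesis using assms by simp
qed

text \<open>Y is assembled from matrix units, one entry at a time. The values on matrix units will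
  be the entries of the adjoint.\<close>

lemma linear_op_map_functional:
  assumes lin: "linear_op_map n m \<Xi>" and X: "X \<in> carrier_mat m m" and Y: "Y \<in> carrier_mat n n"
  shows "mtrace (X * \<Xi> Y) = (\<Sum>i<n. \<Sum>j<n. Y $$ (i, j) * mtrace (X * \<Xi> (unit_mat n i j)))"
proof -
  have car: "\<Xi> A \<in> carrier_mat m m" if "A \<in> carrier_mat n n" for A using lin that by (simp add: linear_op_map_def)
  define YS where "YS S = mat n n (\<lambda>rc. if rc \<in> S then Y $$ rc else 0)" for S
  have YSc: "YS S \<in> carrier_mat n n" for S by (simp add: YS_def)
  have "mtrace (X * \<Xi> (YS S)) = (\<Sum>p\<in>S. Y $$ p * mtrace (X * \<Xi> (unit_mat n (fst p) (snd p))))"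
    if "finite S" "S \<subseteq> {..<n} \<times> {..<n}" for S
    using that
  proof (induction S)
    case empty
    have "\<forall>c. \<forall>X\<in>carrier_mat n n. \<Xi> (c \<cdot>\<^sub>m X) = c \<cdot>\<^sub>m \<Xi> X" using lin by (simp add: linear_op_map_def)
    from this[rule_format, of "0\<^sub>m n n" 0] have "\<Xi> (0 \<cdot>\<^sub>m 0\<^sub>m n n) = 0 \<cdot>\<^sub>m \<Xi> (0\<^sub>m n n)" by (simp only: zero_carrier_mat)
    moreover have "YS {} = 0 \<cdot>\<^sub>m 0\<^sub>m n n" by (intro eq_matI) (auto simp: YS_def)
    ultimately have "\<Xi> (YS {}) = 0 \<cdot>\<^sub>m \<Xi> (0\<^sub>m n n)" by (simp only:)
    then show ?case using mtrace_smult_right[OF X car, of "0\<^sub>m n n" 0] by simp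
  next
    case (insert p S)
    have p: "fst p < n" "snd p < n" using insert.prems by auto
    have "YS (insert p S) = YS S + Y $$ p \<cdot>\<^sub>m unit_mat n (fst p) (snd p)"
      using insert.hyps by (intro eq_matI) (auto simp: YS_def unit_mat_def)
    then have "\<Xi> (YS (insert p S)) = \<Xi> (YS S) + Y $$ p \<cdot>\<^sub>m \<Xi> (unit_mat n (fst p) (snd p))"
      using lin YSc[of S] unit_mat_carrier[of n] by (simp add: linear_op_map_def)
    moreover have "mtrace (X * (\<Xi> (YS S) + Y $$ p \<cdot>\<^sub>m \<Xi> (unit_mat n (fst p) (snd p)))) =
        mtrace (X * \<Xi> (YS S)) + Y $$ p * mtrace (X * \<Xi> (unit_mat n (fst p) (snd p)))"
      using X car[OF YSc] car[OF unit_mat_carrier]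
      by (simp add: mtrace_add_right[of _ m] mtrace_smult_right[of _ m])
    ultimately show ?case using insert by simp
  qed
  from this[of "{..<n} \<times> {..<n}"]
  have "mtrace (X * \<Xi> (YS ({..<n} \<times> {..<n}))) = (\<Sum>p\<in>{..<n} \<times> {..<n}. Y $$ p * mtrace (X * \<Xi> (unit_mat n (fst p) (snd p))))"
    by simp
  moreover have "YS ({..<n} \<times> {..<n}) = Y" using Y by (intro eq_matI) (auto simp: YS_def)
  ultimately show ?thesis by (simp add: sum.cartesian_product')
qed

text \<open>\<open>adjoint_map\<close> is a definite description; testing against matrix units reads
  off every entry and gives uniqueness.\<close>

lemma adjoint_map_eqI:
  assumes Z: "Z \<in> carrier_mat n n" and eq: "\<And>Y. Y \<in> carrier_mat n n \<Longrightarrow> mtrace (X * \<Xi> Y) = mtrace (Z * Y)"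
  shows "adjoint_map n \<Xi> X = Z"
  unfolding adjoint_map_def
proof (rule the_equality)
  show "Z \<in> carrier_mat n n \<and> (\<forall>Y\<in>carrier_mat n n. mtrace (X * \<Xi> Y) = mtrace (Z * Y))" using assms by blast
  fix Z' assume Z': "Z' \<in> carrier_mat n n \<and> (\<forall>Y\<in>carrier_mat n n. mtrace (X * \<Xi> Y) = mtrace (Z' * Y))"
  have "Z' $$ (j, i) = Z $$ (j, i)" if "i < n" "j < n" for i j
    using Z' Z eq[OF unit_mat_carrier, of i j] that mtrace_mult_unit_mat[of Z' n i j] mtrace_mult_unit_mat[of Z n i j]
      unit_mat_carrier[of n i j] by metis
  then show "Z' = Z" using Z' Z by (intro eq_matI) auto
qed

lemma adjoint_map_trace:
  assumes lin: "linear_op_map n m \<Xi>" and X: "X \<in> carrier_mat m m"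
  shows "adjoint_map n \<Xi> X \<in> carrier_mat n n"
    and "Y \<in> carrier_mat n n \<Longrightarrow> mtrace (X * \<Xi> Y) = mtrace (adjoint_map n \<Xi> X * Y)"
proof -
  define Z where "Z = mat n n (\<lambda>(j, i). mtrace (X * \<Xi> (unit_mat n i j)))"
  have Z: "Z \<in> carrier_mat n n" by (simp add: Z_def)
  have eq: "mtrace (X * \<Xi> Y) = mtrace (Z * Y)" if Y: "Y \<in> carrier_mat n n" for Y
  proof -
    have "mtrace (Z * Y) = (\<Sum>j<n. \<Sum>i<n. Y $$ (i, j) * mtrace (X * \<Xi> (unit_mat n i j)))"
      unfolding mtrace_mult[OF Z Y] by (intro sum.cong refl) (simp add: Z_def)
    also have "\<dots> = (\<Sum>i<n. \<Sum>j<n. Y $$ (i, j) * mtrace (X * \<Xi> (unit_mat n i j)))" by (rule sum.swap)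
    finally show ?thesis using linear_op_map_functional[OF lin X Y] by simp
  qed
  have "adjoint_map n \<Xi> X = Z" using Z eq by (rule adjoint_map_eqI)
  then show "adjoint_map n \<Xi> X \<in> carrier_mat n n"
    and "Y \<in> carrier_mat n n \<Longrightarrow> mtrace (X * \<Xi> Y) = mtrace (adjoint_map n \<Xi> X * Y)"
    using Z eq by simp_all
qed

section \<open>Channels\<close>

text \<open>The case k = 1 of complete positivity, where the single block is X itself.\<close>

lemma completely_positive_psd:
  assumes "completely_positive n m \<Xi>" "psd n X" "m > 0"
  shows "psd m (\<Xi> X)"
proof -
  have X: "X \<in> carrier_mat n n" using assms(2) by (simp add: psd_def)
  have car: "\<Xi> X \<in> carrier_mat m m" using assms(1) X by (simp add: completely_positive_def linear_op_map_def)
  have "psd (1 * m) (ampliation 1 n m \<Xi> X)"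
    using assms unfolding completely_positive_def by (metis mult_1)
  moreover have "ampliation 1 n m \<Xi> X = \<Xi> X"
  proof (rule eq_matI)
    fix r c assume "r < dim_row (\<Xi> X)" "c < dim_col (\<Xi> X)"
    then have rc: "r < m" "c < m" using car by auto
    then have "mat n n (\<lambda>(i, j). X $$ (r div m * n + i, c div m * n + j)) = X" using X by (intro eq_matI) auto
    then show "ampliation 1 n m \<Xi> X $$ (r, c) = \<Xi> X $$ (r, c)" using rc by (simp add: ampliation_def)
  qed (use car in \<open>auto simp: ampliation_def\<close>)
  ultimately show ?thesis by simp
qed

lemma psd_trace_nonneg:
  assumes "psd n A" "psd n B"
  shows "0 \<le> mtrace (A * B)"
proof -
  obtain k :: nat and g where g: "\<And>i j. i < n \<Longrightarrow> j < n \<Longrightarrow> B $$ (i, j) = (\<Sum>r<k. g r i * cnj (g r j))"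
    using psd_gram[OF assms(2)] by blast
  have "mtrace (A * B) = (\<Sum>r<k. hform {..<n} (\<lambda>r c. A $$ (r, c)) (g r))"
    using assms g by (intro gram_expectation(1)) (auto simp: psd_def)
  also have "0 \<le> \<dots>" using assms(1) by (intro sum_nonneg) (auto simp: psd_iff_psdk psdk_def)
  finally show ?thesis .
qed

text \<open>The map that traces T against each block is completely positive: with Gram vectors
  \<open>g s\<close> of T, its form at f is the sum of the forms of X at the product vectors of f
  and \<open>g s\<close>.\<close>

lemma psd_block_trace:
  assumes X: "psd (k * n) X" and T: "psd n T" and n: "n > 0"
  shows "psdk {..<k} (\<lambda>r c. mtrace (T * mat n n (\<lambda>(i, j). X $$ (r * n + i, c * n + j))))"
proof -
  have Tc: "T \<in> carrier_mat n n" using T by (simp add: psd_def)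
  obtain l :: nat and g where g: "\<And>i j. i < n \<Longrightarrow> j < n \<Longrightarrow> T $$ (i, j) = (\<Sum>r<l. g r i * cnj (g r j))"
    using psd_gram[OF T] by blast
  have entry: "mtrace (T * mat n n (\<lambda>(i, j). X $$ (r * n + i, c * n + j))) =
      (\<Sum>s<l. \<Sum>j<n. \<Sum>i<n. cnj (g s j) * X $$ (r * n + j, c * n + i) * g s i)" for r c
  proof -
    have B: "mat n n (\<lambda>(i, j). X $$ (r * n + i, c * n + j)) \<in> carrier_mat n n" by simp
    have "mtrace (mat n n (\<lambda>(i, j). X $$ (r * n + i, c * n + j)) * T) =
        (\<Sum>s<l. hform {..<n} (\<lambda>i j. mat n n (\<lambda>(i, j). X $$ (r * n + i, c * n + j)) $$ (i, j)) (g s))"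
      by (rule gram_expectation(1)[OF B Tc g])
    also have "\<dots> = (\<Sum>s<l. \<Sum>j<n. \<Sum>i<n. cnj (g s j) * X $$ (r * n + j, c * n + i) * g s i)"
      by (simp add: hform_def)
    finally show ?thesis using mtrace_comm[OF Tc B] by simp
  qed
  have "hform {..<k} (\<lambda>r c. \<Sum>s<l. \<Sum>j<n. \<Sum>i<n. cnj (g s j) * X $$ (r * n + j, c * n + i) * g s i) f =
      (\<Sum>s<l. hform {..<k * n} (\<lambda>r c. X $$ (r, c)) (pv n f (g s)))" for f
  proof -
    have "hform {..<k * n} (\<lambda>r c. X $$ (r, c)) (pv n f (g s)) =
        hform {..<k} (\<lambda>r c. \<Sum>j<n. \<Sum>i<n. cnj (g s j) * X $$ (r * n + j, c * n + i) * g s i) f" for s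
    proof -
      have "hform {..<k * n} (\<lambda>r c. X $$ (r, c)) (pv n f (g s)) =
          hform {..<k * n} (\<lambda>r c. mk n X (r div n, r mod n) (c div n, c mod n)) (pv n f (g s))"
        by (simp add: mk_def)
      also have "\<dots> = (\<Sum>r<k. \<Sum>j<n. \<Sum>c<k. \<Sum>i<n. cnj (f r) * (cnj (g s j) * X $$ (r * n + j, c * n + i) * g s i) * f c)"
        unfolding hform_bipartite[OF n] by (simp add: hform_def sum.cartesian_product' mk_def mult_ac)
      also have "\<dots> = (\<Sum>r<k. \<Sum>c<k. \<Sum>j<n. \<Sum>i<n. cnj (f r) * (cnj (g s j) * X $$ (r * n + j, c * n + i) * g s i) * f c)"
        by (intro sum.cong refl sum.swap)
      finally show ?thesis by (simp add: hform_def sum_distrib_left sum_distrib_right)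
    qed
    then show ?thesis unfolding hform_sum by simp
  qed
  then show ?thesis
    unfolding entry psdk_def using X by (auto simp: psd_iff_psdk psdk_def intro!: sum_nonneg)
qed

text \<open>Measure the two-outcome test (T, S) and prepare R or Q accordingly.\<close>

definition test_map :: "op \<Rightarrow> op \<Rightarrow> op \<Rightarrow> op \<Rightarrow> op \<Rightarrow> op" where
  "test_map T R S Q X = mtrace (T * X) \<cdot>\<^sub>m R + mtrace (S * X) \<cdot>\<^sub>m Q"

lemma test_map_linear:
  assumes "T \<in> carrier_mat n n" "S \<in> carrier_mat n n" "R \<in> carrier_mat m m" "Q \<in> carrier_mat m m"
  shows "linear_op_map n m (test_map T R S Q)"
  unfolding linear_op_map_def
proof (intro conjI ballI allI)
  fix X Y :: op assume X: "X \<in> carrier_mat n n"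
  show "test_map T R S Q X \<in> carrier_mat m m" using assms by (simp add: test_map_def)
  show "test_map T R S Q (c \<cdot>\<^sub>m X) = c \<cdot>\<^sub>m test_map T R S Q X" for c
    unfolding test_map_def mtrace_smult_right[OF assms(1) X] mtrace_smult_right[OF assms(2) X]
    using assms by (intro eq_matI) (auto simp: algebra_simps)
  assume Y: "Y \<in> carrier_mat n n"
  show "test_map T R S Q (X + Y) = test_map T R S Q X + test_map T R S Q Y"
    unfolding test_map_def mtrace_add_right[OF assms(1) X Y] mtrace_add_right[OF assms(2) X Y]
    using assms by (intro eq_matI) (auto simp: algebra_simps)
qed

text \<open>The ampliated output is a sum of two tensor products, block traces of X against T or S
  times the prepared state, so positivity is that of tensor products.\<close>

lemma test_map_CPTP:
  assumes T: "psd n T" and S: "psd n S" and TS: "T + S = 1\<^sub>m n" and R: "R \<in> density m" and Q: "Q \<in> density m"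
    and n: "n > 0" and m: "m > 0"
  shows "test_map T R S Q \<in> CPTP n m"
proof -
  have car: "T \<in> carrier_mat n n" "S \<in> carrier_mat n n" "R \<in> carrier_mat m m" "Q \<in> carrier_mat m m"
    using assms by (auto simp: psd_def density_def)
  have tr: "mtrace R = 1" "mtrace Q = 1" using R Q by (auto simp: density_def)
  have "psd (k * m) (ampliation k n m (test_map T R S Q) X)" if X: "psd (k * n) X" for k X
  proof -
    define B where "B r c = mat n n (\<lambda>(i, j). X $$ (r * n + i, c * n + j))" for r c
    have one: "psdk {..<k * m} (\<lambda>r c. mtrace (A * B (r div m) (c div m)) * C $$ (r mod m, c mod m))"
      if A: "psd n A" and C: "psd m C" for A C
    proof -
      have "psdk ({..<k} \<times> {..<m}) (\<lambda>s t. mtrace (A * B (fst s) (fst t)) * C $$ (snd s, snd t))"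
        using psd_block_trace[OF X A n] C unfolding B_def
        by (intro psdk_tensor[of _ "\<lambda>r c. mtrace (A * mat n n (\<lambda>(i, j). X $$ (r * n + i, c * n + j)))" _ "\<lambda>r c. C $$ (r, c)"])
          (auto simp: psd_iff_psdk)
      from psdk_reindex[OF bij_betw_div_mod[OF m], THEN iffD2, OF this] show ?thesis by simp
    qed
    have "psdk {..<k * m} (\<lambda>r c. mtrace (T * B (r div m) (c div m)) * R $$ (r mod m, c mod m) +
        mtrace (S * B (r div m) (c div m)) * Q $$ (r mod m, c mod m))"
      using T S R Q by (intro psdk_add one) (auto simp: density_def)
    then have "psdk {..<k * m} (\<lambda>r c. ampliation k n m (test_map T R S Q) X $$ (r, c))"
      by (rule psdk_cong[THEN iffD1, rotated]) (use m car in \<open>auto simp: ampliation_def test_map_def B_def\<close>)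
    then show ?thesis by (simp add: psd_iff_psdk ampliation_def)
  qed
  moreover have "mtrace (test_map T R S Q X) = mtrace X" if X: "X \<in> carrier_mat n n" for X
  proof -
    have "mtrace (test_map T R S Q X) = mtrace (T * X) * mtrace R + mtrace (S * X) * mtrace Q"
      using car by (simp add: test_map_def mtrace_def sum.distrib sum_distrib_left)
    also have "\<dots> = mtrace ((T + S) * X)" using tr mtrace_add_left[OF X car(1,2)] by simp
    finally show ?thesis using X by (simp add: TS)
  qed
  ultimately show ?thesis
    using test_map_linear[OF car(1,2,3,4)] by (simp add: CPTP_def completely_positive_def trace_preserving_def)
qed

section \<open>Non-entangling operations\<close>

definition max_mixed :: "nat \<Rightarrow> nat \<Rightarrow> op" where
  "max_mixed a b = complex_of_real (1 / real (a * b)) \<cdot>\<^sub>m 1\<^sub>m (a * b)"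

lemma max_mixed_separable:
  assumes "a > 0" "b > 0"
  shows "max_mixed a b \<in> separable a b"
proof (rule sepc_imp_separable[OF _ _ assms])
  have "max_mixed a b = kmat a b (\<lambda>p q. complex_of_real (1 / real (a * b)) * of_bool (p = q))"
  proof (rule eq_matI)
    fix r s assume "r < dim_row (kmat a b (\<lambda>p q. complex_of_real (1 / real (a * b)) * of_bool (p = q)))"
      "s < dim_col (kmat a b (\<lambda>p q. complex_of_real (1 / real (a * b)) * of_bool (p = q)))"
    then have rs: "r < a * b" "s < a * b" by (simp_all add: kmat_def)
    have eq: "(r div b, r mod b) = (s div b, s mod b) \<longleftrightarrow> r = s" using eq_iff_div_mod[of r s b] by simp
    show "max_mixed a b $$ (r, s) = kmat a b (\<lambda>p q. complex_of_real (1 / real (a * b)) * of_bool (p = q)) $$ (r, s)"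
      unfolding kmat_entry[OF rs] eq using rs by (simp add: max_mixed_def)
  qed (simp_all add: max_mixed_def kmat_def)
  then show "sepc a b (max_mixed a b)" using sepc_diagonal[OF assms(2), of "\<lambda>_. 1 / real (a * b)" a] by simp
  show "mtrace (max_mixed a b) = 1" using assms by (simp add: max_mixed_def mtrace_def)
qed

lemma zero_state_density:
  assumes "n > 0"
  shows "unit_mat n 0 0 \<in> density n"
proof -
  have "nrm2 n (\<lambda>i. if i = 0 then 1 else 0) = (\<Sum>i<n. if i = 0 then 1 else 0)"
    unfolding nrm2_def by (intro sum.cong) auto
  moreover have "ket_bra (vec n (\<lambda>i. if i = 0 then 1 else 0)) = unit_mat n 0 0"
    by (intro eq_matI) (auto simp: ket_bra_def unit_mat_def)
  ultimately show ?thesis using ket_bra_density[of n "\<lambda>i. if i = 0 then 1 else 0"] assms by simp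
qed

lemma zero_state_separable:
  assumes "a > 0" "b > 0"
  shows "unit_mat (a * b) 0 0 \<in> separable a b"
proof (rule sepc_imp_separable[OF _ _ assms])
  show "sepc a b (unit_mat (a * b) 0 0)"
  proof (rule sepcI[of "{0::nat}" _ _ _ "\<lambda>_. 1" "\<lambda>_ x. of_bool (x = 0)" "\<lambda>_ x. of_bool (x = 0)"])
    fix r s assume rs: "r < a * b" "s < a * b"
    have z: "t = 0 \<longleftrightarrow> t div b = 0 \<and> t mod b = 0" for t using eq_iff_div_mod[of t 0 b] by simp
    show "unit_mat (a * b) 0 0 $$ (r, s) = (\<Sum>j\<in>{0::nat}. complex_of_real 1 *
      (pv b (\<lambda>x. of_bool (x = 0)) (\<lambda>x. of_bool (x = 0)) r * cnj (pv b (\<lambda>x. of_bool (x = 0)) (\<lambda>x. of_bool (x = 0)) s)))"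
      using rs z[of r] z[of s] by (simp add: unit_mat_def pv_def)
  qed (simp_all add: unit_mat_carrier)
  show "mtrace (unit_mat (a * b) 0 0) = 1"
    using zero_state_density[of "a * b"] assms by (simp add: density_def)
qed

text \<open>Discards the input and prepares |0><0|, written as a trivial test so that
  \<open>test_map_CPTP\<close> applies. It shows that NE and DNE are nonempty, so that the infima in
  the yield are over nonempty sets, and it makes m = 0 achievable.\<close>

definition trace_out :: "nat \<Rightarrow> nat \<Rightarrow> op \<Rightarrow> op" where
  "trace_out n m = test_map (1\<^sub>m n) (unit_mat m 0 0) (0\<^sub>m n n) (unit_mat m 0 0)"

lemma trace_out_eq:
  assumes "X \<in> carrier_mat n n"
  shows "trace_out n m X = mtrace X \<cdot>\<^sub>m unit_mat m 0 0"
proof -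
  have "mtrace (0\<^sub>m n n :: op) = 0" by (simp add: mtrace_def)
  then show ?thesis
    using assms unit_mat_carrier[of m 0 0] unfolding trace_out_def test_map_def by (intro eq_matI) auto
qed

text \<open>The adjoint sends X to its expectation in |00> times the identity, which is a
  nonnegative multiple of the separable state \<open>max_mixed\<close>.\<close>

lemma trace_out_DNE:
  assumes "a > 0" "b > 0" "a' > 0" "b' > 0"
  shows "trace_out (a * b) (a' * b') \<in> DNE a b a' b'"
proof -
  have psd01: "psd n (1\<^sub>m n)" "psd n (0\<^sub>m n n)" for n
  proof -
    have "psdk {..<n} (\<lambda>i j. 1\<^sub>m n $$ (i, j))"
      by (rule psdk_cong[THEN iffD1, OF _ psdk_delta]) auto
    then show "psd n (1\<^sub>m n)" by (simp add: psd_iff_psdk)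
    show "psd n (0\<^sub>m n n)" by (auto simp: psd_iff_psdk psdk_def hform_def)
  qed
  have ab: "a * b > 0" "a' * b' > 0" using assms by simp_all
  have CPTP: "trace_out (a * b) (a' * b') \<in> CPTP (a * b) (a' * b')"
    unfolding trace_out_def using ab by (intro test_map_CPTP psd01 zero_state_density) auto
  have NE: "trace_out (a * b) (a' * b') X \<in> separable a' b'" if "X \<in> separable a b" for X
  proof -
    have "X \<in> carrier_mat (a * b) (a * b)" "mtrace X = 1"
      using separable_imp_sepc[OF that assms(1,2)] by (auto simp: sepc_def)
    then have "trace_out (a * b) (a' * b') X = unit_mat (a' * b') 0 0"
      using unit_mat_carrier[of "a' * b'" 0 0] by (subst trace_out_eq) (auto intro!: eq_matI)
    then show ?thesis using zero_state_separable[OF assms(3,4)] by simp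
  qed
  have "adjoint_map (a * b) (trace_out (a * b) (a' * b')) X \<in> state_cone (separable a b)" if "X \<in> separable a' b'" for X
  proof -
    have X: "sepc a' b' X" using separable_imp_sepc[OF that assms(3,4)] by simp
    then have Xp: "psd (a' * b') X" and Xc: "X \<in> carrier_mat (a' * b') (a' * b')" by (auto simp: sepc_psd sepc_def)
    have x00: "X $$ (0, 0) = mtrace (X * unit_mat (a' * b') 0 0)"
      using mtrace_mult_unit_mat[OF Xc ab(2) ab(2)] by simp
    have "0 \<le> X $$ (0, 0)" unfolding x00
      using zero_state_density[OF ab(2)] by (intro psd_trace_nonneg[OF Xp]) (auto simp: density_def)
    then have x: "X $$ (0, 0) = complex_of_real (Re (X $$ (0, 0)))" "0 \<le> Re (X $$ (0, 0))"
      by (auto simp: less_eq_complex_def complex_eq_iff)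
    have "adjoint_map (a * b) (trace_out (a * b) (a' * b')) X = X $$ (0, 0) \<cdot>\<^sub>m 1\<^sub>m (a * b)"
    proof (rule adjoint_map_eqI)
      fix Y :: op assume Y: "Y \<in> carrier_mat (a * b) (a * b)"
      show "mtrace (X * trace_out (a * b) (a' * b') Y) = mtrace ((X $$ (0, 0) \<cdot>\<^sub>m 1\<^sub>m (a * b)) * Y)"
        unfolding trace_out_eq[OF Y] mtrace_smult_right[OF Xc unit_mat_carrier] mtrace_smult_left[OF Y one_carrier_mat]
          x00[symmetric] using Y by simp
    qed simp
    also have "\<dots> = complex_of_real (Re (X $$ (0, 0)) * real (a * b)) \<cdot>\<^sub>m max_mixed a b"
      unfolding max_mixed_def using x(1) assms by (intro eq_matI) auto
    finally show ?thesis unfolding state_cone_def using x(2) max_mixed_separable[OF assms(1,2)]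
      by (intro CollectI exI[of _ "Re (X $$ (0, 0)) * real (a * b)"] exI[of _ "max_mixed a b"]) simp
  qed
  then show ?thesis using CPTP NE by (auto simp: DNE_def NE_def)
qed

lemma state_cone_sepc:
  assumes "X \<in> state_cone (separable a b)" "a > 0" "b > 0"
  shows "sepc a b X"
  using assms separable_imp_sepc unfolding state_cone_def by (auto intro: sepc_scale)

section \<open>The target state\<close>

definition phi :: "nat \<Rightarrow> nat \<Rightarrow> complex" where
  "phi m r = complex_of_real (1 / sqrt (2 ^ m)) * of_bool (r div 2 ^ m = r mod 2 ^ m)"

abbreviation Phi :: "nat \<Rightarrow> op" where
  "Phi m \<equiv> bip_power 2 2 Phi2 m"

lemma Phi_carrier: "Phi m \<in> carrier_mat (2 ^ m * 2 ^ m) (2 ^ m * 2 ^ m)"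
  by (rule bip_power_carrier)

lemma Phi_rank_one:
  assumes "r < 2 ^ m * 2 ^ m" "s < 2 ^ m * 2 ^ m"
  shows "Phi m $$ (r, s) = phi m r * cnj (phi m s)"
proof -
  have sq: "complex_of_real (1 / sqrt (2 ^ m)) * complex_of_real (1 / sqrt (2 ^ m)) = 1 / 2 ^ m"
    by (simp flip: of_real_mult)
  have "phi m r * cnj (phi m s) = (complex_of_real (1 / sqrt (2 ^ m)) * complex_of_real (1 / sqrt (2 ^ m))) *
      (of_bool (r div 2 ^ m = r mod 2 ^ m) * of_bool (s div 2 ^ m = s mod 2 ^ m))"
    unfolding phi_def by simp
  also have "\<dots> = Phi m $$ (r, s)"
    unfolding sq Phi2_power kmat_entry[OF assms] maxent_def by simp
  finally show ?thesis by (rule sym)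
qed

lemma phi_norm: "nrm2 (2 ^ m * 2 ^ m) (phi m) = 1"
proof -
  have c: "(cmod (complex_of_real (1 / sqrt (2 ^ m)) * of_bool B))\<^sup>2 = (if B then 1 / 2 ^ m else 0)" for B
    by (cases B) (simp_all add: norm_mult norm_divide power_divide)
  have "nrm2 (2 ^ m * 2 ^ m) (phi m) = (\<Sum>r<(2::nat) ^ m * 2 ^ m. if r div 2 ^ m = r mod 2 ^ m then 1 / 2 ^ m else 0)"
    unfolding nrm2_def phi_def c ..
  also have "\<dots> = (\<Sum>i<(2::nat) ^ m. \<Sum>j<(2::nat) ^ m. if i = j then 1 / 2 ^ m else 0 :: real)"
    using sum_div_mod[of "2 ^ m" "\<lambda>i j. if i = j then 1 / 2 ^ m else 0 :: real" "2 ^ m"] by simp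
  finally show ?thesis by simp
qed

lemma Phi_density: "Phi m \<in> density (2 ^ m * 2 ^ m)"
proof -
  have "ket_bra (vec (2 ^ m * 2 ^ m) (phi m)) = Phi m"
    using Phi_carrier[of m] by (intro eq_matI) (auto simp: ket_bra_def Phi_rank_one)
  then show ?thesis using ket_bra_density[OF phi_norm] by metis
qed

lemma hform_phi:
  assumes "X \<in> carrier_mat (2 ^ m * 2 ^ m) (2 ^ m * 2 ^ m)"
  shows "hform {..<2 ^ m * 2 ^ m} (\<lambda>r s. X $$ (r, s)) (phi m) = mtrace (X * Phi m)"
  using gram_expectation(1)[where J = "{0::nat}" and w = "\<lambda>_. phi m", OF assms Phi_carrier] by (simp add: Phi_rank_one)

text \<open>The missing overlap is minus the form of the traceless difference at the unit vector
  \<open>phi m\<close>, which is at most half the trace norm.\<close>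

lemma trace_norm_overlap:
  assumes X: "X \<in> density (2 ^ m * 2 ^ m)"
  shows "0 \<le> trace_norm (X - Phi m)" "1 - Re (mtrace (X * Phi m)) \<le> 1 / 2 * trace_norm (X - Phi m)"
proof -
  let ?D = "2 ^ m * 2 ^ m :: nat"
  have Xp: "psd ?D X" "mtrace X = 1" and Xc: "X \<in> carrier_mat ?D ?D" using X by (auto simp: density_def psd_def)
  have Pp: "psd ?D (Phi m)" "mtrace (Phi m) = 1" using Phi_density by (auto simp: density_def)
  have M: "X - Phi m \<in> carrier_mat ?D ?D" using Phi_carrier by (rule minus_carrier_mat)
  have herm: "(X - Phi m) $$ (j, i) = cnj ((X - Phi m) $$ (i, j))" if "i < ?D" "j < ?D" for i j
    using psd_hermitian[OF Xp(1) that] psd_hermitian[OF Pp(1) that] that Xc Phi_carrier[of m] by simp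
  show "0 \<le> trace_norm (X - Phi m)" by (rule hermitian_trace_norm(1)[OF M herm])
  have tr: "mtrace (X - Phi m) = 0"
  proof -
    have "mtrace (X - Phi m) = mtrace X - mtrace (Phi m)"
      using Xc Phi_carrier[of m] by (simp add: mtrace_def sum_subtractf)
    then show ?thesis using Xp Pp by simp
  qed
  have "hform {..<?D} (\<lambda>r s. (X - Phi m) $$ (r, s)) (phi m) =
      hform {..<?D} (\<lambda>r s. X $$ (r, s)) (phi m) - hform {..<?D} (\<lambda>r s. phi m r * cnj (phi m s)) (phi m)"
    unfolding hform_diff[symmetric] using Xc Phi_carrier[of m] by (intro hform_cong) (auto simp: Phi_rank_one)
  also have "hform {..<?D} (\<lambda>r s. phi m r * cnj (phi m s)) (phi m) = 1"
  proof -
    have "(\<Sum>s<?D. cnj (phi m s) * phi m s) = complex_of_real (nrm2 ?D (phi m))"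
      unfolding of_real_nrm2 by (simp add: mult.commute)
    then show ?thesis unfolding hform_rank_one phi_norm by simp
  qed
  finally have "hform {..<?D} (\<lambda>r s. (X - Phi m) $$ (r, s)) (phi m) = mtrace (X * Phi m) - 1"
    unfolding hform_phi[OF Xc] .
  then show "1 - Re (mtrace (X * Phi m)) \<le> 1 / 2 * trace_norm (X - Phi m)"
    using hermitian_trace_norm(2)[OF M herm tr, of "phi m"] phi_norm by (simp add: nrm2_def)
qed

lemma hform_maxent_product:
  "Re (hform (sq2 K) maxent (\<lambda>p. u (fst p) * v (snd p))) \<le> nrm2 K u * nrm2 K v"
proof -
  have "hform (sq2 K) maxent (\<lambda>p. u (fst p) * v (snd p)) =
      hform (sq2 K) (\<lambda>p q. of_bool (fst p = snd p) * cnj (of_bool (fst q = snd q))) (\<lambda>p. u (fst p) * v (snd p))"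
    by (intro hform_cong) (simp_all add: maxent_def)
  also have "\<dots> = complex_of_real ((cmod (\<Sum>p\<in>sq2 K. cnj (of_bool (fst p = snd p)) * (u (fst p) * v (snd p))))\<^sup>2)"
    by (rule hform_rank_one)
  also have "(\<Sum>p\<in>sq2 K. cnj (of_bool (fst p = snd p)) * (u (fst p) * v (snd p))) = (\<Sum>x<K. \<Sum>y<K. if y = x then u x * v y else 0)"
    unfolding sum.cartesian_product' by (intro sum.cong refl) auto
  finally have eq: "Re (hform (sq2 K) maxent (\<lambda>p. u (fst p) * v (snd p))) = (cmod (\<Sum>x<K. u x * v x))\<^sup>2" by simp
  have "(cmod (\<Sum>x<K. u x * v x))\<^sup>2 \<le> (\<Sum>x<K. cmod (u x) * cmod (v x))\<^sup>2"
    by (intro power_mono) (simp_all add: sum_norm_le norm_mult)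
  also have "\<dots> \<le> nrm2 K u * nrm2 K v" unfolding nrm2_def by (rule Cauchy_Schwarz_ineq_sum)
  finally show ?thesis using eq by simp
qed

lemma hform_offdiag_product:
  "Re (hform (sq2 K) offdiag (\<lambda>p. u (fst p) * v (snd p))) \<le> nrm2 K u * nrm2 K v"
proof -
  let ?f = "\<lambda>p. u (fst p) * v (snd p)"
  have "hform (sq2 K) offdiag ?f = (\<Sum>p\<in>sq2 K. \<Sum>q\<in>sq2 K. if q = p then of_bool (fst p \<noteq> snd p) * (cnj (?f p) * ?f p) else 0)"
    unfolding hform_def by (intro sum.cong refl) (auto simp: offdiag_def)
  also have "\<dots> = (\<Sum>p\<in>sq2 K. of_bool (fst p \<noteq> snd p) * (?f p * cnj (?f p)))"
    by (intro sum.cong refl) (simp add: mult.commute)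
  also have "\<dots> = complex_of_real (\<Sum>p\<in>sq2 K. of_bool (fst p \<noteq> snd p) * (cmod (?f p))\<^sup>2)"
  proof -
    have b: "of_bool B * complex_of_real x = complex_of_real (of_bool B * x)" for B x by simp
    show ?thesis unfolding of_real_sum complex_norm_square[symmetric] b ..
  qed
  finally have "Re (hform (sq2 K) offdiag ?f) = (\<Sum>p\<in>sq2 K. of_bool (fst p \<noteq> snd p) * (cmod (?f p))\<^sup>2)" by simp
  also have "\<dots> \<le> (\<Sum>p\<in>sq2 K. (cmod (?f p))\<^sup>2)" by (intro sum_mono) auto
  also have "\<dots> = nrm2 K u * nrm2 K v"
    by (simp add: sum.cartesian_product' nrm2_def sum_product norm_mult power_mult_distrib)
  finally show ?thesis .
qed

lemma Phi_separable_overlap: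
  assumes "sepc (2 ^ m) (2 ^ m) X"
  shows "Re (mtrace (Phi m * X)) \<le> 1 / 2 ^ m * Re (mtrace X)"
proof (rule sepc_expectation_le[OF assms Phi_carrier])
  fix u v
  have "hform {..<2 ^ m * 2 ^ m} (\<lambda>r c. Phi m $$ (r, c)) (pv (2 ^ m) u v) =
      1 / 2 ^ m * hform (sq2 (2 ^ m)) maxent (\<lambda>p. u (fst p) * v (snd p))"
    unfolding Phi2_power by (subst hform_kmat) (simp_all only: hform_scale zero_less_power pos2)
  then show "Re (hform {..<2 ^ m * 2 ^ m} (\<lambda>r c. Phi m $$ (r, c)) (pv (2 ^ m) u v)) \<le> 1 / 2 ^ m * (nrm2 (2 ^ m) u * nrm2 (2 ^ m) v)"
    using hform_maxent_product[of "2 ^ m" u v] by (simp add: divide_right_mono)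
qed simp

text \<open>
  As \<^term>\<open>offdiag\<close> is orthogonal to the target, this separable state attains the largest possible
  overlap 1/K of separable states with the target.
\<close>

definition edge_state :: "nat \<Rightarrow> op" where
  "edge_state K = kmat K K (\<lambda>p q. complex_of_real (1 / (real K)\<^sup>2) * (maxent p q + offdiag p q))"

lemma edge_state_carrier: "edge_state K \<in> carrier_mat (K * K) (K * K)"
  by (simp add: edge_state_def kmat_carrier)

lemma edge_state_separable:
  assumes "K > 0"
  shows "edge_state K \<in> separable K K"
proof (rule sepc_imp_separable[OF _ _ assms assms])
  show "sepc K K (edge_state K)" unfolding edge_state_def using assms by (intro sepc_maxent_offdiag) auto
  have "maxent p p + offdiag p p = 1" for p by (auto simp: maxent_def offdiag_def)
  then show "mtrace (edge_state K) = 1"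
    using assms by (simp add: edge_state_def mtrace_kmat power2_eq_square)
qed

text \<open>Both \<open>maxent\<close> and \<open>offdiag\<close> have expectation at most 1 in
  normalized product vectors; this is the origin of the 2.\<close>

lemma edge_state_overlap:
  assumes K: "K > 0" and X: "sepc K K X"
  shows "Re (mtrace (edge_state K * X)) \<le> 2 / (real K)\<^sup>2 * Re (mtrace X)"
proof (rule sepc_expectation_le[OF X edge_state_carrier K])
  fix u v
  have "Re (hform {..<K * K} (\<lambda>r c. edge_state K $$ (r, c)) (pv K u v)) =
      1 / (real K)\<^sup>2 * (Re (hform (sq2 K) maxent (\<lambda>p. u (fst p) * v (snd p))) + Re (hform (sq2 K) offdiag (\<lambda>p. u (fst p) * v (snd p))))"
    unfolding edge_state_def hform_kmat[OF K] hform_scale hform_add by simp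
  also have "\<dots> \<le> 1 / (real K)\<^sup>2 * (nrm2 K u * nrm2 K v + nrm2 K u * nrm2 K v)"
    by (intro mult_left_mono add_mono hform_maxent_product hform_offdiag_product) simp
  finally show "Re (hform {..<K * K} (\<lambda>r c. edge_state K $$ (r, c)) (pv K u v)) \<le> 2 / (real K)\<^sup>2 * (nrm2 K u * nrm2 K v)"
    by simp
qed

text \<open>The edge state is 1/K times the target plus the positive operator \<open>Q\<close>,
  whose contribution is dropped.\<close>

lemma edge_state_ge_Phi:
  assumes X: "psd (2 ^ m * 2 ^ m) X"
  shows "1 / 2 ^ m * Re (mtrace (X * Phi m)) \<le> Re (mtrace (edge_state (2 ^ m) * X))"
proof -
  let ?K = "2 ^ m :: nat"
  define Q where "Q = kmat ?K ?K (\<lambda>p q. complex_of_real (1 / (real ?K)\<^sup>2) * offdiag p q)"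
  have Q: "psd (?K * ?K) Q" unfolding Q_def by (intro sepc_psd sepc_offdiag) auto
  have Qc: "Q \<in> carrier_mat (?K * ?K) (?K * ?K)" by (simp add: Q_def kmat_carrier)
  have Xc: "X \<in> carrier_mat (?K * ?K) (?K * ?K)" using X by (simp add: psd_def)
  have "edge_state ?K = complex_of_real (1 / 2 ^ m) \<cdot>\<^sub>m Phi m + Q"
    unfolding edge_state_def Q_def Phi2_power
    by (intro eq_matI) (auto simp: kmat_def power2_eq_square field_simps)
  then have "mtrace (edge_state ?K * X) = complex_of_real (1 / 2 ^ m) * mtrace (Phi m * X) + mtrace (Q * X)"
    using mtrace_add_left[OF Xc smult_carrier_mat[OF Phi_carrier] Qc] mtrace_smult_left[OF Xc Phi_carrier] by simp
  moreover have "mtrace (Phi m * X) = mtrace (X * Phi m)" by (rule mtrace_comm[OF Phi_carrier Xc])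
  moreover have "0 \<le> Re (mtrace (Q * X))" using psd_trace_nonneg[OF Q X] by (simp add: less_eq_complex_def)
  ultimately show ?thesis by simp
qed

section \<open>Bounds on the one-shot yield\<close>

lemma NE_density:
  assumes \<Theta>: "\<Theta> \<in> NE a b a' b'" and \<rho>: "psd (a * b) \<rho>" "mtrace \<rho> = 1" and pos: "a' > 0" "b' > 0"
  shows "\<Theta> \<rho> \<in> density (a' * b')"
proof -
  have cp: "completely_positive (a * b) (a' * b') \<Theta>" and tp: "trace_preserving (a * b) \<Theta>"
    using \<Theta> by (auto simp: NE_def CPTP_def)
  have "psd (a' * b') (\<Theta> \<rho>)" using completely_positive_psd[OF cp \<rho>(1)] pos by simp
  moreover have "mtrace (\<Theta> \<rho>) = 1" using tp \<rho> by (simp add: trace_preserving_def psd_def)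
  ultimately show ?thesis by (simp add: density_def)
qed

lemma NE_linear: "\<Theta> \<in> NE a b a' b' \<Longrightarrow> linear_op_map (a * b) (a' * b') \<Theta>"
  by (simp add: NE_def CPTP_def completely_positive_def)

text \<open>From \<rho> \<le> 1 = a b \<open>max_mixed\<close>: the image of the maximally mixed
  state is separable and overlaps the target by at most 1/2^m, and the image of 1 - \<rho> only adds
  to the overlap.\<close>

lemma NE_Phi_overlap_max_mixed:
  assumes \<Theta>: "\<Theta> \<in> NE a b (2 ^ m) (2 ^ m)" and pos: "a > 0" "b > 0"
    and \<rho>: "psd (a * b) \<rho>" "psd (a * b) (1\<^sub>m (a * b) - \<rho>)"
  shows "Re (mtrace (Phi m * \<Theta> \<rho>)) \<le> real (a * b) / 2 ^ m"
proof -
  let ?D = "2 ^ m * 2 ^ m :: nat"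
  note lin = NE_linear[OF \<Theta>]
  have cp: "completely_positive (a * b) ?D \<Theta>" using \<Theta> by (auto simp: NE_def CPTP_def)
  have car: "\<Theta> X \<in> carrier_mat ?D ?D" if "X \<in> carrier_mat (a * b) (a * b)" for X
    using lin that by (simp add: linear_op_map_def)
  define R where "R = 1\<^sub>m (a * b) - \<rho>"
  have \<rho>c: "\<rho> \<in> carrier_mat (a * b) (a * b)" "R \<in> carrier_mat (a * b) (a * b)" using \<rho> by (auto simp: psd_def R_def)
  have mm: "max_mixed a b \<in> carrier_mat (a * b) (a * b)" by (simp add: max_mixed_def)
  have "complex_of_real (real (a * b)) \<cdot>\<^sub>m max_mixed a b = \<rho> + R"
    unfolding R_def max_mixed_def using \<rho>c pos by (intro eq_matI) auto
  then have "complex_of_real (real (a * b)) \<cdot>\<^sub>m \<Theta> (max_mixed a b) = \<Theta> \<rho> + \<Theta> R"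
    using lin \<rho>c mm unfolding linear_op_map_def by metis
  then have "complex_of_real (real (a * b)) * mtrace (Phi m * \<Theta> (max_mixed a b)) = mtrace (Phi m * \<Theta> \<rho>) + mtrace (Phi m * \<Theta> R)"
    using mtrace_smult_right[OF Phi_carrier car[OF mm]] mtrace_add_right[OF Phi_carrier car[OF \<rho>c(1)] car[OF \<rho>c(2)]] by metis
  then have "real (a * b) * Re (mtrace (Phi m * \<Theta> (max_mixed a b))) = Re (mtrace (Phi m * \<Theta> \<rho>)) + Re (mtrace (Phi m * \<Theta> R))"
  proof -
    have R: "Re (complex_of_real r * z) = r * Re z" for r z by simp
    assume "complex_of_real (real (a * b)) * mtrace (Phi m * \<Theta> (max_mixed a b)) = mtrace (Phi m * \<Theta> \<rho>) + mtrace (Phi m * \<Theta> R)"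
    then show ?thesis unfolding R[symmetric] plus_complex.simps(1)[symmetric] by (rule arg_cong)
  qed
  moreover have "0 \<le> Re (mtrace (Phi m * \<Theta> R))"
  proof -
    have "psd ?D (\<Theta> R)" using completely_positive_psd[OF cp] \<rho>(2) by (simp add: R_def)
    then have "0 \<le> mtrace (Phi m * \<Theta> R)" using Phi_density by (intro psd_trace_nonneg) (auto simp: density_def)
    then show ?thesis by (simp add: less_eq_complex_def)
  qed
  moreover have "Re (mtrace (Phi m * \<Theta> (max_mixed a b))) \<le> 1 / 2 ^ m"
  proof -
    have "\<Theta> (max_mixed a b) \<in> separable (2 ^ m) (2 ^ m)"
      using \<Theta> max_mixed_separable[OF pos] by (auto simp: NE_def)
    then have "sepc (2 ^ m) (2 ^ m) (\<Theta> (max_mixed a b))" "mtrace (\<Theta> (max_mixed a b)) = 1"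
      using separable_imp_sepc by auto
    then show ?thesis using Phi_separable_overlap[of m "\<Theta> (max_mixed a b)"] by simp
  qed
  ultimately show ?thesis
    using mult_left_mono[of "Re (mtrace (Phi m * \<Theta> (max_mixed a b)))" "1 / 2 ^ m" "real (a * b)"] by simp
qed

text \<open>A crude bound that serves to make the set of achievable m finite. It is derived for the
  projector, which lies below the identity, and then rescaled to the state.\<close>

lemma NE_antisym_bound:
  assumes d: "d > 1" and \<Theta>: "\<Theta> \<in> NE (d ^ n) (d ^ n) (2 ^ m) (2 ^ m)"
  shows "(1 - 1 / 2 * trace_norm (\<Theta> (bip_power d d (antisym_state d) n) - Phi m)) * 2 ^ m \<le>
    (2 / (real d * (real d - 1))) ^ n * real (d ^ n * d ^ n)"
proof -
  define \<rho> where "\<rho> = bip_power d d (antisym_state d) n"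
  define \<kappa> where "\<kappa> = (2 / (real d * (real d - 1))) ^ n"
  have \<kappa>: "\<kappa> \<ge> 0" using d by (simp add: \<kappa>_def)
  have d0: "d > 0" using d by simp
  have T: "psd (d ^ n * d ^ n) (antisym_proj d n)" "psd (d ^ n * d ^ n) (1\<^sub>m (d ^ n * d ^ n) - antisym_proj d n)"
    using antisym_proj_psd[OF d0] by auto
  note lin = NE_linear[OF \<Theta>]
  have TT: "\<Theta> (antisym_proj d n) \<in> carrier_mat (2 ^ m * 2 ^ m) (2 ^ m * 2 ^ m)"
    using lin antisym_proj_carrier[of d n] by (simp add: linear_op_map_def)
  have "\<Theta> \<rho> = complex_of_real \<kappa> \<cdot>\<^sub>m \<Theta> (antisym_proj d n)"
    using lin antisym_proj_carrier[of d n] antisym_power[OF d0, of n] by (simp add: linear_op_map_def \<rho>_def \<kappa>_def)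
  then have "mtrace (Phi m * \<Theta> \<rho>) = complex_of_real \<kappa> * mtrace (Phi m * \<Theta> (antisym_proj d n))"
    using mtrace_smult_right[OF Phi_carrier TT] by simp
  then have "Re (mtrace (Phi m * \<Theta> \<rho>)) \<le> \<kappa> * (real (d ^ n * d ^ n) / 2 ^ m)"
    using mult_left_mono[OF NE_Phi_overlap_max_mixed[OF \<Theta> _ _ T] \<kappa>] d0 by simp
  moreover have D: "\<Theta> \<rho> \<in> density (2 ^ m * 2 ^ m)"
    unfolding \<rho>_def by (rule NE_density[OF \<Theta> antisym_power_psd[OF d] antisym_power_trace[OF d]]) auto
  moreover have "mtrace (\<Theta> \<rho> * Phi m) = mtrace (Phi m * \<Theta> \<rho>)"
    using D by (intro mtrace_comm[OF _ Phi_carrier]) (auto simp: density_def psd_def)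
  ultimately have "1 - 1 / 2 * trace_norm (\<Theta> \<rho> - Phi m) \<le> \<kappa> * (real (d ^ n * d ^ n) / 2 ^ m)"
    using trace_norm_overlap(2)[OF D] by simp
  then have "(1 - 1 / 2 * trace_norm (\<Theta> \<rho> - Phi m)) * 2 ^ m \<le> \<kappa> * (real (d ^ n * d ^ n) / 2 ^ m) * 2 ^ m"
    by (intro mult_right_mono) auto
  then show ?thesis by (simp add: \<rho>_def \<kappa>_def)
qed

text \<open>Both conditions on a DNE map are used. The dual one makes E separable, so that
  \<open>antisym_power_le_sym_power\<close> applies; the primal one makes \<Theta> \<sigma>
  separable, so that \<open>edge_state_overlap\<close> applies. One factor K remains after comparing
  the two ends of the chain.\<close>

lemma DNE_antisym_bound:
  assumes d: "d > 1" and \<Theta>: "\<Theta> \<in> DNE (d ^ n) (d ^ n) (2 ^ m) (2 ^ m)"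
  shows "(1 - 1 / 2 * trace_norm (\<Theta> (bip_power d d (antisym_state d) n) - Phi m)) * 2 ^ m \<le>
    2 * ((real d + 1) / (real d - 1)) ^ n"
proof -
  define \<rho> where "\<rho> = bip_power d d (antisym_state d) n"
  define \<sigma> where "\<sigma> = bip_power d d (sym_state d) n"
  define c where "c = ((real d + 1) / (real d - 1)) ^ n"
  define E where "E = adjoint_map (d ^ n * d ^ n) \<Theta> (edge_state (2 ^ m))"
  have d0: "d > 0" and N: "d ^ n > 0" using d by simp_all
  have K: "(0::nat) < 2 ^ m" by simp
  have c: "c \<ge> 0" using d by (simp add: c_def)
  have NE: "\<Theta> \<in> NE (d ^ n) (d ^ n) (2 ^ m) (2 ^ m)" using \<Theta> by (simp add: DNE_def)
  note adj = adjoint_map_trace[OF NE_linear[OF NE] edge_state_carrier, folded E_def]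
  have \<rho>c: "\<rho> \<in> carrier_mat (d ^ n * d ^ n) (d ^ n * d ^ n)" unfolding \<rho>_def by (rule bip_power_carrier)
  have \<sigma>c: "\<sigma> \<in> carrier_mat (d ^ n * d ^ n) (d ^ n * d ^ n)" unfolding \<sigma>_def by (rule bip_power_carrier)
  have "E \<in> state_cone (separable (d ^ n) (d ^ n))"
    using \<Theta> edge_state_separable[OF K] unfolding DNE_def E_def by blast
  then have E: "sepc (d ^ n) (d ^ n) E" using N by (intro state_cone_sepc)
  have D: "\<Theta> \<rho> \<in> density (2 ^ m * 2 ^ m)"
    unfolding \<rho>_def by (rule NE_density[OF NE antisym_power_psd[OF d] antisym_power_trace[OF d]]) auto
  have "1 / 2 ^ m * (1 - 1 / 2 * trace_norm (\<Theta> \<rho> - Phi m)) \<le> 1 / 2 ^ m * Re (mtrace (\<Theta> \<rho> * Phi m))"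
    using trace_norm_overlap(2)[OF D] by (intro mult_left_mono) auto
  also have "\<dots> \<le> Re (mtrace (edge_state (2 ^ m) * \<Theta> \<rho>))"
    using D by (intro edge_state_ge_Phi) (simp add: density_def)
  also have "\<dots> = Re (mtrace (\<rho> * E))" using adj(2)[OF \<rho>c] mtrace_comm[OF adj(1) \<rho>c] by simp
  also have "\<dots> \<le> c * Re (mtrace (\<sigma> * E))"
    unfolding \<rho>_def \<sigma>_def c_def by (rule antisym_power_le_sym_power[OF d E])
  also have "Re (mtrace (\<sigma> * E)) = Re (mtrace (edge_state (2 ^ m) * \<Theta> \<sigma>))"
    using adj(2)[OF \<sigma>c] mtrace_comm[OF adj(1) \<sigma>c] by simp
  also have "c * Re (mtrace (edge_state (2 ^ m) * \<Theta> \<sigma>)) \<le> c * (2 / (2 ^ m)\<^sup>2)"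
  proof (intro mult_left_mono c)
    have "\<sigma> \<in> separable (d ^ n) (d ^ n)"
      unfolding \<sigma>_def by (rule sepc_imp_separable[OF sym_power_sepc[OF d0] sym_power_trace[OF d0] N N])
    then have "\<Theta> \<sigma> \<in> separable (2 ^ m) (2 ^ m)" using NE by (auto simp: NE_def)
    then have "sepc (2 ^ m) (2 ^ m) (\<Theta> \<sigma>)" "mtrace (\<Theta> \<sigma>) = 1" using separable_imp_sepc by auto
    then show "Re (mtrace (edge_state (2 ^ m) * \<Theta> \<sigma>)) \<le> 2 / (2 ^ m)\<^sup>2"
      using edge_state_overlap[OF K, of "\<Theta> \<sigma>"] by simp
  qed
  finally have "1 / 2 ^ m * (1 - 1 / 2 * trace_norm (\<Theta> \<rho> - Phi m)) \<le> c * (2 / (2 ^ m)\<^sup>2)" .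
  then have "(2 ^ m)\<^sup>2 * (1 / 2 ^ m * (1 - 1 / 2 * trace_norm (\<Theta> \<rho> - Phi m))) \<le> (2 ^ m)\<^sup>2 * (c * (2 / (2 ^ m)\<^sup>2))"
    by (intro mult_left_mono) auto
  then show ?thesis by (simp add: power2_eq_square \<rho>_def c_def mult.commute)
qed

text \<open>If X passes with probability p, the output has components p/K on \<open>maxent\<close>
  and (1 - p)/(K(K - 1)) on \<open>offdiag\<close>. Pairing all of \<open>maxent\<close> with an
  equal amount of \<open>offdiag\<close> gives a separable part; the diagonal rest has weight w,
  nonnegative exactly when p K \<le> 1.\<close>

lemma NE_antisym_protocol:
  assumes d: "d \<ge> 7" and m: "m \<ge> 1" and le: "((real d - 1) / (real d + 2)) ^ n \<le> 1 / 2 ^ m"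
  shows "\<exists>\<Theta>\<in>NE (d ^ n) (d ^ n) (2 ^ m) (2 ^ m). \<Theta> (bip_power d d (antisym_state d) n) = Phi m"
proof -
  define K where "K = (2::nat) ^ m"
  define N where "N = d ^ n"
  define T where "T = antisym_proj d n"
  define S where "S = 1\<^sub>m (N * N) - T"
  \<comment> \<open>The uniform mixture of the K(K - 1) basis states |xy> with x \<noteq> y,
    orthogonal to the target. It exists only for K \<ge> 2, whence m \<ge> 1.\<close>
  define \<tau> where "\<tau> = kmat K K (\<lambda>p q. complex_of_real (1 / (real K * (real K - 1))) * offdiag p q)"
  define \<Theta> where "\<Theta> = test_map T (Phi m) S \<tau>"
  have "(2::nat) ^ 1 \<le> 2 ^ m" using m by (intro power_increasing) auto
  then have K: "K \<ge> 2" by (simp add: K_def)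
  have d0: "d > 0" "d > 1" and N: "N > 0" using d by (simp_all add: N_def)
  have Tp: "psd (N * N) T" "psd (N * N) S" using antisym_proj_psd[OF d0(1), of n] by (simp_all add: T_def S_def N_def)
  have Tc: "T \<in> carrier_mat (N * N) (N * N)" "S \<in> carrier_mat (N * N) (N * N)" using Tp by (auto simp: psd_def)
  have TS: "T + S = 1\<^sub>m (N * N)" unfolding S_def using Tc by (intro eq_matI) auto
  have \<tau>c: "\<tau> \<in> carrier_mat (K * K) (K * K)" by (simp add: \<tau>_def kmat_carrier)
  have \<tau>: "\<tau> \<in> density (K * K)"
  proof -
    have "(\<Sum>p\<in>sq2 K. offdiag p p) = (\<Sum>x<K. \<Sum>y<K. 1 - (if y = x then 1 else 0))"
      unfolding sum.cartesian_product' by (intro sum.cong refl) (auto simp: offdiag_def)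
    also have "\<dots> = of_nat K * (of_nat K - 1)" by (simp add: sum_subtractf algebra_simps)
    finally have "mtrace \<tau> = complex_of_real (1 / (real K * (real K - 1)) * (real K * (real K - 1)))"
      using K by (simp add: \<tau>_def mtrace_kmat flip: sum_divide_distrib)
    also have "1 / (real K * (real K - 1)) * (real K * (real K - 1)) = 1" using K by simp
    finally have "mtrace \<tau> = 1" by simp
    moreover have "psd (K * K) \<tau>" unfolding \<tau>_def using K by (intro sepc_psd sepc_offdiag) auto
    ultimately show ?thesis by (simp add: density_def)
  qed
  have CPTP: "\<Theta> \<in> CPTP (N * N) (K * K)"
    unfolding \<Theta>_def using Phi_density[of m] \<tau> TS Tp N K by (intro test_map_CPTP) (auto simp: K_def)
  have "\<Theta> X \<in> separable K K" if "X \<in> separable N N" for X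
  proof (rule sepc_imp_separable)
    have X: "sepc N N X" "mtrace X = 1" using separable_imp_sepc[OF that N N] by auto
    have Xc: "X \<in> carrier_mat (N * N) (N * N)" using X by (simp add: sepc_def)
    define p where "p = Re (mtrace (T * X))"
    have "0 \<le> mtrace (T * X)" by (rule psd_trace_nonneg[OF Tp(1) sepc_psd[OF X(1)]])
    then have p: "mtrace (T * X) = complex_of_real p" "p \<ge> 0" by (auto simp: p_def less_eq_complex_def complex_eq_iff)
    have "mtrace (T * X) + mtrace (S * X) = mtrace ((T + S) * X)" by (rule mtrace_add_left[OF Xc Tc, symmetric])
    then have q: "mtrace (S * X) = complex_of_real (1 - p)" using X(2) Xc by (simp add: TS p algebra_simps)
    have "p \<le> ((real d - 1) / (real d + 2)) ^ n"
      using antisym_proj_separable_overlap[OF d, of n X] X by (simp add: p_def T_def N_def)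
    then have pK: "p \<le> 1 / real K" using le by (simp add: K_def)
    define w where "w = (1 - p) / (real K * (real K - 1)) - p / real K"
    have "w = (1 - p * real K) / (real K * (real K - 1))"
      using K unfolding w_def by (simp add: divide_simps) (simp add: algebra_simps)
    moreover have "p * real K \<le> 1" using pK K by (simp add: field_simps)
    ultimately have w: "w \<ge> 0" using K by simp
    show "sepc K K (\<Theta> X)"
    proof (rule sepc_add[of K K _ _ 1 1])
      show "sepc K K (kmat K K (\<lambda>a b. complex_of_real (p / real K) * (maxent a b + offdiag a b)))"
        using K p by (intro sepc_maxent_offdiag) auto
      show "sepc K K (kmat K K (\<lambda>a b. complex_of_real w * offdiag a b))"
        using K w by (intro sepc_offdiag) auto
      show "\<Theta> X \<in> carrier_mat (K * K) (K * K)"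
        using Phi_carrier[of m] \<tau>c by (simp add: \<Theta>_def test_map_def K_def)
      fix r s assume rs: "r < K * K" "s < K * K"
      have "\<Theta> X $$ (r, s) = complex_of_real p * Phi m $$ (r, s) + complex_of_real (1 - p) * \<tau> $$ (r, s)"
        using rs Phi_carrier[of m] \<tau>c by (simp add: \<Theta>_def test_map_def p q K_def)
      also have "Phi m $$ (r, s) = complex_of_real (1 / real K) * maxent (r div K, r mod K) (s div K, s mod K)"
        using rs unfolding Phi2_power by (simp add: kmat_entry K_def)
      also have "\<tau> $$ (r, s) = complex_of_real (1 / (real K * (real K - 1))) * offdiag (r div K, r mod K) (s div K, s mod K)"
        unfolding \<tau>_def by (rule kmat_entry[OF rs])
      also have "complex_of_real p * (complex_of_real (1 / real K) * maxent (r div K, r mod K) (s div K, s mod K)) +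
          complex_of_real (1 - p) * (complex_of_real (1 / (real K * (real K - 1))) * offdiag (r div K, r mod K) (s div K, s mod K)) =
          complex_of_real (p / real K) * maxent (r div K, r mod K) (s div K, s mod K) +
          complex_of_real ((1 - p) / (real K * (real K - 1))) * offdiag (r div K, r mod K) (s div K, s mod K)"
        by simp
      also have "(1 - p) / (real K * (real K - 1)) = p / real K + w" by (simp add: w_def)
      finally show "\<Theta> X $$ (r, s) = complex_of_real 1 * kmat K K (\<lambda>a b. complex_of_real (p / real K) * (maxent a b + offdiag a b)) $$ (r, s) +
          complex_of_real 1 * kmat K K (\<lambda>a b. complex_of_real w * offdiag a b) $$ (r, s)"
        unfolding kmat_entry[OF rs] by (simp add: algebra_simps)
    qed simp_all
    show "mtrace (\<Theta> X) = 1" using CPTP Xc X(2) by (simp add: CPTP_def trace_preserving_def)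
  qed (use K in auto)
  then have "\<Theta> \<in> NE N N K K" using CPTP by (auto simp: NE_def)
  moreover have "\<Theta> (bip_power d d (antisym_state d) n) = Phi m"
  proof -
    define \<rho> where "\<rho> = bip_power d d (antisym_state d) n"
    have \<rho>c: "\<rho> \<in> carrier_mat (N * N) (N * N)" unfolding \<rho>_def N_def by (rule bip_power_carrier)
    have T1: "mtrace (T * \<rho>) = 1"
      unfolding T_def \<rho>_def antisym_proj_power[OF d0(2)] by (rule antisym_power_trace[OF d0(2)])
    have "mtrace (T * \<rho>) + mtrace (S * \<rho>) = mtrace ((T + S) * \<rho>)" by (rule mtrace_add_left[OF \<rho>c Tc, symmetric])
    also have "\<dots> = 1" unfolding TS using \<rho>c antisym_power_trace[OF d0(2), of n] by (simp add: \<rho>_def)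
    finally have "mtrace (S * \<rho>) = 0" using T1 by simp
    then show ?thesis
      unfolding \<rho>_def[symmetric] \<Theta>_def test_map_def T1 using Phi_carrier[of m] \<tau>c
      by (intro eq_matI) (auto simp: K_def)
  qed
  ultimately show ?thesis unfolding N_def K_def by blast
qed

section \<open>One-shot yields as maxima of finite sets\<close>

definition achievable :: "(nat \<Rightarrow> nat \<Rightarrow> nat \<Rightarrow> nat \<Rightarrow> (op \<Rightarrow> op) set) \<Rightarrow> nat \<Rightarrow> real \<Rightarrow> op \<Rightarrow> nat set" where
  "achievable \<F> a \<epsilon> \<rho> = {m. (INF \<Theta>\<in>\<F> a a (2 ^ m) (2 ^ m). 1 / 2 * trace_norm (\<Theta> \<rho> - Phi m)) \<le> \<epsilon>}"

lemma one_shot_achievable: "one_shot_distillable \<F> a a \<epsilon> \<rho> = Max (achievable \<F> a \<epsilon> \<rho>)"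
  by (simp add: one_shot_distillable_def achievable_def)

lemma achievable_mono: "\<epsilon> \<le> \<epsilon>' \<Longrightarrow> achievable \<F> a \<epsilon> \<rho> \<subseteq> achievable \<F> a \<epsilon>' \<rho>"
  by (auto simp: achievable_def)

text \<open>A bound for each single map passes to the infimum, so the argument does not depend on
  the infimum being attained. Nonemptiness is what \<open>cINF_greatest\<close> asks for.\<close>

lemma achievable_bound:
  assumes "m \<in> achievable \<F> a \<epsilon> \<rho>" and "\<F> a a (2 ^ m) (2 ^ m) \<noteq> {}"
    and le: "\<And>\<Theta>. \<Theta> \<in> \<F> a a (2 ^ m) (2 ^ m) \<Longrightarrow> (1 - 1 / 2 * trace_norm (\<Theta> \<rho> - Phi m)) * 2 ^ m \<le> B"
  shows "(1 - \<epsilon>) * 2 ^ m \<le> B"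
proof -
  have "1 - B / 2 ^ m \<le> (INF \<Theta>\<in>\<F> a a (2 ^ m) (2 ^ m). 1 / 2 * trace_norm (\<Theta> \<rho> - Phi m))"
  proof (rule cINF_greatest[OF assms(2)])
    fix \<Theta> assume "\<Theta> \<in> \<F> a a (2 ^ m) (2 ^ m)"
    then show "1 - B / 2 ^ m \<le> 1 / 2 * trace_norm (\<Theta> \<rho> - Phi m)"
      using le[of \<Theta>] by (simp add: field_simps)
  qed
  also have "\<dots> \<le> \<epsilon>" using assms(1) by (simp add: achievable_def)
  finally show ?thesis by (simp add: field_simps)
qed

text \<open>An exact protocol has error 0 and hence works for every \<epsilon>. The infimum is taken
  in the reals, so a lower bound of the errors is required; nonnegativity of the trace norm supplies
  it.\<close>

lemma achievable_member:
  assumes sub: "\<F> a a (2 ^ m) (2 ^ m) \<subseteq> NE a a (2 ^ m) (2 ^ m)" and \<rho>: "psd (a * a) \<rho>" "mtrace \<rho> = 1"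
    and \<Theta>: "\<Theta> \<in> \<F> a a (2 ^ m) (2 ^ m)" "\<Theta> \<rho> = Phi m" and \<epsilon>: "0 \<le> \<epsilon>"
  shows "m \<in> achievable \<F> a \<epsilon> \<rho>"
proof -
  let ?f = "\<lambda>\<Theta>. 1 / 2 * trace_norm (\<Theta> \<rho> - Phi m)"
  have "bdd_below (?f ` \<F> a a (2 ^ m) (2 ^ m))"
  proof (rule bdd_belowI2)
    fix \<Theta>' assume "\<Theta>' \<in> \<F> a a (2 ^ m) (2 ^ m)"
    then have "\<Theta>' \<rho> \<in> density (2 ^ m * 2 ^ m)" using sub \<rho> by (intro NE_density) auto
    then show "0 \<le> ?f \<Theta>'" using trace_norm_overlap(1) by simp
  qed
  then have "(INF \<Theta>\<in>\<F> a a (2 ^ m) (2 ^ m). ?f \<Theta>) \<le> ?f \<Theta>" by (rule cINF_lower[OF _ \<Theta>(1)])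
  also have "Phi m - Phi m = 0\<^sub>m (2 ^ m * 2 ^ m) (2 ^ m * 2 ^ m)"
    using Phi_carrier[of m] by (intro eq_matI) auto
  then have "?f \<Theta> = 0" by (simp add: \<Theta>(2) trace_norm_zero)
  finally show ?thesis using \<epsilon> by (simp add: achievable_def)
qed

lemma DNE_subset_NE: "DNE a b a' b' \<subseteq> NE a b a' b'"
  by (auto simp: DNE_def)

lemma zero_achievable:
  assumes "DNE a a 1 1 \<subseteq> \<F> a a 1 1" "\<F> a a 1 1 \<subseteq> NE a a 1 1" and \<rho>: "psd (a * a) \<rho>" "mtrace \<rho> = 1"
    and "0 \<le> \<epsilon>" "a > 0"
  shows "0 \<in> achievable \<F> a \<epsilon> \<rho>"
proof (rule achievable_member[OF _ \<rho>])
  show "trace_out (a * a) (1 * 1) \<in> \<F> a a (2 ^ 0) (2 ^ 0)"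
    using trace_out_DNE[of a a 1 1] assms by auto
  have "\<rho> \<in> carrier_mat (a * a) (a * a)" using \<rho> by (simp add: psd_def)
  then show "trace_out (a * a) (1 * 1) \<rho> = Phi 0"
    using \<rho> by (intro eq_matI) (auto simp: trace_out_eq unit_mat_def)
qed (use assms in auto)

lemma finite_achievable:
  assumes "\<epsilon> < 1" and le: "\<And>m. m \<in> achievable \<F> a \<epsilon> \<rho> \<Longrightarrow> (1 - \<epsilon>) * 2 ^ m \<le> B"
  shows "finite (achievable \<F> a \<epsilon> \<rho>)"
proof -
  have "m \<le> nat \<lceil>B / (1 - \<epsilon>)\<rceil>" if "m \<in> achievable \<F> a \<epsilon> \<rho>" for m
  proof -
    have "real m \<le> 2 ^ m" using less_exp[of m] by (metis less_imp_le of_nat_le_iff of_nat_numeral of_nat_power)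
    also have "\<dots> \<le> B / (1 - \<epsilon>)" using le[OF that] assms(1) by (simp add: pos_le_divide_eq mult.commute)
    finally show ?thesis by linarith
  qed
  then show ?thesis using finite_subset[of _ "{..nat \<lceil>B / (1 - \<epsilon>)\<rceil>}"] by auto
qed

text \<open>These two facts give \<open>Max\<close> its meaning; they are the side conditions of all
  later comparisons of yields.\<close>

lemma antisym_achievable:
  assumes d: "d > 1" and \<epsilon>: "0 \<le> \<epsilon>" "\<epsilon> < 1" and \<F>: "\<F> = NE \<or> \<F> = DNE"
  shows "finite (achievable \<F> (d ^ n) \<epsilon> (bip_power d d (antisym_state d) n))"
    and "0 \<in> achievable \<F> (d ^ n) \<epsilon> (bip_power d d (antisym_state d) n)"
proof -
  have sub: "DNE a b a' b' \<subseteq> \<F> a b a' b'" "\<F> a b a' b' \<subseteq> NE a b a' b'" for a b a' b'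
    using \<F> DNE_subset_NE[of a b a' b'] by (elim disjE; simp)+
  have ne: "\<F> (d ^ n) (d ^ n) (2 ^ m) (2 ^ m) \<noteq> {}" for m
    using sub(1)[of "d ^ n" "d ^ n" "2 ^ m" "2 ^ m"] trace_out_DNE[of "d ^ n" "d ^ n" "2 ^ m" "2 ^ m"] d by auto
  show "finite (achievable \<F> (d ^ n) \<epsilon> (bip_power d d (antisym_state d) n))"
  proof (rule finite_achievable[OF \<epsilon>(2)])
    fix m assume m: "m \<in> achievable \<F> (d ^ n) \<epsilon> (bip_power d d (antisym_state d) n)"
    show "(1 - \<epsilon>) * 2 ^ m \<le> (2 / (real d * (real d - 1))) ^ n * real (d ^ n * d ^ n)"
      using sub(2) NE_antisym_bound[OF d] by (intro achievable_bound[OF m ne]) blast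
  qed
  show "0 \<in> achievable \<F> (d ^ n) \<epsilon> (bip_power d d (antisym_state d) n)"
    using d \<epsilon> antisym_power_psd[OF d] antisym_power_trace[OF d] by (intro zero_achievable sub) auto
qed

lemma DNE_one_shot_le:
  assumes d: "d > 1" and \<epsilon>: "0 \<le> \<epsilon>" "\<epsilon> < 1"
  shows "real (one_shot_distillable DNE (d ^ n) (d ^ n) \<epsilon> (bip_power d d (antisym_state d) n)) \<le>
    real n * log 2 ((real d + 1) / (real d - 1)) + log 2 (2 / (1 - \<epsilon>))"
proof -
  define m where "m = one_shot_distillable DNE (d ^ n) (d ^ n) \<epsilon> (bip_power d d (antisym_state d) n)"
  define c where "c = (real d + 1) / (real d - 1)"
  have c: "c > 0" using d by (simp add: c_def)
  have "m \<in> achievable DNE (d ^ n) \<epsilon> (bip_power d d (antisym_state d) n)"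
    unfolding m_def one_shot_achievable using antisym_achievable[OF d \<epsilon>, of DNE n] by (intro Max_in) auto
  moreover have "DNE (d ^ n) (d ^ n) (2 ^ m) (2 ^ m) \<noteq> {}"
    using trace_out_DNE[of "d ^ n" "d ^ n" "2 ^ m" "2 ^ m"] d by auto
  ultimately have "(1 - \<epsilon>) * 2 ^ m \<le> 2 * c ^ n"
    unfolding c_def using DNE_antisym_bound[OF d] by (rule achievable_bound)
  then have "2 ^ m \<le> c ^ n * (2 / (1 - \<epsilon>))" using \<epsilon> by (simp add: field_simps)
  then have "log 2 (2 ^ m) \<le> log 2 (c ^ n * (2 / (1 - \<epsilon>)))" using c \<epsilon> by (intro log_mono) auto
  also have "\<dots> = real n * log 2 c + log 2 (2 / (1 - \<epsilon>))"
  proof -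
    have "log 2 (c ^ n * (2 / (1 - \<epsilon>))) = log 2 (c ^ n) + log 2 (2 / (1 - \<epsilon>))"
      using c \<epsilon> by (intro log_mult_pos) auto
    then show ?thesis using c by (simp add: log_nat_power)
  qed
  finally show ?thesis by (simp add: m_def c_def log_nat_power)
qed

lemma NE_one_shot_ge:
  assumes d: "d \<ge> 7" and \<epsilon>: "0 \<le> \<epsilon>" "\<epsilon> < 1"
  shows "real n * log 2 ((real d + 2) / (real d - 1)) - 1 \<le>
    real (one_shot_distillable NE (d ^ n) (d ^ n) \<epsilon> (bip_power d d (antisym_state d) n))"
proof -
  define c where "c = (real d + 2) / (real d - 1)"
  \<comment> \<open>The largest integer with 2^m \<le> c^n; rounding down costs at most 1, which is
    negligible after division by n.\<close>
  define m where "m = nat \<lfloor>real n * log 2 c\<rfloor>"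
  have d1: "d > 1" using d by simp
  have c: "c > 1" using d by (simp add: c_def)
  have pos: "0 \<le> real n * log 2 c" using c by simp
  have "real m \<le> real n * log 2 c" unfolding m_def using pos by linarith
  then have "2 powr real m \<le> 2 powr (real n * log 2 c)" by simp
  also have "\<dots> = (2 powr log 2 c) powr real n" by (simp add: powr_powr mult.commute)
  also have "\<dots> = c ^ n" using c by (simp add: powr_realpow)
  finally have "2 ^ m \<le> c ^ n" by (simp add: powr_realpow)
  then have "1 / c ^ n \<le> 1 / 2 ^ m" using c by (intro divide_left_mono) auto
  moreover have "((real d - 1) / (real d + 2)) ^ n = 1 / c ^ n"
    unfolding c_def by (simp add: power_divide)
  ultimately have le: "((real d - 1) / (real d + 2)) ^ n \<le> 1 / 2 ^ m" by simp
  note fin = antisym_achievable[OF d1 \<epsilon>, of NE n]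
  have "m \<in> achievable NE (d ^ n) \<epsilon> (bip_power d d (antisym_state d) n)"
  proof (cases "m = 0")
    case True
    then show ?thesis using fin(2) by simp
  next
    case False
    then obtain \<Theta> where "\<Theta> \<in> NE (d ^ n) (d ^ n) (2 ^ m) (2 ^ m)" "\<Theta> (bip_power d d (antisym_state d) n) = Phi m"
      using NE_antisym_protocol[OF d _ le] by auto
    then show ?thesis
      by (rule achievable_member[where \<F> = NE, OF order_refl antisym_power_psd[OF d1] antisym_power_trace[OF d1] _ _ \<epsilon>(1)])
  qed
  then have "m \<le> one_shot_distillable NE (d ^ n) (d ^ n) \<epsilon> (bip_power d d (antisym_state d) n)"
    unfolding one_shot_achievable using fin(1) by (intro Max_ge) auto
  moreover have "real n * log 2 c - 1 \<le> real m" unfolding m_def using pos by linarith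
  ultimately show ?thesis by (simp add: c_def)
qed

section \<open>Asymptotic rates\<close>

text \<open>Monotonicity turns the limit into an infimum, so that an upper bound needs just one
  \<epsilon> and a lower bound is one that holds for all of them.\<close>

lemma Lim_at_right_0_mono:
  fixes g :: "real \<Rightarrow> ereal"
  assumes mono: "\<And>x y. 0 < x \<Longrightarrow> x \<le> y \<Longrightarrow> y < 1 \<Longrightarrow> g x \<le> g y"
  shows "Lim (at_right 0) g = (INF x\<in>{0<..<1}. g x)"
proof -
  \<comment> \<open>Monotonicity is known only below 1, so the limit is taken within that interval
    and then identified with the right-hand limit; -\<infinity> is the lower bound that
    \<open>Lim_right_bound\<close> asks for.\<close>
  have "(g \<longlongrightarrow> Inf (g ` ({0<..} \<inter> {..<1}))) (at 0 within ({0<..} \<inter> {..<1}))"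
    by (rule Lim_right_bound[where K = "-\<infinity>"]) (use mono in auto)
  moreover have "at 0 within ({0<..} \<inter> {..<1}) = at_right (0::real)"
    by (rule at_within_nhd[of _ "{..<1}"]) auto
  moreover have "{0<..} \<inter> {..<1} = {0<..<1::real}" by auto
  ultimately have "(g \<longlongrightarrow> (INF x\<in>{0<..<1}. g x)) (at_right 0)" by simp
  then show ?thesis by (intro tendsto_Lim) auto
qed

lemma antisym_distillable_INF:
  assumes d: "d > 1" and \<F>: "\<F> = NE \<or> \<F> = DNE"
  shows "distillable_entanglement \<F> d d (antisym_state d) = (INF \<epsilon>\<in>{0<..<1}. liminf (\<lambda>n.
    ereal (1 / real n * real (one_shot_distillable \<F> (d ^ n) (d ^ n) \<epsilon> (bip_power d d (antisym_state d) n)))))"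
  unfolding distillable_entanglement_def
proof (rule Lim_at_right_0_mono)
  fix x y :: real assume xy: "0 < x" "x \<le> y" "y < 1"
  have "one_shot_distillable \<F> (d ^ n) (d ^ n) x (bip_power d d (antisym_state d) n) \<le>
      one_shot_distillable \<F> (d ^ n) (d ^ n) y (bip_power d d (antisym_state d) n)" for n
    unfolding one_shot_achievable
    using antisym_achievable(1)[OF d _ xy(3) \<F>, of n] antisym_achievable(2)[OF d _ _ \<F>, of x n] xy
    by (intro Max_mono achievable_mono) auto
  then show "liminf (\<lambda>n. ereal (1 / real n * real (one_shot_distillable \<F> (d ^ n) (d ^ n) x (bip_power d d (antisym_state d) n)))) \<le>
      liminf (\<lambda>n. ereal (1 / real n * real (one_shot_distillable \<F> (d ^ n) (d ^ n) y (bip_power d d (antisym_state d) n))))"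
    by (intro Liminf_mono always_eventually) (simp add: divide_right_mono)
qed

lemma rate_tendsto: "(\<lambda>n. ereal (1 / real n * (real n * r + C))) \<longlonglongrightarrow> ereal r"
proof -
  have "(\<lambda>n. r + C * inverse (real n)) \<longlonglongrightarrow> r + C * 0"
    by (intro tendsto_intros lim_inverse_n)
  moreover have "\<forall>\<^sub>F n in sequentially. r + C * inverse (real n) = 1 / real n * (real n * r + C)"
    using eventually_gt_at_top[of 0] by eventually_elim (simp add: field_simps)
  ultimately have "(\<lambda>n. 1 / real n * (real n * r + C)) \<longlonglongrightarrow> r"
    by (simp add: Lim_transform_eventually)
  then show ?thesis by simp
qed

text \<open>The value \<epsilon> = 1/2 is enough: the one-shot bound depends on \<epsilon> only
  through an additive constant, which disappears after division by n.\<close>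

lemma DNE_distillable_le:
  assumes d: "d > 1"
  shows "distillable_entanglement DNE d d (antisym_state d) \<le> ereal (log 2 ((real d + 1) / (real d - 1)))"
proof -
  let ?r = "log 2 ((real d + 1) / (real d - 1))" and ?C = "log 2 (2 / (1 - 1 / 2))"
  have "distillable_entanglement DNE d d (antisym_state d) \<le> liminf (\<lambda>n.
    ereal (1 / real n * real (one_shot_distillable DNE (d ^ n) (d ^ n) (1 / 2) (bip_power d d (antisym_state d) n))))"
    unfolding antisym_distillable_INF[OF d disjI2[OF refl]] by (rule INF_lower) simp
  also have "\<dots> \<le> liminf (\<lambda>n. ereal (1 / real n * (real n * ?r + ?C)))"
    using DNE_one_shot_le[OF d, of "1 / 2"]
    by (intro Liminf_mono always_eventually allI) (simp only: ereal_less_eq(3), intro mult_left_mono, auto)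
  also have "\<dots> = ereal ?r" by (rule lim_imp_Liminf[OF _ rate_tendsto]) simp
  finally show ?thesis .
qed

text \<open>The protocol is exact, so the same lower bound holds for each \<epsilon> in the
  infimum.\<close>

lemma NE_distillable_ge:
  assumes d: "d \<ge> 7"
  shows "ereal (log 2 ((real d + 2) / (real d - 1))) \<le> distillable_entanglement NE d d (antisym_state d)"
proof -
  let ?r = "log 2 ((real d + 2) / (real d - 1))"
  have d1: "d > 1" using d by simp
  show ?thesis unfolding antisym_distillable_INF[OF d1 disjI1[OF refl]]
  proof (rule INF_greatest)
    fix \<epsilon> :: real assume \<epsilon>: "\<epsilon> \<in> {0<..<1}"
    have "ereal ?r = liminf (\<lambda>n. ereal (1 / real n * (real n * ?r + (- 1))))"
      by (rule lim_imp_Liminf[OF _ rate_tendsto, symmetric]) simp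
    also have "\<dots> \<le> liminf (\<lambda>n. ereal (1 / real n * real (one_shot_distillable NE (d ^ n) (d ^ n) \<epsilon> (bip_power d d (antisym_state d) n))))"
      using NE_one_shot_ge[OF d, of \<epsilon>] \<epsilon>
      by (intro Liminf_mono always_eventually allI) (simp only: ereal_less_eq(3), intro mult_left_mono, auto)
    finally show "ereal ?r \<le> liminf (\<lambda>n. ereal (1 / real n * real (one_shot_distillable NE (d ^ n) (d ^ n) \<epsilon> (bip_power d d (antisym_state d) n))))" .
  qed
qed

theorem mainTheorem5:
  shows "\<forall>\<^sub>F d in sequentially.
    distillable_entanglement DNE d d (antisym_state d) < distillable_entanglement NE d d (antisym_state d)"
  using eventually_ge_at_top[of 7]
proof eventually_elim
  case (elim d)
  have "distillable_entanglement DNE d d (antisym_state d) \<le> ereal (log 2 ((real d + 1) / (real d - 1)))"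
    using elim by (intro DNE_distillable_le) simp
  also have "\<dots> < ereal (log 2 ((real d + 2) / (real d - 1)))"
    using elim by (simp add: divide_strict_right_mono)
  also have "\<dots> \<le> distillable_entanglement NE d d (antisym_state d)" by (rule NE_distillable_ge[OF elim])
  finally show ?case .
qed

end
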